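(* There is an absolute constant $c_0\in(0,1/4)$ such that for every constant $C>0$ and every $\xi\in(0,c_0]$ there is a constant $K>0$ (depending only on $C$ and $\xi$) for which the following holds. For all integers $d\ge 1$, all $\gamma,\alpha\in(0,c_0]$, all $\epsilon\in(0,C]$ and all $\delta\in(0,1)$, writing $L=K\,\alpha^{-K}\left(\log\frac{1}{\alpha\gamma\delta}\right)^{K}$, there exists an $(\epsilon,\delta)$-DP $(\gamma,0.9\gamma)$-robust learner in dimension $d$, with accuracy parameter $\alpha$ and failure probability $\xi$, whose sample complexity $n$ satisfies $$n\ \le\ L\cdot\frac1\epsilon\max\left\{\frac{\sqrt d}{\gamma},\frac{1}{\gamma^2}\right\}$$ and whose running time is at most $L\cdot \dfrac{nd}{\gamma}$.
   Context: Let $\mathbb{B}^d=\{\mathbf{x}\in\mathbb{R}^d:\|\mathbf{x}\|_2\le 1\}$. For $\mathbf{w}\in\mathbb{R}^d$ the halfspace $h_{\mathbf{w}}:\mathbb{B}^d\to\{\pm1\}$ is $h_{\mathbf{w}}(\mathbf{x})=\operatorname{sgn}(\langle \mathbf{w},\mathbf{x}\rangle)$, with $\operatorname{sgn}(t)=+1$ for $t\ge 0$ and $-1$ for $t<0$. For $\gamma\ge 0$, a hypothesis $h:\mathbb{B}^d\to\{\pm1\}$ and a distribution $\mathcal{D}$ on $\mathbb{B}^d\times\{\pm1\}$, the robust risk is $\mathcal{R}_\gamma(h,\mathcal{D})=\Pr_{(\mathbf{x},y)\sim\mathcal{D}}[\exists \mathbf{z}\in\mathbb{B}^d:\ \|\mathbf{z}-\mathbf{x}\|_2\le\gamma,\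 h(\mathbf{z})\ne y]$. $\mathcal{D}$ is $\gamma$-realizable if there is $\mathbf{w}^*\in\mathbb{R}^d$ with $\mathcal{R}_\gamma(h_{\mathbf{w}^*},\mathcal{D})=0$. A learner is a randomized algorithm $\mathbb{A}$ that takes a finite dataset of labelled points in $\mathbb{B}^d\times\{\pm1\}$ and outputs a hypothesis $h:\mathbb{B}^d\to\{\pm1\}$. It is a $(\gamma,\gamma')$-robust learner with accuracy $\alpha$, failure probability $\xi$ and sample complexity $n$ if, for every $\gamma$-realizable $\mathcal{D}$, when run on $n$ i.i.d. samples from $\mathcal{D}$ it outputs, with probability at least $1-\xi$, a hypothesis $h$ with $\mathcal{R}_{\gamma'}(h,\mathcal{D})\le\alpha$. Two datasets are neighbors if one results from the other by adding or removing a single data point. A randomized algorithm $\mathbb{A}$ is $(\epsilon,\delta)$-DP if for all neighboring datasets $\mathbf{X},\mathbf{X}'$ and all sets $S$ of outputs, $\Pr[\mathbb{A}(\mathbf{X})\in S]\le e^{\epsilon}\Pr[\mathbb{A}(\mathbf{X}')\in S]+\delta$. *)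

theory Defs
  imports "HOL-Probability.Probability"
begin

section \<open>Points, labels, hypotheses\<close>

text \<open>
  The dimension \<open>d\<close> is quantified inside the theorem (after the constant \<open>K\<close>), so it cannot be a
  type. A vector of dimension \<open>d\<close> is a function on \<open>{..<d}\<close>, extended by \<open>undefined\<close> as in
  \<open>Pi\<^sub>M\<close>. Labels are the reals \<open>-1\<close> and \<open>1\<close>.
\<close>

type_synonym point = "nat \<Rightarrow> real"
type_synonym example = "point \<times> real"
type_synonym hypothesis = "point \<Rightarrow> real"

definition unit_ball :: "nat \<Rightarrow> point set" where
  "unit_ball d = {x \<in> extensional {..<d}. L2_set x {..<d} \<le> 1}"

definition labels :: "real set" where
  "labels = {- 1, 1}"

definition sgn_pm :: "real \<Rightarrow> real" where
  "sgn_pm t = (if t \<ge> 0 then 1 else - 1)"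

definition halfspace :: "nat \<Rightarrow> point \<Rightarrow> hypothesis" where
  "halfspace d w x = sgn_pm (\<Sum>i<d. w i * x i)"

definition example_space :: "nat \<Rightarrow> example measure" where
  "example_space d =
     restrict_space (Pi\<^sub>M {..<d} (\<lambda>_. borel)) (unit_ball d) \<Otimes>\<^sub>M count_space labels"

definition distribution :: "nat \<Rightarrow> example measure \<Rightarrow> bool" where
  "distribution d D \<longleftrightarrow> prob_space D \<and> sets D = sets (example_space d)"

definition datasets :: "nat \<Rightarrow> example list set" where
  "datasets d = lists (unit_ball d \<times> labels)"

definition robust_error :: "nat \<Rightarrow> real \<Rightarrow> hypothesis \<Rightarrow> example set" where
  "robust_error d \<gamma> h = {(x, y) \<in> unit_ball d \<times> labels.
     \<exists>z \<in> unit_ball d. L2_set (\<lambda>i. z i - x i) {..<d} \<le> \<gamma> \<and> h z \<noteq> y}"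

text \<open>
  For an arbitrary hypothesis the robust error event need not be measurable, and \<open>measure\<close> would
  then be \<open>0\<close>. The outer measure coincides with the probability for measurable events
  (lemma \<open>outer_measure_of_eq\<close>) and does not reward non-measurable ones.
\<close>

definition robust_risk :: "nat \<Rightarrow> real \<Rightarrow> hypothesis \<Rightarrow> example measure \<Rightarrow> ennreal" where
  "robust_risk d \<gamma> h D = outer_measure_of D (robust_error d \<gamma> h)"

definition realizable :: "nat \<Rightarrow> real \<Rightarrow> example measure \<Rightarrow> bool" where
  "realizable d \<gamma> D \<longleftrightarrow>
     (\<exists>w \<in> extensional {..<d}. robust_risk d \<gamma> (halfspace d w) D = 0)"

section \<open>Robust learners and differential privacy\<close>

text \<open>
  A randomized algorithm is a function of its input and of an outcome of a probability space \<open>M\<close>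
  of coins.
\<close>

definition robust_learner ::
  "nat \<Rightarrow> real \<Rightarrow> real \<Rightarrow> real \<Rightarrow> real \<Rightarrow> nat \<Rightarrow> 'c measure \<Rightarrow>
     (example list \<Rightarrow> 'c \<Rightarrow> hypothesis) \<Rightarrow> bool" where
  "robust_learner d \<gamma> \<gamma>' \<alpha> \<xi> n M A \<longleftrightarrow>
     (\<forall>D. distribution d D \<and> realizable d \<gamma> D \<longrightarrow>
        measure (Pi\<^sub>M {..<n} (\<lambda>_. D) \<Otimes>\<^sub>M M)
          {(s, \<omega>) \<in> space (Pi\<^sub>M {..<n} (\<lambda>_. D) \<Otimes>\<^sub>M M).
             robust_risk d \<gamma>' (A (map s [0..<n]) \<omega>) D \<le> ennreal \<alpha>} \<ge> 1 - \<xi>)"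

definition neighbors :: "'a list \<Rightarrow> 'a list \<Rightarrow> bool" where
  "neighbors X X' \<longleftrightarrow>
     (\<exists>us p vs. (X = us @ vs \<and> X' = us @ p # vs) \<or> (X = us @ p # vs \<and> X' = us @ vs))"

definition differentially_private ::
  "'a list set \<Rightarrow> 'c measure \<Rightarrow> 'o measure \<Rightarrow> real \<Rightarrow> real \<Rightarrow> ('a list \<Rightarrow> 'c \<Rightarrow> 'o) \<Rightarrow> bool" where
  "differentially_private U M N \<epsilon> \<delta> A \<longleftrightarrow>
     (\<forall>X \<in> U. A X \<in> M \<rightarrow>\<^sub>M N) \<and>
     (\<forall>X \<in> U. \<forall>X' \<in> U. neighbors X X' \<longrightarrow> (\<forall>S \<in> sets N.
        measure M {\<omega> \<in> space M. A X \<omega> \<in> S}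
          \<le> exp \<epsilon> * measure M {\<omega> \<in> space M. A X' \<omega> \<in> S} + \<delta>))"

section \<open>Real RAM programs\<close>

text \<open>
  The machine has natural-number registers (used for counters and addresses), real registers, and
  three unbounded real arrays. Every instruction and every test costs one step. Rounding reals to
  integers and multiplying natural numbers are deliberately absent: at unit cost, they would allow
  packing long computations into single numbers.
\<close>

datatype bank = Inp | Work | Out

datatype instr =
    NConst nat nat
  | NAdd nat nat nat
  | NSub nat nat nat
  | RConst nat real
  | RAdd nat nat nat
  | RSub nat nat nat
  | RMul nat nat nat
  | RDiv nat nat nat
  | RSqrt nat nat
  | Load nat bank nat
  | Store bank nat nat
  | DrawUniform nat
  | DrawNormal nat

datatype test = NLess nat nat | RLess nat nat

datatype program =
    Skip
  | Do instr
  | Seq program program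
  | Cond test program program
  | While test program

record state =
  nreg :: "nat \<Rightarrow> nat"
  rreg :: "nat \<Rightarrow> real"
  mem :: "bank \<Rightarrow> nat \<Rightarrow> real"
  upos :: nat
  npos :: nat

text \<open>
  The coins are an infinite sequence of independent uniform samples from \<open>[0, 1]\<close> and one of
  independent standard normal samples. \<open>upos\<close> and \<open>npos\<close> count the samples consumed so far.
\<close>

type_synonym coins = "(nat \<Rightarrow> real) \<times> (nat \<Rightarrow> real)"

definition coin_space :: "coins measure" where
  "coin_space =
     Pi\<^sub>M UNIV (\<lambda>_. uniform_measure lborel {0..1}) \<Otimes>\<^sub>M
     Pi\<^sub>M UNIV (\<lambda>_. density lborel std_normal_density)"

fun exec_instr :: "coins \<Rightarrow> instr \<Rightarrow> state \<Rightarrow> state" where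
  "exec_instr \<omega> (NConst r c) s = s\<lparr>nreg := (nreg s)(r := c)\<rparr>"
| "exec_instr \<omega> (NAdd r a b) s = s\<lparr>nreg := (nreg s)(r := nreg s a + nreg s b)\<rparr>"
| "exec_instr \<omega> (NSub r a b) s = s\<lparr>nreg := (nreg s)(r := nreg s a - nreg s b)\<rparr>"
| "exec_instr \<omega> (RConst r c) s = s\<lparr>rreg := (rreg s)(r := c)\<rparr>"
| "exec_instr \<omega> (RAdd r a b) s = s\<lparr>rreg := (rreg s)(r := rreg s a + rreg s b)\<rparr>"
| "exec_instr \<omega> (RSub r a b) s = s\<lparr>rreg := (rreg s)(r := rreg s a - rreg s b)\<rparr>"
| "exec_instr \<omega> (RMul r a b) s = s\<lparr>rreg := (rreg s)(r := rreg s a * rreg s b)\<rparr>"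
| "exec_instr \<omega> (RDiv r a b) s = s\<lparr>rreg := (rreg s)(r := rreg s a / rreg s b)\<rparr>"
| "exec_instr \<omega> (RSqrt r a) s = s\<lparr>rreg := (rreg s)(r := sqrt (rreg s a))\<rparr>"
| "exec_instr \<omega> (Load r m a) s = s\<lparr>rreg := (rreg s)(r := mem s m (nreg s a))\<rparr>"
| "exec_instr \<omega> (Store m a r) s =
     s\<lparr>mem := (mem s)(m := (mem s m)(nreg s a := rreg s r))\<rparr>"
| "exec_instr \<omega> (DrawUniform r) s =
     s\<lparr>rreg := (rreg s)(r := fst \<omega> (upos s)), upos := Suc (upos s)\<rparr>"
| "exec_instr \<omega> (DrawNormal r) s =
     s\<lparr>rreg := (rreg s)(r := snd \<omega> (npos s)), npos := Suc (npos s)\<rparr>"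

fun holds :: "test \<Rightarrow> state \<Rightarrow> bool" where
  "holds (NLess a b) s \<longleftrightarrow> nreg s a < nreg s b"
| "holds (RLess a b) s \<longleftrightarrow> rreg s a < rreg s b"

text \<open>
  \<open>exec \<omega> P s t s'\<close>: started in state \<open>s\<close> with coins \<open>\<omega>\<close>, the program \<open>P\<close> halts in state \<open>s'\<close>
  after \<open>t\<close> steps.
\<close>

inductive exec :: "coins \<Rightarrow> program \<Rightarrow> state \<Rightarrow> nat \<Rightarrow> state \<Rightarrow> bool" for \<omega> where
  Skip: "exec \<omega> Skip s 0 s"
| Do: "exec \<omega> (Do i) s 1 (exec_instr \<omega> i s)"
| Seq: "exec \<omega> P s t s' \<Longrightarrow> exec \<omega> Q s' u s'' \<Longrightarrow> exec \<omega> (Seq P Q) s (t + u) s''"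
| CondTrue: "holds b s \<Longrightarrow> exec \<omega> P s t s' \<Longrightarrow> exec \<omega> (Cond b P Q) s (Suc t) s'"
| CondFalse: "\<not> holds b s \<Longrightarrow> exec \<omega> Q s t s' \<Longrightarrow> exec \<omega> (Cond b P Q) s (Suc t) s'"
| WhileFalse: "\<not> holds b s \<Longrightarrow> exec \<omega> (While b P) s 1 s"
| WhileTrue: "holds b s \<Longrightarrow> exec \<omega> P s t s' \<Longrightarrow> exec \<omega> (While b P) s' u s'' \<Longrightarrow>
    exec \<omega> (While b P) s (Suc (t + u)) s''"

inductive_cases SkipE: "exec \<omega> Skip s t s'"
inductive_cases DoE: "exec \<omega> (Do i) s t s'"
inductive_cases SeqE: "exec \<omega> (Seq P Q) s t s'"
inductive_cases CondE: "exec \<omega> (Cond b P Q) s t s'"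
inductive_cases WhileE: "exec \<omega> (While b P) s t s'"

lemma exec_deterministic:
  "exec \<omega> P s t s' \<Longrightarrow> exec \<omega> P s u s'' \<Longrightarrow> u = t \<and> s'' = s'"
proof (induction arbitrary: u s'' rule: exec.induct)
  case (Skip s)
  then show ?case by (auto elim: SkipE)
next
  case (Do i s)
  then show ?case by (auto elim: DoE)
next
  case (Seq P s t s' Q u' s1)
  from Seq.prems show ?case
    by (rule SeqE) (use Seq.IH in blast)
next
  case (CondTrue b s P t s' Q)
  from CondTrue.prems show ?case
    by (rule CondE) (use CondTrue.IH CondTrue.hyps in blast)+
next
  case (CondFalse b s Q t s' P)
  from CondFalse.prems show ?case
    by (rule CondE) (use CondFalse.IH CondFalse.hyps in blast)+
next
  case (WhileFalse b s P)
  from WhileFalse.prems show ?case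
    by (rule WhileE) (use WhileFalse.hyps in simp_all)
next
  case (WhileTrue b s P t s' u' s1)
  from WhileTrue.prems show ?case
    by (rule WhileE) (use WhileTrue.IH WhileTrue.hyps in blast)+
qed

definition halts :: "coins \<Rightarrow> program \<Rightarrow> state \<Rightarrow> bool" where
  "halts \<omega> P s \<longleftrightarrow> (\<exists>t s'. exec \<omega> P s t s')"

definition steps :: "coins \<Rightarrow> program \<Rightarrow> state \<Rightarrow> nat" where
  "steps \<omega> P s = (THE t. \<exists>s'. exec \<omega> P s t s')"

definition result :: "coins \<Rightarrow> program \<Rightarrow> state \<Rightarrow> state" where
  "result \<omega> P s = (THE s'. \<exists>t. exec \<omega> P s t s')"

lemma exec_result:
  assumes "exec \<omega> P s t s'"
  shows "halts \<omega> P s" "steps \<omega> P s = t" "result \<omega> P s = s'"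
  using assms exec_deterministic[OF assms] unfolding halts_def steps_def result_def by blast+

section \<open>Learners as programs\<close>

text \<open>
  A learner consists of a training program and a prediction program. The training program reads
  the dataset from array \<open>Inp\<close> (row by row, each point followed by its label) and the number of
  examples from register \<open>0\<close>; its output is the final contents of array \<open>Out\<close>, which represents a
  hypothesis. The hypothesis itself is computed by the prediction program from this
  representation (in \<open>Work\<close>) and the point (in \<open>Inp\<close>), as the sign of cell \<open>0\<close> of \<open>Out\<close>.
  Predictions are deterministic: all coins are \<open>0\<close>.
\<close>

definition init_state :: "state" where
  "init_state = \<lparr>nreg = (\<lambda>_. 0), rreg = (\<lambda>_. 0), mem = (\<lambda>_ _. 0), upos = 0, npos = 0\<rparr>"

definition encode_dataset :: "nat \<Rightarrow> example list \<Rightarrow> nat \<Rightarrow> real" where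
  "encode_dataset d X k =
     (let i = k div (d + 1); j = k mod (d + 1) in
      if i < length X then (if j < d then fst (X ! i) j else snd (X ! i)) else 0)"

definition train_state :: "nat \<Rightarrow> example list \<Rightarrow> state" where
  "train_state d X = init_state\<lparr>nreg := (\<lambda>_. 0)(0 := length X),
     mem := (\<lambda>_ _. 0)(Inp := encode_dataset d X)\<rparr>"

definition predict_state :: "nat \<Rightarrow> (nat \<Rightarrow> real) \<Rightarrow> point \<Rightarrow> state" where
  "predict_state d \<theta> x = init_state\<lparr>
     mem := (\<lambda>_ _. 0)(Inp := (\<lambda>k. if k < d then x k else 0), Work := \<theta>)\<rparr>"

definition no_coins :: coins where
  "no_coins = (\<lambda>_. 0, \<lambda>_. 0)"

definition trained :: "nat \<Rightarrow> program \<Rightarrow> example list \<Rightarrow> coins \<Rightarrow> (nat \<Rightarrow> real)" where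
  "trained d P X \<omega> = mem (result \<omega> P (train_state d X)) Out"

definition predictor :: "nat \<Rightarrow> program \<Rightarrow> (nat \<Rightarrow> real) \<Rightarrow> hypothesis" where
  "predictor d Q \<theta> x = sgn_pm (mem (result no_coins Q (predict_state d \<theta> x)) Out 0)"

definition learner :: "nat \<Rightarrow> program \<Rightarrow> program \<Rightarrow> bool" where
  "learner d P Q \<longleftrightarrow>
     (\<forall>X \<in> datasets d. \<forall>\<omega>. halts \<omega> P (train_state d X) \<and>
        (\<forall>x \<in> unit_ball d. halts no_coins Q (predict_state d (trained d P X \<omega>) x)))"

text \<open>
  The running time also bounds the evaluation of the hypothesis at a point, since otherwise the
  training program could postpone all its work to prediction.
\<close>

definition runs_in_time :: "nat \<Rightarrow> nat \<Rightarrow> real \<Rightarrow> program \<Rightarrow> program \<Rightarrow> bool" where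
  "runs_in_time d n T P Q \<longleftrightarrow>
     (\<forall>X \<in> datasets d. length X = n \<longrightarrow> (\<forall>\<omega>.
        real (steps \<omega> P (train_state d X)) \<le> T \<and>
        (\<forall>x \<in> unit_ball d.
           real (steps no_coins Q (predict_state d (trained d P X \<omega>) x)) \<le> T)))"

text \<open>Privacy is required of the released representation, hence of the hypothesis.\<close>

definition private_learner :: "nat \<Rightarrow> real \<Rightarrow> real \<Rightarrow> program \<Rightarrow> bool" where
  "private_learner d \<epsilon> \<delta> P \<longleftrightarrow>
     differentially_private (datasets d) coin_space (Pi\<^sub>M UNIV (\<lambda>_. borel)) \<epsilon> \<delta> (trained d P)"

end

theory Submission
  imports Defs
begin

text \<open>
  The learner makes one pass of projected stochastic gradient descent over the sample, with the
  gradient of a Huberised hinge loss clipped at the margin \<open>\<gamma>\<close>, and releases the average iterate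
  plus one Gaussian vector. A gradient step with a convex smooth loss is nonexpansive, so adding or
  removing an example moves the average only by a multiple of the length \<open>\<eta> * \<gamma>\<close> of a single step, and the
  output perturbation is private without any composition over the iterations. On realizable data the
  squared distance to a separator decreases with every margin violation; since every iterate is tested
  on a fresh example, this bounds the expected loss of the average by a multiple of \<open>1 / (n * \<gamma> * \<eta>)\<close>.
  With \<open>\<eta>\<close> of order \<open>1 / (n * \<alpha> * \<xi> * \<gamma>\<^sup>2)\<close>, the noise is negligible against the norm of the weight vector
  as soon as \<open>n\<close> exceeds \<open>sqrt d / (\<epsilon> * \<gamma>)\<close>, and against the margin as soon as \<open>n\<close> exceeds \<open>1 / (\<epsilon> * \<gamma>\<^sup>2)\<close>,
  up to factors in \<open>\<alpha>\<close>, \<open>\<xi>\<close> and \<open>ln (1 / (\<alpha> * \<gamma> * \<delta>))\<close>. Only second moments and Markov's inequality are used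
  for utility, as \<open>\<xi>\<close> is a constant.
\<close>

section \<open>Vectors of varying dimension\<close>

text \<open>Privacy must hold between datasets of every length, while the number \<open>n\<close> of
  processed rows is fixed and an insertion shifts all later rows. The sum of the iterates is
  therefore truncated after \<open>n\<close> rows and always divided by \<open>n\<close>. An
  inserted row then acts through one displaced step, which later steps carry along without
  amplifying it, and through the exchange of one iterate for another, which is the term
  \<open>2 / n\<close> of the sensitivity. All iterates stay in the unit ball, where the separator
  has margin at least \<open>\<gamma>\<close> without normalisation, so an upper bound on the norm
  of the output suffices to turn its functional margin into robustness. The gap between
  \<open>\<gamma>\<close> and \<open>0.9 * \<gamma>\<close> pays for the level
  \<open>0.98 * \<gamma>\<close> of the comparison loss, for the noise in the norm and for the noise
  in the margin. Noise enters the norm through all \<open>d + 1\<close> coordinates, but the margin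
  of a fixed example through a single direction; these two second moments produce the two terms of
  \<open>max (sqrt d / \<gamma>) (1 / \<gamma>\<^sup>2)\<close>. Taking expectations of the risk
  requires its measurability, which is not evident from an uncountable union over perturbed
  points.\<close>

definition ip :: "nat \<Rightarrow> point \<Rightarrow> point \<Rightarrow> real" where
  "ip m u v = (\<Sum>i<m. u i * v i)"

lemma ip_commute: "ip m u v = ip m v u"
  by (simp add: ip_def mult.commute)

lemma ip_self_nonneg [simp]: "0 \<le> ip m u u"
  by (simp add: ip_def sum_nonneg)

lemma L2_set_eq_sqrt_ip: "L2_set u {..<m} = sqrt (ip m u u)"
  by (simp add: L2_set_def ip_def power2_eq_square)

lemma ip_add_left: "ip m (\<lambda>i. u i + v i) w = ip m u w + ip m v w"
  and ip_diff_left: "ip m (\<lambda>i. u i - v i) w = ip m u w - ip m v w"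
  and ip_scale_left: "ip m (\<lambda>i. c * u i) w = c * ip m u w"
  and ip_add_right: "ip m w (\<lambda>i. u i + v i) = ip m w u + ip m w v"
  and ip_diff_right: "ip m w (\<lambda>i. u i - v i) = ip m w u - ip m w v"
  and ip_scale_right: "ip m w (\<lambda>i. c * u i) = c * ip m w u"
  by (simp_all add: ip_def sum.distrib sum_subtractf sum_distrib_left algebra_simps)

lemmas ip_bilinear = ip_add_left ip_diff_left ip_scale_left ip_add_right ip_diff_right ip_scale_right

lemma ip_le_L2_set: "\<bar>ip m u v\<bar> \<le> L2_set u {..<m} * L2_set v {..<m}"
proof -
  have "\<bar>ip m u v\<bar> \<le> (\<Sum>i<m. \<bar>u i\<bar> * \<bar>v i\<bar>)"
    unfolding ip_def by (rule order_trans[OF sum_abs]) (simp add: abs_mult)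
  also have "\<dots> \<le> L2_set u {..<m} * L2_set v {..<m}"
    by (rule L2_set_mult_ineq)
  finally show ?thesis .
qed

lemma ip_le_1:
  assumes "ip m u u \<le> 1" "ip m v v \<le> 1"
  shows "ip m u v \<le> 1"
proof -
  have "0 \<le> ip m (\<lambda>i. u i - v i) (\<lambda>i. u i - v i)" by simp
  then have "2 * ip m u v \<le> ip m u u + ip m v v"
    by (simp only: ip_bilinear ip_commute[of m v u])
  then show ?thesis using assms by simp
qed

lemma L2_set_diff_triangle:
  "L2_set (\<lambda>i. u i - w i) A \<le> L2_set (\<lambda>i. u i - v i) A + L2_set (\<lambda>i. v i - w i) A"
  using L2_set_triangle_ineq[of "\<lambda>i. u i - v i" "\<lambda>i. v i - w i" A] by simp

lemma L2_set_sum_le: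
  "L2_set (\<lambda>i. \<Sum>k\<in>K. f k i) A \<le> (\<Sum>k\<in>K. L2_set (f k) A)"
proof (induction K rule: infinite_finite_induct)
  case (insert k K)
  then have "L2_set (\<lambda>i. \<Sum>k\<in>insert k K. f k i) A = L2_set (\<lambda>i. f k i + (\<Sum>k\<in>K. f k i)) A"
    by simp
  then show ?case
    using L2_set_triangle_ineq[of "f k" "\<lambda>i. \<Sum>k\<in>K. f k i" A] insert by simp
qed (simp_all add: L2_set_def)

section \<open>Projection onto the unit ball\<close>

definition project :: "nat \<Rightarrow> point \<Rightarrow> point" where
  "project m w = (\<lambda>i. w i / max 1 (sqrt (ip m w w)))"

lemma project_ip_le_1: "ip m (project m w) (project m w) \<le> 1"
proof -
  let ?r = "max 1 (sqrt (ip m w w))"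
  have "ip m (project m w) (project m w) = ip m w w / ?r\<^sup>2"
    by (simp add: project_def ip_def sum_divide_distrib power2_eq_square)
  moreover have "ip m w w \<le> ?r\<^sup>2"
    using real_sqrt_pow2[OF ip_self_nonneg[of m w]]
    by (metis max.cobounded2 power_mono real_sqrt_ge_zero ip_self_nonneg)
  ultimately show ?thesis by (simp add: divide_le_eq_1)
qed

lemma project_id: "ip m w w \<le> 1 \<Longrightarrow> project m w = w"
  by (simp add: project_def max_absorb1)

text \<open>The variational inequality of a convex projection. Outside the ball
  \<open>w = r * p\<close> with \<open>r > 1\<close> and \<open>p\<close> of norm 1, so the left
  side is \<open>r - 1\<close> times \<open>ip m p q - 1\<close>, and Cauchy-Schwarz decides the
  sign.\<close>

lemma project_obtuse:
  assumes "ip m q q \<le> 1"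
  shows "ip m (\<lambda>i. w i - project m w i) (\<lambda>i. q i - project m w i) \<le> 0"
proof (cases "ip m w w \<le> 1")
  case True
  then show ?thesis by (simp add: project_id ip_def)
next
  case False
  define r where "r = sqrt (ip m w w)"
  have r: "r > 1" using False by (simp add: r_def)
  define p where "p = project m w"
  have p: "p = (\<lambda>i. w i / r)" using r by (simp add: p_def project_def r_def[symmetric] max_def)
  have w: "w = (\<lambda>i. r * p i)" using r by (simp add: p)
  have "r\<^sup>2 = ip m w w" by (simp add: r_def)
  also have "\<dots> = r * (r * ip m p p)" by (subst (1 2) w) (simp only: ip_bilinear)
  finally have pp: "ip m p p = 1" using r by (simp add: power2_eq_square)
  have "ip m (\<lambda>i. w i - p i) (\<lambda>i. q i - p i) = (r - 1) * (ip m p q - ip m p p)"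
    by (subst w, simp only: ip_bilinear) (simp add: algebra_simps)
  also have "\<dots> \<le> 0"
    using r ip_le_1[of m p q] pp assms by (intro mult_nonneg_nonpos) auto
  finally show ?thesis by (simp add: p_def)
qed

text \<open>Adding the two obtuse-angle inequalities shows that the squared distance of the
  projections is at most the inner product of \<open>u - v\<close> with their difference. The
  nonnegative square of the difference of the residuals turns this into the claim.\<close>

lemma project_nonexpansive:
  "ip m (\<lambda>i. project m u i - project m v i) (\<lambda>i. project m u i - project m v i)
    \<le> ip m (\<lambda>i. u i - v i) (\<lambda>i. u i - v i)"
proof -
  define p q where "p = project m u" and "q = project m v"
  have 1: "ip m (\<lambda>i. u i - p i) (\<lambda>i. q i - p i) \<le> 0"
    unfolding p_def q_def by (rule project_obtuse[OF project_ip_le_1])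
  have 2: "ip m (\<lambda>i. v i - q i) (\<lambda>i. p i - q i) \<le> 0"
    unfolding p_def q_def by (rule project_obtuse[OF project_ip_le_1])
  have 3: "0 \<le> ip m (\<lambda>i. (u i - p i) - (v i - q i)) (\<lambda>i. (u i - p i) - (v i - q i))"
    by simp
  show ?thesis
    using 1 2 3 unfolding p_def[symmetric] q_def[symmetric]
    by (simp only: ip_bilinear ip_commute[of m p u] ip_commute[of m p v] ip_commute[of m q u]
        ip_commute[of m q v] ip_commute[of m q p] ip_commute[of m v u])
qed

section \<open>Clipped stochastic gradient steps\<close>

text \<open>The additional constant coordinate \<open>\<gamma>\<close> makes the constant hypothesis \<open>1\<close>, which is the
  halfspace of the vector \<open>0\<close>, separate with the same margin as a proper halfspace.\<close>

definition augment :: "nat \<Rightarrow> real \<Rightarrow> point \<Rightarrow> point" where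
  "augment d \<gamma> x = (\<lambda>i. if i < d then x i else \<gamma>)"

definition margin :: "nat \<Rightarrow> real \<Rightarrow> point \<Rightarrow> example \<Rightarrow> real" where
  "margin d \<gamma> w e = snd e * ip (Suc d) w (augment d \<gamma> (fst e))"

text \<open>The negative derivative of the Huberised hinge loss: 0 above margin
  \<open>\<gamma>\<close>, \<open>(\<gamma> - t)\<^sup>2 / 2\<close> between 0 and
  \<open>\<gamma>\<close>, linear with slope \<open>- \<gamma>\<close> below 0. Being 1-Lipschitz in
  the margin gives stability, being at most \<open>\<gamma>\<close> gives short steps.\<close>

definition pull :: "real \<Rightarrow> real \<Rightarrow> real" where
  "pull \<gamma> t = max 0 (min \<gamma> (\<gamma> - t))"

definition gradient_step :: "nat \<Rightarrow> real \<Rightarrow> real \<Rightarrow> example \<Rightarrow> point \<Rightarrow> point" where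
  "gradient_step d \<gamma> \<eta> e w =
     (\<lambda>i. w i + \<eta> * pull \<gamma> (margin d \<gamma> w e) * snd e * augment d \<gamma> (fst e) i)"

definition sgd_step :: "nat \<Rightarrow> real \<Rightarrow> real \<Rightarrow> example \<Rightarrow> point \<Rightarrow> point" where
  "sgd_step d \<gamma> \<eta> e w = project (Suc d) (gradient_step d \<gamma> \<eta> e w)"

lemma augment_ip_le:
  assumes "x \<in> unit_ball d" "0 \<le> \<gamma>" "\<gamma> \<le> 1"
  shows "ip (Suc d) (augment d \<gamma> x) (augment d \<gamma> x) \<le> 2"
proof -
  have "ip (Suc d) (augment d \<gamma> x) (augment d \<gamma> x) = ip d x x + \<gamma> * \<gamma>"
    by (simp add: ip_def augment_def)
  moreover have "ip d x x \<le> 1"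
    using assms(1) by (simp add: unit_ball_def L2_set_eq_sqrt_ip)
  moreover have "\<gamma> * \<gamma> \<le> 1" using assms by (simp add: mult_le_one)
  ultimately show ?thesis by simp
qed

text \<open>Cocoercivity of the gradient of a smooth convex loss. Since \<open>pull\<close> is
  antitone and 1-Lipschitz, the cross term contributes at most
  \<open>- 2 * \<eta> * b\<^sup>2\<close>; as the augmented point has squared norm at most 2, the
  quadratic term is at most \<open>2 * \<eta>\<^sup>2 * b\<^sup>2\<close>, which
  \<open>\<eta> \<le> 1\<close> absorbs.\<close>

lemma gradient_step_nonexpansive:
  assumes e: "e \<in> unit_ball d \<times> labels" and g: "0 \<le> \<gamma>" "\<gamma> \<le> 1" and h: "0 \<le> \<eta>" "\<eta> \<le> 1"
  shows "ip (Suc d) (\<lambda>i. gradient_step d \<gamma> \<eta> e u i - gradient_step d \<gamma> \<eta> e v i)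
      (\<lambda>i. gradient_step d \<gamma> \<eta> e u i - gradient_step d \<gamma> \<eta> e v i)
    \<le> ip (Suc d) (\<lambda>i. u i - v i) (\<lambda>i. u i - v i)"
proof -
  define x y where "x = augment d \<gamma> (fst e)" and "y = snd e"
  define t t' where "t = margin d \<gamma> u e" and "t' = margin d \<gamma> v e"
  define b where "b = pull \<gamma> t - pull \<gamma> t'"
  define w where "w = (\<lambda>i. u i - v i)"
  have y: "y * y = 1" using e by (auto simp: y_def labels_def)
  have xx: "ip (Suc d) x x \<le> 2"
    unfolding x_def using e g by (intro augment_ip_le) auto
  have wx: "y * ip (Suc d) w x = t - t'"
    unfolding t_def t'_def margin_def w_def x_def y_def by (simp only: ip_bilinear right_diff_distrib)
  have b: "b * (t - t') \<le> - (b * b)"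
  proof -
    have "b * (t - t' + b) \<le> 0"
    proof (cases "t \<le> t'")
      case True
      then have "0 \<le> b" "t - t' + b \<le> 0" by (auto simp: b_def pull_def)
      then show ?thesis by (rule mult_nonneg_nonpos)
    next
      case False
      then have "b \<le> 0" "0 \<le> t - t' + b" by (auto simp: b_def pull_def)
      then show ?thesis by (rule mult_nonpos_nonneg)
    qed
    then show ?thesis by (simp add: algebra_simps)
  qed
  have eq: "(\<lambda>i. gradient_step d \<gamma> \<eta> e u i - gradient_step d \<gamma> \<eta> e v i) = (\<lambda>i. w i + (\<eta> * b * y) * x i)"
    by (simp add: gradient_step_def w_def b_def x_def y_def t_def t'_def algebra_simps)
  have "ip (Suc d) (\<lambda>i. w i + (\<eta> * b * y) * x i) (\<lambda>i. w i + (\<eta> * b * y) * x i)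
      = ip (Suc d) w w + 2 * \<eta> * (b * (y * ip (Suc d) w x)) + \<eta>\<^sup>2 * (y * y) * (b * b) * ip (Suc d) x x"
    by (simp only: ip_bilinear ip_commute[of _ x w]) (simp add: algebra_simps power2_eq_square)
  also have "\<dots> = ip (Suc d) w w + 2 * \<eta> * (b * (t - t')) + \<eta>\<^sup>2 * (b * b) * ip (Suc d) x x"
    by (simp add: wx y)
  also have "\<dots> \<le> ip (Suc d) w w + 2 * \<eta> * (- (b * b)) + \<eta>\<^sup>2 * (b * b) * 2"
    using b xx h by (intro add_mono mult_left_mono) auto
  also have "\<dots> = ip (Suc d) w w - 2 * (b * b) * (\<eta> * (1 - \<eta>))"
    by (simp add: algebra_simps power2_eq_square)
  also have "\<dots> \<le> ip (Suc d) w w"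
    using h by simp
  finally show ?thesis unfolding eq w_def .
qed

lemma sgd_step_nonexpansive:
  assumes "e \<in> unit_ball d \<times> labels" "0 \<le> \<gamma>" "\<gamma> \<le> 1" "0 \<le> \<eta>" "\<eta> \<le> 1"
  shows "L2_set (\<lambda>i. sgd_step d \<gamma> \<eta> e u i - sgd_step d \<gamma> \<eta> e v i) {..<Suc d}
    \<le> L2_set (\<lambda>i. u i - v i) {..<Suc d}"
  unfolding sgd_step_def L2_set_eq_sqrt_ip
  by (intro real_sqrt_le_mono order_trans[OF project_nonexpansive gradient_step_nonexpansive] assms)

lemma sgd_step_ip_le_1: "ip (Suc d) (sgd_step d \<gamma> \<eta> e w) (sgd_step d \<gamma> \<eta> e w) \<le> 1"
  unfolding sgd_step_def by (rule project_ip_le_1)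

text \<open>The projection fixes \<open>w\<close> and is nonexpansive, so only the raw gradient step
  has to be measured. Its coefficient is at most \<open>\<eta> * \<gamma>\<close>, and the squared
  norm 2 of the augmented point is rounded up to 4 to have a rational root.\<close>

lemma sgd_step_displacement:
  assumes e: "e \<in> unit_ball d \<times> labels" and g: "0 \<le> \<gamma>" "\<gamma> \<le> 1" and h: "0 \<le> \<eta>"
    and w: "ip (Suc d) w w \<le> 1"
  shows "L2_set (\<lambda>i. sgd_step d \<gamma> \<eta> e w i - w i) {..<Suc d} \<le> 2 * \<eta> * \<gamma>"
proof -
  define x y b where "x = augment d \<gamma> (fst e)" and "y = snd e" and "b = pull \<gamma> (margin d \<gamma> w e)"
  have y: "y * y = 1" using e by (auto simp: y_def labels_def)
  have xx: "ip (Suc d) x x \<le> 2"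
    unfolding x_def using e g by (intro augment_ip_le) auto
  have b: "0 \<le> b" "b \<le> \<gamma>" using g by (auto simp: b_def pull_def)
  have "ip (Suc d) (\<lambda>i. sgd_step d \<gamma> \<eta> e w i - w i) (\<lambda>i. sgd_step d \<gamma> \<eta> e w i - w i)
      \<le> ip (Suc d) (\<lambda>i. gradient_step d \<gamma> \<eta> e w i - w i) (\<lambda>i. gradient_step d \<gamma> \<eta> e w i - w i)"
    using project_nonexpansive[of "Suc d" "gradient_step d \<gamma> \<eta> e w" w]
    by (simp add: sgd_step_def project_id[OF w])
  also have "(\<lambda>i. gradient_step d \<gamma> \<eta> e w i - w i) = (\<lambda>i. (\<eta> * b * y) * x i)"
    by (simp add: gradient_step_def x_def y_def b_def)
  also have "ip (Suc d) \<dots> \<dots> = (\<eta> * b * y) * ((\<eta> * b * y) * ip (Suc d) x x)"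
    by (simp only: ip_scale_left ip_scale_right)
  also have "\<dots> = (\<eta> * b)\<^sup>2 * (y * y) * ip (Suc d) x x"
    by (simp add: algebra_simps power2_eq_square)
  also have "\<dots> \<le> (\<eta> * \<gamma>)\<^sup>2 * 1 * 4"
    using y xx b h by (intro mult_mono power_mono) auto
  also have "\<dots> = (2 * \<eta> * \<gamma>)\<^sup>2" by (simp add: power2_eq_square)
  finally show ?thesis
    unfolding L2_set_eq_sqrt_ip using h g by (intro real_le_lsqrt) auto
qed

text \<open>The perceptron-style potential argument. With \<open>t\<close> the margin of
  \<open>w\<close>, the cross term is at most \<open>- 2 * \<eta> * b * (\<gamma> - t)\<close>,
  because \<open>u\<close> has margin at least \<open>\<gamma>\<close>. From
  \<open>b\<^sup>2 \<le> b * (\<gamma> - t)\<close> and \<open>\<eta> \<le> 1/2\<close>, the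
  quadratic term eats at most half of it; the other half is the progress.\<close>

lemma sgd_step_progress:
  assumes e: "e \<in> unit_ball d \<times> labels" and g: "0 \<le> \<gamma>" "\<gamma> \<le> 1" and h: "0 \<le> \<eta>" "\<eta> \<le> 1/2"
    and u: "ip (Suc d) u u \<le> 1" and mu: "\<gamma> \<le> margin d \<gamma> u e"
  shows "ip (Suc d) (\<lambda>i. sgd_step d \<gamma> \<eta> e w i - u i) (\<lambda>i. sgd_step d \<gamma> \<eta> e w i - u i)
    + \<eta> * (pull \<gamma> (margin d \<gamma> w e) * (\<gamma> - margin d \<gamma> w e))
    \<le> ip (Suc d) (\<lambda>i. w i - u i) (\<lambda>i. w i - u i)"
proof -
  define x y t where "x = augment d \<gamma> (fst e)" and "y = snd e" and "t = margin d \<gamma> w e"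
  define b where "b = pull \<gamma> t"
  define v where "v = (\<lambda>i. w i - u i)"
  have y: "y * y = 1" using e by (auto simp: y_def labels_def)
  have xx: "ip (Suc d) x x \<le> 2"
    unfolding x_def using e g by (intro augment_ip_le) auto
  have b: "0 \<le> b" "b * b \<le> b * (\<gamma> - t)" using g by (auto simp: b_def pull_def min_def max_def mult_left_mono)
  have vx: "y * ip (Suc d) v x = t - margin d \<gamma> u e"
    unfolding t_def margin_def v_def x_def y_def by (simp only: ip_bilinear right_diff_distrib)
  have "ip (Suc d) (\<lambda>i. sgd_step d \<gamma> \<eta> e w i - u i) (\<lambda>i. sgd_step d \<gamma> \<eta> e w i - u i)
      \<le> ip (Suc d) (\<lambda>i. gradient_step d \<gamma> \<eta> e w i - u i) (\<lambda>i. gradient_step d \<gamma> \<eta> e w i - u i)"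
    using project_nonexpansive[of "Suc d" "gradient_step d \<gamma> \<eta> e w" u]
    by (simp add: sgd_step_def project_id[OF u])
  also have "(\<lambda>i. gradient_step d \<gamma> \<eta> e w i - u i) = (\<lambda>i. v i + (\<eta> * b * y) * x i)"
    by (simp add: gradient_step_def v_def b_def x_def y_def t_def algebra_simps)
  also have "ip (Suc d) \<dots> \<dots> = ip (Suc d) v v + 2 * \<eta> * (b * (y * ip (Suc d) v x))
      + \<eta>\<^sup>2 * (y * y) * (b * b) * ip (Suc d) x x"
    by (simp only: ip_bilinear ip_commute[of _ x v]) (simp add: algebra_simps power2_eq_square)
  also have "\<dots> = ip (Suc d) v v + 2 * \<eta> * (b * (t - margin d \<gamma> u e)) + \<eta>\<^sup>2 * (b * b) * ip (Suc d) x x"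
    by (simp add: vx y)
  also have "\<dots> \<le> ip (Suc d) v v + 2 * \<eta> * (b * (t - \<gamma>)) + (\<eta> * (1/2)) * (b * (\<gamma> - t)) * 2"
  proof -
    have "\<eta>\<^sup>2 \<le> \<eta> * (1/2)" using mult_left_mono[OF h(2) h(1)] by (simp add: power2_eq_square)
    moreover have "b * (t - margin d \<gamma> u e) \<le> b * (t - \<gamma>)" using b mu by (intro mult_left_mono) auto
    moreover have "0 \<le> b * b" by simp
    ultimately have "\<eta>\<^sup>2 * (b * b) \<le> (\<eta> * (1/2)) * (b * (\<gamma> - t))"
      using mult_right_mono[of "\<eta>\<^sup>2" "\<eta> * (1/2)" "b * b"]
        mult_left_mono[of "b * b" "b * (\<gamma> - t)" "\<eta> * (1/2)"] b h by auto
    moreover have "\<eta>\<^sup>2 * (b * b) * ip (Suc d) x x \<le> \<eta>\<^sup>2 * (b * b) * 2"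
      using xx by (intro mult_left_mono) auto
    moreover have "2 * \<eta> * (b * (t - margin d \<gamma> u e)) \<le> 2 * \<eta> * (b * (t - \<gamma>))"
      by (rule mult_left_mono[OF \<open>b * (t - margin d \<gamma> u e) \<le> b * (t - \<gamma>)\<close>]) (use h in simp)
    ultimately show ?thesis by linarith
  qed
  finally show ?thesis
    unfolding v_def b_def t_def by (simp add: algebra_simps)
qed

section \<open>Stability and regret of averaged gradient descent\<close>

definition sgd :: "nat \<Rightarrow> real \<Rightarrow> real \<Rightarrow> example list \<Rightarrow> point \<Rightarrow> point" where
  "sgd d \<gamma> \<eta> X = fold (sgd_step d \<gamma> \<eta>) X"

lemma sgd_Nil [simp]: "sgd d \<gamma> \<eta> [] w = w"
  and sgd_Cons [simp]: "sgd d \<gamma> \<eta> (e # X) w = sgd d \<gamma> \<eta> X (sgd_step d \<gamma> \<eta> e w)"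
  and sgd_append [simp]: "sgd d \<gamma> \<eta> (X @ Y) w = sgd d \<gamma> \<eta> Y (sgd d \<gamma> \<eta> X w)"
  by (simp_all add: sgd_def)

lemma sgd_ip_le_1:
  assumes "ip (Suc d) w w \<le> 1"
  shows "ip (Suc d) (sgd d \<gamma> \<eta> X w) (sgd d \<gamma> \<eta> X w) \<le> 1"
  using assms by (induction X arbitrary: w) (auto simp: sgd_step_ip_le_1)

lemma sgd_nonexpansive:
  assumes "X \<in> datasets d" "0 \<le> \<gamma>" "\<gamma> \<le> 1" "0 \<le> \<eta>" "\<eta> \<le> 1"
  shows "L2_set (\<lambda>i. sgd d \<gamma> \<eta> X u i - sgd d \<gamma> \<eta> X v i) {..<Suc d}
    \<le> L2_set (\<lambda>i. u i - v i) {..<Suc d}"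
  using assms(1)
proof (induction X arbitrary: u v)
  case (Cons e X)
  then show ?case
    unfolding sgd_Cons using assms(2-)
    by (intro order_trans[OF Cons.IH sgd_step_nonexpansive]) (auto simp: datasets_def)
qed simp

text \<open>The iterates before each update: summand \<open>k\<close> has seen only the first
  \<open>k\<close> examples, and the final iterate is left out. This offset is what makes example
  \<open>k\<close> fresh for iterate \<open>k\<close>.\<close>

definition trajectory_sum :: "nat \<Rightarrow> real \<Rightarrow> real \<Rightarrow> example list \<Rightarrow> point \<Rightarrow> point" where
  "trajectory_sum d \<gamma> \<eta> X w = (\<lambda>i. \<Sum>k<length X. sgd d \<gamma> \<eta> (take k X) w i)"

lemma trajectory_sum_append:
  "trajectory_sum d \<gamma> \<eta> (X @ Y) w =
    (\<lambda>i. trajectory_sum d \<gamma> \<eta> X w i + trajectory_sum d \<gamma> \<eta> Y (sgd d \<gamma> \<eta> X w) i)"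
proof (induction Y rule: rev_induct)
  case Nil
  then show ?case by (simp add: trajectory_sum_def)
next
  case (snoc y Y)
  have snoc_eq: "trajectory_sum d \<gamma> \<eta> (Z @ [e]) w = (\<lambda>i. trajectory_sum d \<gamma> \<eta> Z w i + sgd d \<gamma> \<eta> Z w i)"
    for Z e w by (simp add: trajectory_sum_def)
  show ?case
    by (simp only: append_assoc[symmetric] snoc_eq snoc) (simp add: add.assoc)
qed

lemma trajectory_sum_single: "trajectory_sum d \<gamma> \<eta> [e] w = w"
  by (simp add: trajectory_sum_def)

lemma trajectory_sum_nonexpansive:
  assumes "X \<in> datasets d" "0 \<le> \<gamma>" "\<gamma> \<le> 1" "0 \<le> \<eta>" "\<eta> \<le> 1"
  shows "L2_set (\<lambda>i. trajectory_sum d \<gamma> \<eta> X u i - trajectory_sum d \<gamma> \<eta> X v i) {..<Suc d}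
    \<le> length X * L2_set (\<lambda>i. u i - v i) {..<Suc d}"
proof -
  have "take k X \<in> datasets d" for k
    using assms(1) by (auto simp: datasets_def dest: in_set_takeD)
  then have le: "(\<Sum>k<length X. L2_set (\<lambda>i. sgd d \<gamma> \<eta> (take k X) u i - sgd d \<gamma> \<eta> (take k X) v i) {..<Suc d})
      \<le> (\<Sum>k<length X. L2_set (\<lambda>i. u i - v i) {..<Suc d})"
    using assms by (intro sum_mono sgd_nonexpansive)
  have "(\<lambda>i. trajectory_sum d \<gamma> \<eta> X u i - trajectory_sum d \<gamma> \<eta> X v i) =
      (\<lambda>i. \<Sum>k<length X. sgd d \<gamma> \<eta> (take k X) u i - sgd d \<gamma> \<eta> (take k X) v i)"
    by (simp add: trajectory_sum_def sum_subtractf)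
  then have "L2_set (\<lambda>i. trajectory_sum d \<gamma> \<eta> X u i - trajectory_sum d \<gamma> \<eta> X v i) {..<Suc d}
      \<le> (\<Sum>k<length X. L2_set (\<lambda>i. sgd d \<gamma> \<eta> (take k X) u i - sgd d \<gamma> \<eta> (take k X) v i) {..<Suc d})"
    by (simp only: L2_set_sum_le)
  also have "\<dots> \<le> length X * L2_set (\<lambda>i. u i - v i) {..<Suc d}"
    using le by simp
  finally show ?thesis .
qed

lemma L2_set_diff_commute: "L2_set (\<lambda>i. u i - v i) A = L2_set (\<lambda>i. v i - u i) A"
  by (simp add: L2_set_def power2_commute)

text \<open>Both runs agree up to \<open>w\<close>, the iterate reached after \<open>us\<close>. The
  longer one then counts \<open>w\<close> once more and continues on the common rows
  \<open>Y\<close> from \<open>v\<close>, one step away from \<open>w\<close>. Nonexpansiveness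
  keeps each of the at most \<open>n\<close> later differences below the length
  \<open>2 * \<eta> * \<gamma>\<close> of that step; the unmatched iterates \<open>w\<close> and
  \<open>r\<close> lie in the unit ball and cost 2.\<close>

lemma trajectory_sum_insert:
  assumes X: "us @ p # vs \<in> datasets d" and g: "0 \<le> \<gamma>" "\<gamma> \<le> 1" and h: "0 \<le> \<eta>" "\<eta> \<le> 1"
  shows "L2_set (\<lambda>i. trajectory_sum d \<gamma> \<eta> (take n (us @ p # vs)) (\<lambda>_. 0) i
      - trajectory_sum d \<gamma> \<eta> (take n (us @ vs)) (\<lambda>_. 0) i) {..<Suc d}
    \<le> n * (2 * \<eta> * \<gamma>) + 2"
proof (cases "n \<le> length us")
  case True
  then show ?thesis using g h by (simp add: L2_set_def)
next
  case False
  define N where "N = n - Suc (length us)"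
  define w where "w = sgd d \<gamma> \<eta> us (\<lambda>_. 0)"
  define v where "v = sgd_step d \<gamma> \<eta> p w"
  define Y where "Y = take N vs"
  \<comment> \<open>The iterate belonging to the extra row that still fits into the first
    \<open>n\<close> rows when \<open>p\<close> is absent; if \<open>vs\<close> is exhausted there
    is no such row and the contribution is 0.\<close>
  define r where "r = (if N < length vs then sgd d \<gamma> \<eta> Y w else (\<lambda>_. 0))"
  have w: "ip (Suc d) w w \<le> 1"
    unfolding w_def by (rule sgd_ip_le_1) (simp add: ip_def)
  have r: "ip (Suc d) r r \<le> 1"
    using sgd_ip_le_1[OF w] by (auto simp: r_def ip_def)
  have len: "n - length us = Suc N" using False by (simp add: N_def)
  have Y: "Y \<in> datasets d"
    using X by (auto simp: Y_def datasets_def dest: in_set_takeD)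
  have YN: "length Y \<le> n" by (simp add: Y_def N_def)
  have 1: "take n (us @ p # vs) = us @ [p] @ Y"
    using False len by (simp add: Y_def)
  have 2: "take n (us @ vs) = us @ Y @ (if N < length vs then [vs ! N] else [])"
    using False len by (simp add: Y_def take_Suc_conv_app_nth)
  have 3: "trajectory_sum d \<gamma> \<eta> (take n (us @ p # vs)) (\<lambda>_. 0) =
      (\<lambda>i. trajectory_sum d \<gamma> \<eta> us (\<lambda>_. 0) i + (w i + trajectory_sum d \<gamma> \<eta> Y v i))"
    unfolding 1 by (simp add: trajectory_sum_append trajectory_sum_single w_def v_def
        del: append_Cons append_Nil append.simps)
  have 4: "trajectory_sum d \<gamma> \<eta> (take n (us @ vs)) (\<lambda>_. 0) =
      (\<lambda>i. trajectory_sum d \<gamma> \<eta> us (\<lambda>_. 0) i + (trajectory_sum d \<gamma> \<eta> Y w i + r i))"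
    unfolding 2 r_def w_def
    by (auto simp add: trajectory_sum_append trajectory_sum_single) (simp add: trajectory_sum_def)
  have "L2_set (\<lambda>i. trajectory_sum d \<gamma> \<eta> (take n (us @ p # vs)) (\<lambda>_. 0) i
      - trajectory_sum d \<gamma> \<eta> (take n (us @ vs)) (\<lambda>_. 0) i) {..<Suc d}
    = L2_set (\<lambda>i. (trajectory_sum d \<gamma> \<eta> Y v i - trajectory_sum d \<gamma> \<eta> Y w i) + (w i - r i)) {..<Suc d}"
    unfolding 3 4 by (simp add: algebra_simps)
  also have "\<dots> \<le> L2_set (\<lambda>i. trajectory_sum d \<gamma> \<eta> Y v i - trajectory_sum d \<gamma> \<eta> Y w i) {..<Suc d}
      + L2_set (\<lambda>i. w i - r i) {..<Suc d}"
    by (rule L2_set_triangle_ineq)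
  also have "\<dots> \<le> n * (2 * \<eta> * \<gamma>) + 2"
  proof (rule add_mono)
    have "L2_set (\<lambda>i. v i - w i) {..<Suc d} \<le> 2 * \<eta> * \<gamma>"
      unfolding v_def using X g h w by (intro sgd_step_displacement) (auto simp: datasets_def)
    then have "length Y * L2_set (\<lambda>i. v i - w i) {..<Suc d} \<le> n * (2 * \<eta> * \<gamma>)"
      using YN by (intro mult_mono) (auto simp: L2_set_nonneg)
    then show "L2_set (\<lambda>i. trajectory_sum d \<gamma> \<eta> Y v i - trajectory_sum d \<gamma> \<eta> Y w i) {..<Suc d}
        \<le> n * (2 * \<eta> * \<gamma>)"
      using trajectory_sum_nonexpansive[OF Y g h] by (rule order_trans[rotated])
    have "L2_set w {..<Suc d} \<le> 1" "L2_set (\<lambda>i. - r i) {..<Suc d} \<le> 1"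
      using w r by (simp_all add: L2_set_eq_sqrt_ip) (simp add: ip_def)
    then show "L2_set (\<lambda>i. w i - r i) {..<Suc d} \<le> 2"
      using L2_set_triangle_ineq[of w "\<lambda>i. - r i" "{..<Suc d}"] by simp
  qed
  finally show ?thesis .
qed

text \<open>The divisor is \<open>n\<close> even for a shorter dataset: a divisor depending on the
  length would differ between neighbors and enter the sensitivity.\<close>

definition sgd_mean :: "nat \<Rightarrow> real \<Rightarrow> real \<Rightarrow> nat \<Rightarrow> example list \<Rightarrow> point" where
  "sgd_mean d \<gamma> \<eta> n X = (\<lambda>i. trajectory_sum d \<gamma> \<eta> (take n X) (\<lambda>_. 0) i / n)"

lemma sgd_mean_sensitivity:
  assumes X: "X \<in> datasets d" "X' \<in> datasets d" "neighbors X X'"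
    and g: "0 \<le> \<gamma>" "\<gamma> \<le> 1" and h: "0 \<le> \<eta>" "\<eta> \<le> 1" and n: "0 < n"
  shows "L2_set (\<lambda>i. sgd_mean d \<gamma> \<eta> n X i - sgd_mean d \<gamma> \<eta> n X' i) {..<Suc d} \<le> 2 * \<eta> * \<gamma> + 2 / n"
proof -
  let ?T = "\<lambda>X. trajectory_sum d \<gamma> \<eta> (take n X) (\<lambda>_. 0)"
  have "L2_set (\<lambda>i. ?T X i - ?T X' i) {..<Suc d} \<le> n * (2 * \<eta> * \<gamma>) + 2"
    using X(3) unfolding neighbors_def
  proof (elim exE disjE conjE)
    fix us p vs assume "X = us @ vs" "X' = us @ p # vs"
    then show ?thesis
      using trajectory_sum_insert[of us p vs d \<gamma> \<eta> n] X(2) g h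
      by (subst L2_set_diff_commute) simp
  next
    fix us p vs assume "X = us @ p # vs" "X' = us @ vs"
    then show ?thesis
      using trajectory_sum_insert[of us p vs d \<gamma> \<eta> n] X(1) g h by simp
  qed
  then have "(1 / n) * L2_set (\<lambda>i. ?T X i - ?T X' i) {..<Suc d} \<le> (1 / n) * (n * (2 * \<eta> * \<gamma>) + 2)"
    using n by (intro mult_left_mono) auto
  also have "(1 / n) * L2_set (\<lambda>i. ?T X i - ?T X' i) {..<Suc d}
      = L2_set (\<lambda>i. sgd_mean d \<gamma> \<eta> n X i - sgd_mean d \<gamma> \<eta> n X' i) {..<Suc d}"
    by (subst L2_set_right_distrib) (auto simp: sgd_mean_def diff_divide_distrib)
  also have "(1 / n) * (n * (2 * \<eta> * \<gamma>) + 2) = 2 * \<eta> * \<gamma> + 2 / n"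
    using n by (simp add: field_simps)
  finally show ?thesis .
qed

text \<open>Telescoping \<open>sgd_step_progress\<close>: the squared distance to \<open>u\<close>
  starts at no more than 1, because the run starts at 0, and never becomes negative.\<close>

lemma sgd_regret:
  assumes X: "X \<in> datasets d" and g: "0 \<le> \<gamma>" "\<gamma> \<le> 1" and h: "0 \<le> \<eta>" "\<eta> \<le> 1/2"
    and u: "ip (Suc d) u u \<le> 1" "\<And>e. e \<in> set X \<Longrightarrow> \<gamma> \<le> margin d \<gamma> u e"
  shows "\<eta> * (\<Sum>k<length X. pull \<gamma> (margin d \<gamma> (sgd d \<gamma> \<eta> (take k X) (\<lambda>_. 0)) (X ! k))
      * (\<gamma> - margin d \<gamma> (sgd d \<gamma> \<eta> (take k X) (\<lambda>_. 0)) (X ! k))) \<le> 1"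
proof -
  define w where "w k = sgd d \<gamma> \<eta> (take k X) (\<lambda>_. 0)" for k
  define a where "a k = pull \<gamma> (margin d \<gamma> (w k) (X ! k)) * (\<gamma> - margin d \<gamma> (w k) (X ! k))" for k
  have step: "w (Suc k) = sgd_step d \<gamma> \<eta> (X ! k) (w k)" if "k < length X" for k
    using that by (simp add: w_def take_Suc_conv_app_nth)
  have "ip (Suc d) (\<lambda>i. w m i - u i) (\<lambda>i. w m i - u i) + \<eta> * (\<Sum>k<m. a k) \<le> 1" if "m \<le> length X" for m
    using that
  proof (induction m)
    case 0
    then show ?case using u(1) by (simp add: w_def ip_def)
  next
    case (Suc m)
    then have m: "m < length X" by simp
    then have "X ! m \<in> set X" by simp
    moreover from this have "X ! m \<in> unit_ball d \<times> labels" using X by (auto simp: datasets_def)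
    ultimately show ?case
      using sgd_step_progress[OF _ g h u(1), of "X ! m" "w m"] u(2) Suc
      by (simp add: step[OF m] a_def[symmetric] distrib_left)
  qed
  from this[of "length X"] have "\<eta> * (\<Sum>k<length X. a k) \<le> 1"
    using ip_self_nonneg[of "Suc d" "\<lambda>i. w (length X) i - u i"] by linarith
  then show ?thesis by (simp add: a_def w_def)
qed

section \<open>The Gaussian mechanism\<close>

abbreviation gauss :: "real measure" where
  "gauss \<equiv> density lborel std_normal_density"

lemma sets_gauss [measurable_cong]: "sets gauss = sets borel"
  by simp

lemma prob_space_gauss: "prob_space gauss"
  by (rule prob_space_normal_density) simp

interpretation gauss: prob_space gauss
  by (rule prob_space_gauss)

interpretation gauss_product: product_prob_space "\<lambda>_::nat. gauss" UNIV
  by standard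

text \<open>The factor \<open>exp (c * y - c\<^sup>2 / 2)\<close> is the density of a Gaussian with
  mean \<open>c\<close> relative to the standard one.\<close>

lemma nn_integral_gauss_shift:
  assumes [measurable]: "f \<in> borel_measurable borel"
  shows "(\<integral>\<^sup>+y. f (y + c) \<partial>gauss) = (\<integral>\<^sup>+y. f y * ennreal (exp (c * y - c\<^sup>2 / 2)) \<partial>gauss)"
proof -
  have dens: "std_normal_density y * exp (c * y - c\<^sup>2 / 2) = std_normal_density (y - c)" for y :: real
    by (simp add: std_normal_density_def exp_add[symmetric] power2_eq_square algebra_simps add_divide_distrib diff_divide_distrib)
  have "(\<integral>\<^sup>+y. f y * ennreal (exp (c * y - c\<^sup>2 / 2)) \<partial>gauss)
      = (\<integral>\<^sup>+y. ennreal (std_normal_density y * exp (c * y - c\<^sup>2 / 2)) * f y \<partial>lborel)"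
    by (subst nn_integral_density) (auto simp: ennreal_mult ac_simps intro!: nn_integral_cong)
  also have "\<dots> = (\<integral>\<^sup>+y. ennreal (std_normal_density (y - c)) * f y \<partial>lborel)"
    by (simp only: dens)
  also have "\<dots> = (\<integral>\<^sup>+y. ennreal (std_normal_density y) * f (y + c) \<partial>lborel)"
    by (subst nn_integral_real_affine[where c=1 and t=c]) (auto simp: add.commute)
  also have "\<dots> = (\<integral>\<^sup>+y. f (y + c) \<partial>gauss)"
    by (subst nn_integral_density) auto
  finally show ?thesis ..
qed

text \<open>The exponent on the right is the privacy loss of the shift by \<open>c\<close>, in the
  form in which \<open>gaussian_mechanism\<close> splits on it. The induction peels off one
  coordinate by Fubini and shifts it alone.\<close>

lemma nn_integral_gauss_product_shift:
  assumes "finite I" and "f \<in> borel_measurable (Pi\<^sub>M I (\<lambda>_. gauss))"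
  shows "(\<integral>\<^sup>+x. f (\<lambda>i\<in>I. x i + c i) \<partial>Pi\<^sub>M I (\<lambda>_::nat. gauss))
    = (\<integral>\<^sup>+x. f x * ennreal (exp (\<Sum>i\<in>I. c i * x i - (c i)\<^sup>2 / 2)) \<partial>Pi\<^sub>M I (\<lambda>_. gauss))"
  using assms
proof (induction I arbitrary: f rule: finite_induct)
  case empty
  have "(\<lambda>i\<in>{}. x i + c i) = x" if "x \<in> space (Pi\<^sub>M {} (\<lambda>_::nat. gauss))" for x
    using that by (auto simp: space_PiM)
  then show ?case by (intro nn_integral_cong) simp
next
  case (insert i I)
  note [measurable] = insert.prems
  let ?P = "\<lambda>I. Pi\<^sub>M I (\<lambda>_::nat. gauss)"
  let ?e = "\<lambda>i y. c i * y - (c i)\<^sup>2 / 2"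
  define F where "F x = (\<integral>\<^sup>+y. f (x(i := y)) * ennreal (exp (?e i y)) \<partial>gauss)" for x
  have [measurable]: "F \<in> borel_measurable (?P I)"
    unfolding F_def by measurable
  have upd: "(\<lambda>j\<in>insert i I. (x(i := y)) j + c j) = (\<lambda>j\<in>I. x j + c j)(i := y + c i)" for x y
    using insert.hyps by (auto simp: fun_eq_iff)
  have "(\<integral>\<^sup>+x. f (\<lambda>j\<in>insert i I. x j + c j) \<partial>?P (insert i I))
      = (\<integral>\<^sup>+x. (\<integral>\<^sup>+y. f (\<lambda>j\<in>insert i I. (x(i := y)) j + c j) \<partial>gauss) \<partial>?P I)"
    by (rule gauss_product.product_nn_integral_insert) (use insert.hyps in measurable)
  also have "\<dots> = (\<integral>\<^sup>+x. (\<integral>\<^sup>+y. f ((\<lambda>j\<in>I. x j + c j)(i := y + c i)) \<partial>gauss) \<partial>?P I)"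
    by (simp only: upd)
  also have "\<dots> = (\<integral>\<^sup>+x. F (\<lambda>j\<in>I. x j + c j) \<partial>?P I)"
  proof (intro nn_integral_cong)
    fix x assume "x \<in> space (?P I)"
    then have [measurable]: "(\<lambda>j\<in>I. x j + c j) \<in> space (?P I)"
      by (auto simp: space_PiM)
    have "(\<lambda>y. f ((\<lambda>j\<in>I. x j + c j)(i := y))) \<in> borel_measurable borel"
      by measurable
    then show "(\<integral>\<^sup>+y. f ((\<lambda>j\<in>I. x j + c j)(i := y + c i)) \<partial>gauss) = F (\<lambda>j\<in>I. x j + c j)"
      unfolding F_def by (rule nn_integral_gauss_shift)
  qed
  also have "\<dots> = (\<integral>\<^sup>+x. F x * ennreal (exp (\<Sum>j\<in>I. ?e j (x j))) \<partial>?P I)"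
    by (rule insert.IH) measurable
  also have "\<dots> = (\<integral>\<^sup>+x. (\<integral>\<^sup>+y. f (x(i := y)) * ennreal (exp (\<Sum>j\<in>insert i I. ?e j ((x(i := y)) j))) \<partial>gauss) \<partial>?P I)"
  proof (intro nn_integral_cong)
    fix x assume x[measurable]: "x \<in> space (?P I)"
    have eq: "(\<Sum>j\<in>I. ?e j ((x(i := y)) j)) = (\<Sum>j\<in>I. ?e j (x j))" for y
      using insert.hyps by (intro sum.cong) auto
    show "F x * ennreal (exp (\<Sum>j\<in>I. ?e j (x j)))
        = (\<integral>\<^sup>+y. f (x(i := y)) * ennreal (exp (\<Sum>j\<in>insert i I. ?e j ((x(i := y)) j))) \<partial>gauss)"
      unfolding F_def
      by (subst nn_integral_multc[symmetric])
        (use insert.hyps in \<open>simp_all add: eq exp_add ennreal_mult mult.assoc del: fun_upd_apply\<close>,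
          simp only: fun_upd_same)
  qed
  also have "\<dots> = (\<integral>\<^sup>+x. f x * ennreal (exp (\<Sum>j\<in>insert i I. ?e j (x j))) \<partial>?P (insert i I))"
    by (subst gauss_product.product_nn_integral_insert) (use insert.hyps in simp_all)
  finally show ?case .
qed

text \<open>The shift identity for the constant function 1 is already the moment generating
  function, after moving the deterministic part of the exponent to the other side.\<close>

lemma nn_integral_gauss_exp:
  assumes "finite I"
  shows "(\<integral>\<^sup>+x. ennreal (exp (\<Sum>i\<in>I. c i * x i)) \<partial>Pi\<^sub>M I (\<lambda>_::nat. gauss)) = ennreal (exp ((\<Sum>i\<in>I. (c i)\<^sup>2) / 2))"
proof -
  interpret P: prob_space "Pi\<^sub>M I (\<lambda>_::nat. gauss)"
    by (intro prob_space_PiM prob_space_gauss)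
  have "1 = (\<integral>\<^sup>+x. ennreal (exp (\<Sum>i\<in>I. c i * x i - (c i)\<^sup>2 / 2)) \<partial>Pi\<^sub>M I (\<lambda>_::nat. gauss))"
    using nn_integral_gauss_product_shift[OF assms, of "\<lambda>_. 1" c] by (simp add: P.emeasure_space_1)
  also have "\<dots> = (\<integral>\<^sup>+x. ennreal (exp (- (\<Sum>i\<in>I. (c i)\<^sup>2) / 2)) * ennreal (exp (\<Sum>i\<in>I. c i * x i)) \<partial>Pi\<^sub>M I (\<lambda>_::nat. gauss))"
    by (simp add: ennreal_mult[symmetric] exp_add[symmetric] sum_subtractf sum_divide_distrib)
  also have "\<dots> = ennreal (exp (- (\<Sum>i\<in>I. (c i)\<^sup>2) / 2)) * (\<integral>\<^sup>+x. ennreal (exp (\<Sum>i\<in>I. c i * x i)) \<partial>Pi\<^sub>M I (\<lambda>_::nat. gauss))"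
    by (rule nn_integral_cmult) measurable
  finally have "ennreal (exp ((\<Sum>i\<in>I. (c i)\<^sup>2) / 2)) * 1 = ennreal (exp ((\<Sum>i\<in>I. (c i)\<^sup>2) / 2)) * \<dots>"
    by (rule arg_cong)
  then show ?thesis
    by (simp add: mult.assoc[symmetric] ennreal_mult[symmetric] exp_add[symmetric])
qed

text \<open>The quadratic moment is bounded through \<open>v\<^sup>2 \<le> exp v + exp (- v)\<close>, so the same shift identity
  serves for privacy and for utility.\<close>

lemma square_le_exp: "v\<^sup>2 \<le> exp v + exp (- v)" for v :: real
proof -
  have "\<bar>v\<bar> \<le> 1 + \<bar>v\<bar> / 2 + (\<bar>v\<bar> / 2)\<^sup>2 / 2"
    using zero_le_power2[of "\<bar>v\<bar> - 2"] by (simp add: power2_eq_square algebra_simps)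
  also have "\<dots> \<le> exp (\<bar>v\<bar> / 2)"
    by (rule exp_lower_Taylor_quadratic) simp
  finally have "\<bar>v\<bar>\<^sup>2 \<le> (exp (\<bar>v\<bar> / 2))\<^sup>2" by (intro power_mono) auto
  also have "\<dots> = exp \<bar>v\<bar>" by (simp add: power2_eq_square exp_add[symmetric])
  also have "\<dots> \<le> exp v + exp (- v)" by (simp add: abs_if)
  finally show ?thesis by simp
qed

lemma nn_integral_gauss_square_le:
  assumes "finite I"
  shows "(\<integral>\<^sup>+x. ennreal ((\<Sum>i\<in>I. c i * x i)\<^sup>2) \<partial>Pi\<^sub>M I (\<lambda>_::nat. gauss)) \<le> ennreal (2 * exp ((\<Sum>i\<in>I. (c i)\<^sup>2) / 2))"
proof -
  let ?P = "Pi\<^sub>M I (\<lambda>_::nat. gauss)"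
  have "(\<integral>\<^sup>+x. ennreal ((\<Sum>i\<in>I. c i * x i)\<^sup>2) \<partial>?P)
      \<le> (\<integral>\<^sup>+x. ennreal (exp (\<Sum>i\<in>I. c i * x i)) + ennreal (exp (\<Sum>i\<in>I. - c i * x i)) \<partial>?P)"
    by (intro nn_integral_mono)
      (simp add: ennreal_plus[symmetric] square_le_exp sum_negf del: ennreal_plus)
  also have "\<dots> = ennreal (exp ((\<Sum>i\<in>I. (c i)\<^sup>2) / 2)) + ennreal (exp ((\<Sum>i\<in>I. (- c i)\<^sup>2) / 2))"
    by (subst nn_integral_add) (measurable, simp only: nn_integral_gauss_exp[OF assms])
  also have "\<dots> = ennreal (2 * exp ((\<Sum>i\<in>I. (c i)\<^sup>2) / 2))"
    by (simp add: ennreal_plus[symmetric] del: ennreal_plus)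
  finally show ?thesis .
qed

text \<open>Where the privacy loss \<open>l x\<close> is at most \<open>\<epsilon>\<close>, the
  density ratio is at most \<open>exp \<epsilon>\<close>. Elsewhere a Chernoff factor
  \<open>exp (\<theta> * (l x - \<epsilon>))\<close> is inserted and the moment generating function
  bounds the result by \<open>\<delta>\<close>. For privacy \<open>f\<close> is the indicator of an
  output event, and \<open>\<kappa>\<close> bounds the squared shift in units of the noise.\<close>

lemma gaussian_mechanism:
  assumes "finite I" and f[measurable]: "f \<in> borel_measurable (Pi\<^sub>M I (\<lambda>_. gauss))" and f1: "\<And>x. f x \<le> 1"
    and eps: "0 < \<epsilon>" and del: "0 < \<delta>" "\<delta> < 1" and k: "0 < \<kappa>"
    and c: "(\<Sum>i\<in>I. (c i)\<^sup>2) \<le> \<kappa>" and k1: "2 * \<kappa> \<le> \<epsilon>" and k2: "4 * \<kappa> * ln (1 / \<delta>) \<le> \<epsilon>\<^sup>2"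
  shows "(\<integral>\<^sup>+x. f (\<lambda>i\<in>I. x i + c i) \<partial>Pi\<^sub>M I (\<lambda>_::nat. gauss))
    \<le> ennreal (exp \<epsilon>) * (\<integral>\<^sup>+x. f x \<partial>Pi\<^sub>M I (\<lambda>_. gauss)) + ennreal \<delta>"
proof -
  let ?P = "Pi\<^sub>M I (\<lambda>_::nat. gauss)"
  define s where "s = (\<Sum>i\<in>I. (c i)\<^sup>2)"
  \<comment> \<open>The minimiser of \<open>\<theta> * (\<theta> * \<kappa> - \<epsilon>)\<close>,
    with minimum \<open>- \<epsilon>\<^sup>2 / (4 * \<kappa>)\<close>. The condition
    \<open>2 * \<kappa> \<le> \<epsilon>\<close> makes it at least 1, so that
    \<open>1 + \<theta>\<close> may be replaced by \<open>2 * \<theta>\<close>.\<close>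
  define \<theta> where "\<theta> = \<epsilon> / (2 * \<kappa>)"
  have s: "0 \<le> s" "s \<le> \<kappa>" using c by (simp_all add: s_def sum_nonneg)
  have th: "1 \<le> \<theta>" using k k1 by (simp add: \<theta>_def)
  define l where "l x = (\<Sum>i\<in>I. c i * x i - (c i)\<^sup>2 / 2)" for x
  define b where "b = - \<theta> * \<epsilon> - (1 + \<theta>) * s / 2"
  have l: "l x = (\<Sum>i\<in>I. c i * x i) - s / 2" for x
    by (simp add: l_def s_def sum_subtractf sum_divide_distrib)
  have tail: "f x * ennreal (exp (l x)) \<le> ennreal (exp \<epsilon>) * f x + ennreal (exp b) * ennreal (exp (\<Sum>i\<in>I. (1 + \<theta>) * c i * x i))" for x
  proof (cases "l x \<le> \<epsilon>")
    case True
    then have "f x * ennreal (exp (l x)) \<le> ennreal (exp \<epsilon>) * f x"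
      by (subst mult.commute) (intro mult_right_mono ennreal_leI, auto)
    then show ?thesis by (rule order_trans) simp
  next
    case False
    have "f x * ennreal (exp (l x)) \<le> 1 * ennreal (exp (l x))"
      by (intro mult_right_mono f1) simp
    also have "\<dots> \<le> ennreal (exp (l x + \<theta> * (l x - \<epsilon>)))"
      using False th by (auto intro!: ennreal_leI)
    also have "l x + \<theta> * (l x - \<epsilon>) = b + (\<Sum>i\<in>I. (1 + \<theta>) * c i * x i)"
      by (simp add: l b_def sum_distrib_left sum.distrib algebra_simps add_divide_distrib)
    also have "ennreal (exp \<dots>) = ennreal (exp b) * ennreal (exp (\<Sum>i\<in>I. (1 + \<theta>) * c i * x i))"
      by (simp add: exp_add ennreal_mult)
    finally show ?thesis by (rule order_trans) simp
  qed
  have "(\<Sum>i\<in>I. ((1 + \<theta>) * c i)\<^sup>2) = (1 + \<theta>)\<^sup>2 * s"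
    by (simp add: s_def power_mult_distrib sum_distrib_left)
  then have mom: "(\<integral>\<^sup>+x. ennreal (exp (\<Sum>i\<in>I. (1 + \<theta>) * c i * x i)) \<partial>?P) = ennreal (exp ((1 + \<theta>)\<^sup>2 * s / 2))"
    using nn_integral_gauss_exp[OF assms(1), of "\<lambda>i. (1 + \<theta>) * c i"] by simp
  have "b + (1 + \<theta>)\<^sup>2 * s / 2 = \<theta> * ((1 + \<theta>) * s / 2 - \<epsilon>)"
    by (simp add: b_def power2_eq_square algebra_simps add_divide_distrib)
  also have "\<dots> \<le> \<theta> * ((\<theta> + \<theta>) * \<kappa> / 2 - \<epsilon>)"
    using th s by (intro mult_left_mono diff_right_mono divide_right_mono mult_mono) auto
  also have "\<dots> = - \<epsilon>\<^sup>2 / (4 * \<kappa>)"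
    using k by (simp add: \<theta>_def field_simps power2_eq_square)
  also have "\<dots> \<le> ln \<delta>"
    using k k2 del by (simp add: ln_div field_simps)
  finally have "exp (b + (1 + \<theta>)\<^sup>2 * s / 2) \<le> exp (ln \<delta>)" by (simp only: exp_le_cancel_iff)
  then have exp_b: "exp (b + (1 + \<theta>)\<^sup>2 * s / 2) \<le> \<delta>" using del by simp
  have "(\<integral>\<^sup>+x. f (\<lambda>i\<in>I. x i + c i) \<partial>?P) = (\<integral>\<^sup>+x. f x * ennreal (exp (l x)) \<partial>?P)"
    unfolding l_def by (rule nn_integral_gauss_product_shift[OF assms(1,2)])
  also have "\<dots> \<le> (\<integral>\<^sup>+x. ennreal (exp \<epsilon>) * f x + ennreal (exp b) * ennreal (exp (\<Sum>i\<in>I. (1 + \<theta>) * c i * x i)) \<partial>?P)"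
    by (intro nn_integral_mono tail)
  also have "\<dots> = ennreal (exp \<epsilon>) * (\<integral>\<^sup>+x. f x \<partial>?P)
      + ennreal (exp b) * (\<integral>\<^sup>+x. ennreal (exp (\<Sum>i\<in>I. (1 + \<theta>) * c i * x i)) \<partial>?P)"
    by (subst nn_integral_add) (measurable, simp add: nn_integral_cmult)
  also have "\<dots> \<le> ennreal (exp \<epsilon>) * (\<integral>\<^sup>+x. f x \<partial>?P) + ennreal \<delta>"
    unfolding mom using exp_b by (intro add_left_mono) (simp add: ennreal_mult[symmetric] exp_add[symmetric] ennreal_leI)
  finally show ?thesis .
qed

section \<open>The probability space of the coins\<close>

lemma sets_coin_space [measurable_cong]:
  "sets coin_space = sets (Pi\<^sub>M UNIV (\<lambda>_. borel) \<Otimes>\<^sub>M Pi\<^sub>M UNIV (\<lambda>_. borel))"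
  unfolding coin_space_def by (intro sets_pair_measure_cong sets_PiM_cong) auto

lemma space_coin_space [simp]: "space coin_space = UNIV"
  by (simp add: sets_eq_imp_space_eq[OF sets_coin_space] space_pair_measure space_PiM)

lemma prob_space_coin_space: "prob_space coin_space"
proof -
  have "prob_space (uniform_measure lborel {0..1::real})"
    by (rule prob_space_uniform_measure) auto
  then show ?thesis
    unfolding coin_space_def by (intro prob_space_pair prob_space_PiM prob_space_gauss)
qed

text \<open>Only the first \<open>m\<close> normal coins are read, so integrals over the infinite
  sequence reduce to the finite product on which the shift and moment identities were
  proved.\<close>

lemma nn_integral_coins:
  assumes f[measurable]: "f \<in> borel_measurable (Pi\<^sub>M {..<m} (\<lambda>_. gauss))"
  shows "(\<integral>\<^sup>+\<omega>. f (restrict (snd \<omega>) {..<m}) \<partial>coin_space) = (\<integral>\<^sup>+x. f x \<partial>Pi\<^sub>M {..<m} (\<lambda>_. gauss))"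
proof -
  let ?U = "Pi\<^sub>M UNIV (\<lambda>_::nat. uniform_measure lborel {0..1::real})"
  let ?N = "Pi\<^sub>M UNIV (\<lambda>_::nat. gauss)"
  have "prob_space (uniform_measure lborel {0..1::real})"
    by (rule prob_space_uniform_measure) auto
  then interpret U: prob_space ?U by (intro prob_space_PiM)
  have N: "sigma_finite_measure ?N"
    by (intro prob_space_imp_sigma_finite prob_space_PiM prob_space_gauss)
  have [measurable]: "(\<lambda>x. restrict x {..<m}) \<in> measurable ?N (Pi\<^sub>M {..<m} (\<lambda>_. gauss))"
    by (rule measurable_restrict_subset) simp
  have "(\<lambda>\<omega>. f (restrict (snd \<omega>) {..<m})) \<in> borel_measurable (?U \<Otimes>\<^sub>M ?N)"
    by (rule measurable_compose[OF measurable_snd]) measurable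
  then have "(\<integral>\<^sup>+\<omega>. f (restrict (snd \<omega>) {..<m}) \<partial>coin_space)
      = (\<integral>\<^sup>+u. (\<integral>\<^sup>+z. f (restrict z {..<m}) \<partial>?N) \<partial>?U)"
    unfolding coin_space_def by (subst sigma_finite_measure.nn_integral_fst[OF N, symmetric]) simp_all
  also have "\<dots> = (\<integral>\<^sup>+z. f (restrict z {..<m}) \<partial>?N)"
    by (simp add: U.emeasure_space_1)
  also have "\<dots> = (\<integral>\<^sup>+x. f x \<partial>distr ?N (Pi\<^sub>M {..<m} (\<lambda>_. gauss)) (\<lambda>x. restrict x {..<m}))"
    by (subst nn_integral_distr) measurable
  also have "\<dots> = (\<integral>\<^sup>+x. f x \<partial>Pi\<^sub>M {..<m} (\<lambda>_. gauss))"
    by (subst gauss_product.distr_PiM_restrict_finite) auto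
  finally show ?thesis .
qed

section \<open>Separators and generalization\<close>

lemma outer_measure_null_AE:
  assumes "outer_measure_of M A = 0" "A \<subseteq> space M"
  shows "AE x in M. x \<notin> A"
proof -
  obtain E where "E \<in> sets M" "A \<subseteq> E" "outer_measure_of M A = emeasure M E"
    using outer_measure_of_attain[OF assms(2)] by blast
  then show ?thesis
    using assms(1) by (intro AE_I[of _ _ E]) auto
qed

lemma space_example_space: "space (example_space d) = unit_ball d \<times> labels"
  by (auto simp: example_space_def space_pair_measure space_restrict_space space_PiM PiE_def unit_ball_def)

lemma space_distribution: "distribution d D \<Longrightarrow> space D = unit_ball d \<times> labels"
  using sets_eq_imp_space_eq[of D "example_space d"] by (simp add: distribution_def space_example_space)

lemma ip_cong: "(\<And>i. i < m \<Longrightarrow> u i = u' i) \<Longrightarrow> (\<And>i. i < m \<Longrightarrow> v i = v' i) \<Longrightarrow> ip m u v = ip m u' v'"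
  by (simp add: ip_def)

lemma halfspace_eq_ip: "halfspace d w x = sgn_pm (ip d w x)"
  by (simp add: halfspace_def ip_def)

text \<open>If the margin were smaller, the point could be moved to the other side of the hyperplane
  within distance \<open>\<gamma>\<close> and without leaving the unit ball. The labels differ
  because the sign of 0 is 1: label 1 is only refuted strictly beyond the hyperplane, label -1
  already on it. Here \<open>p\<close> is the orthogonal projection of \<open>x\<close> to the
  hyperplane.\<close>

lemma robust_imp_margin:
  assumes x: "x \<in> unit_ball d" and v: "ip d v v = 1" and y: "y \<in> labels" and g: "0 < \<gamma>" "\<gamma> \<le> 1"
    and rob: "\<And>z. z \<in> unit_ball d \<Longrightarrow> L2_set (\<lambda>i. z i - x i) {..<d} \<le> \<gamma> \<Longrightarrow> sgn_pm (ip d v z) = y"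
  shows "\<gamma> \<le> y * ip d v x"
proof (rule ccontr)
  assume less: "\<not> \<gamma> \<le> y * ip d v x"
  define m where "m = ip d v x"
  define p where "p = (\<lambda>i. x i - m * v i)"
  have xx: "ip d x x \<le> 1" using x by (simp add: unit_ball_def L2_set_eq_sqrt_ip)
  have vp: "ip d v p = 0" "ip d p v = 0"
    unfolding p_def by (simp_all only: ip_bilinear v ip_commute[of d x v]) (simp_all add: m_def)
  have "ip d p p = ip d x x - m * m"
    unfolding p_def by (simp only: ip_bilinear v ip_commute[of d x v]) (simp add: m_def)
  then have pp: "ip d p p \<le> 1" using xx by (smt (verit) zero_le_square)
  have y_eq: "sgn_pm m = y"
    using rob[OF x] g by (simp add: m_def L2_set_def)
  show False
  proof (cases "y = 1")
    case True
    then have m: "0 \<le> m" "m < \<gamma>" using y_eq less by (auto simp: sgn_pm_def m_def split: if_splits)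
    \<comment> \<open>Half of the slack. Crossing the hyperplane by \<open>\<tau> / 2\<close> could
      leave the unit ball when \<open>p\<close> has norm 1, so \<open>p\<close> is shrunk by the
      factor \<open>1 - \<tau>\<close> first. The total displacement is at most
      \<open>\<tau> + m + \<tau> / 2\<close>.\<close>
    define \<tau> where "\<tau> = (\<gamma> - m) / 2"
    have t: "0 < \<tau>" "\<tau> \<le> 1" "m + 3 / 2 * \<tau> \<le> \<gamma>" using m g by (auto simp: \<tau>_def field_simps)
    define z where "z = (\<lambda>i\<in>{..<d}. (1 - \<tau>) * p i - (\<tau> / 2) * v i)"
    have zz: "ip d z z = (1 - \<tau>)\<^sup>2 * ip d p p + \<tau>\<^sup>2 / 4"
    proof -
      have "ip d z z = ip d (\<lambda>i. (1 - \<tau>) * p i - (\<tau> / 2) * v i) (\<lambda>i. (1 - \<tau>) * p i - (\<tau> / 2) * v i)"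
        by (rule ip_cong) (simp_all add: z_def)
      also have "\<dots> = (1 - \<tau>)\<^sup>2 * ip d p p + \<tau>\<^sup>2 / 4"
        by (simp only: ip_bilinear v vp) (simp add: power2_eq_square)
      finally show ?thesis .
    qed
    have "(1 - \<tau>)\<^sup>2 * ip d p p \<le> (1 - \<tau>)\<^sup>2 * 1" using pp by (intro mult_left_mono) auto
    moreover have "(1 - \<tau>)\<^sup>2 + \<tau>\<^sup>2 / 4 \<le> 1"
      using mult_nonneg_nonneg[of \<tau> "2 - 5 / 4 * \<tau>"] t by (simp add: power2_eq_square algebra_simps)
    ultimately have z: "z \<in> unit_ball d"
      unfolding unit_ball_def L2_set_eq_sqrt_ip using zz by (auto simp: z_def)
    have "L2_set (\<lambda>i. z i - x i) {..<d} = L2_set (\<lambda>i. (- \<tau>) * p i + (- (m + \<tau> / 2)) * v i) {..<d}"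
      by (rule L2_set_cong) (auto simp: z_def p_def algebra_simps)
    also have "\<dots> \<le> L2_set (\<lambda>i. (- \<tau>) * p i) {..<d} + L2_set (\<lambda>i. (- (m + \<tau> / 2)) * v i) {..<d}"
      by (rule L2_set_triangle_ineq)
    also have "\<dots> = \<tau> * sqrt (ip d p p) + (m + \<tau> / 2) * sqrt (ip d v v)"
      unfolding L2_set_eq_sqrt_ip ip_scale_left ip_scale_right mult.assoc[symmetric] real_sqrt_mult
        real_sqrt_mult_self using t m by simp
    also have "\<dots> \<le> \<tau> * 1 + (m + \<tau> / 2) * 1"
      using t m pp v by (intro add_mono mult_left_mono) auto
    also have "\<dots> \<le> \<gamma>" using t by simp
    finally have "sgn_pm (ip d v z) = y" by (rule rob[OF z])
    moreover have "ip d v z = ip d v (\<lambda>i. (1 - \<tau>) * p i - (\<tau> / 2) * v i)"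
      by (rule ip_cong) (simp_all add: z_def)
    moreover have "\<dots> = - \<tau> / 2"
      by (simp only: ip_bilinear v vp)
    ultimately show False using True t by (simp add: sgn_pm_def)
  next
    case False
    then have y: "y = -1" using y by (simp add: labels_def)
    then have m: "m < 0" "- m < \<gamma>" using y_eq less by (auto simp: sgn_pm_def m_def split: if_splits)
    \<comment> \<open>The projection itself suffices: its score is 0, which is classified as
      1.\<close>
    define z where "z = restrict p {..<d}"
    have zp: "ip d z z = ip d p p" "ip d v z = 0"
      using vp by (auto simp: ip_def z_def)
    have z: "z \<in> unit_ball d"
      unfolding unit_ball_def L2_set_eq_sqrt_ip using zp pp by (auto simp: z_def)
    have "L2_set (\<lambda>i. z i - x i) {..<d} = L2_set (\<lambda>i. (- m) * v i) {..<d}"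
      by (rule L2_set_cong) (auto simp: z_def p_def)
    also have "\<dots> = - m"
      unfolding L2_set_eq_sqrt_ip ip_scale_left ip_scale_right using m v by simp
    finally have "sgn_pm (ip d v z) = y" using m by (intro rob[OF z]) simp
    then show False using zp y by (simp add: sgn_pm_def)
  qed
qed

text \<open>Supplies the comparator of \<open>sgd_regret\<close>. A proper halfspace is normalised
  and extended by 0. A vector that vanishes on the first \<open>d\<close> coordinates forces all
  labels to be 1 almost surely, and then the unit vector of the additional coordinate has margin
  exactly \<open>\<gamma>\<close>.\<close>

lemma realizable_separator:
  assumes D: "distribution d D" "realizable d \<gamma> D" and g: "0 < \<gamma>" "\<gamma> \<le> 1"
  obtains u where "ip (Suc d) u u \<le> 1" "AE e in D. \<gamma> \<le> margin d \<gamma> u e"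
proof -
  obtain w where w: "outer_measure_of D (robust_error d \<gamma> (halfspace d w)) = 0"
    using D(2) by (auto simp: realizable_def robust_risk_def)
  have sp: "space D = unit_ball d \<times> labels" by (rule space_distribution[OF D(1)])
  have "AE e in D. e \<notin> robust_error d \<gamma> (halfspace d w)"
    by (rule outer_measure_null_AE[OF w]) (auto simp: sp robust_error_def)
  then have AE: "AE e in D. e \<in> unit_ball d \<times> labels \<and> e \<notin> robust_error d \<gamma> (halfspace d w)"
    using AE_space by eventually_elim (auto simp: sp)
  show ?thesis
  proof (cases "ip d w w = 0")
    case True
    then have w0: "w i = 0" if "i < d" for i
      using that by (auto simp: ip_def sum_nonneg_eq_0_iff)
    define u where "u = (\<lambda>i. if i < d then 0 else 1 :: real)"
    show ?thesis
    proof (rule that[of u])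
      show "ip (Suc d) u u \<le> 1" by (simp add: ip_def u_def)
      show "AE e in D. \<gamma> \<le> margin d \<gamma> u e"
        using AE
      proof eventually_elim
        case (elim e)
        then have "halfspace d w (fst e) = snd e"
          using g by (auto simp: robust_error_def L2_set_def intro!: bexI[of _ "fst e"])
        then have "snd e = 1" by (simp add: halfspace_def w0 sgn_pm_def)
        then show ?case by (simp add: margin_def ip_def u_def augment_def)
      qed
    qed
  next
    case False
    define r where "r = sqrt (ip d w w)"
    have r: "r > 0" using False ip_self_nonneg[of d w] by (simp add: r_def less_le)
    define v where "v = (\<lambda>i. (1 / r) * w i)"
    have v: "ip d v v = 1"
      unfolding v_def ip_scale_left ip_scale_right using False ip_self_nonneg[of d w] by (simp add: r_def)
    have hv: "halfspace d w z = sgn_pm (ip d v z)" for z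
      unfolding v_def ip_scale_left halfspace_eq_ip sgn_pm_def using r by (simp add: zero_le_divide_iff)
    define u where "u = (\<lambda>i. if i < d then v i else 0)"
    show ?thesis
    proof (rule that[of u])
      show "ip (Suc d) u u \<le> 1" using v by (simp add: ip_def u_def)
      show "AE e in D. \<gamma> \<le> margin d \<gamma> u e"
        using AE
      proof eventually_elim
        case (elim e)
        then have "\<gamma> \<le> snd e * ip d v (fst e)"
          using g v by (intro robust_imp_margin) (auto simp: robust_error_def hv)
        also have "ip d v (fst e) = ip (Suc d) u (augment d \<gamma> (fst e))"
          by (simp add: ip_def u_def augment_def)
        finally show ?case by (simp add: margin_def)
      qed
    qed
  qed
qed

text \<open>The step from online to expected loss: as \<open>h s\<close> ignores \<open>s i\<close>,
  that coordinate is independent of the function it is inserted into and may replace the new example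
  \<open>e\<close>.\<close>

lemma nn_integral_fresh_sample:
  assumes D: "prob_space D" and I: "finite I" "i \<in> I"
    and h[measurable]: "case_prod h \<in> borel_measurable (Pi\<^sub>M I (\<lambda>_. D) \<Otimes>\<^sub>M D)"
    and indep: "\<And>s y. h (s(i := y)) = h s"
  shows "(\<integral>\<^sup>+s. (\<integral>\<^sup>+e. h s e \<partial>D) \<partial>Pi\<^sub>M I (\<lambda>_. D)) = (\<integral>\<^sup>+s. h s (s i) \<partial>Pi\<^sub>M I (\<lambda>_. D))"
proof -
  interpret D: prob_space D by (rule D)
  interpret P: product_sigma_finite "\<lambda>_. D" by standard
  define J where "J = I - {i}"
  have J: "insert i J = I" "finite J" "i \<notin> J" using I by (auto simp: J_def)
  note [measurable] = h[folded J(1)]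
  have "(\<integral>\<^sup>+s. (\<integral>\<^sup>+e. h s e \<partial>D) \<partial>Pi\<^sub>M (insert i J) (\<lambda>_. D))
      = (\<integral>\<^sup>+s. (\<integral>\<^sup>+y. (\<integral>\<^sup>+e. h (s(i := y)) e \<partial>D) \<partial>D) \<partial>Pi\<^sub>M J (\<lambda>_. D))"
    by (rule P.product_nn_integral_insert[OF J(2,3)]) measurable
  also have "\<dots> = (\<integral>\<^sup>+s. (\<integral>\<^sup>+y. h (s(i := y)) ((s(i := y)) i) \<partial>D) \<partial>Pi\<^sub>M J (\<lambda>_. D))"
    by (simp add: indep D.emeasure_space_1)
  also have "\<dots> = (\<integral>\<^sup>+s. h s (s i) \<partial>Pi\<^sub>M (insert i J) (\<lambda>_. D))"
    by (rule P.product_nn_integral_insert[OF J(2,3), symmetric]) measurable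
  finally show ?thesis by (simp add: J(1))
qed

section \<open>Measurability of margins and iterates\<close>

lemma measurable_distribution:
  assumes "distribution d D"
  shows "i < d \<Longrightarrow> (\<lambda>e. fst e i) \<in> borel_measurable D" and "snd \<in> borel_measurable D"
proof -
  have sets: "sets D = sets (example_space d)" using assms by (simp add: distribution_def)
  have 1: "fst \<in> measurable (example_space d) (restrict_space (Pi\<^sub>M {..<d} (\<lambda>_. borel)) (unit_ball d))"
    unfolding example_space_def by simp
  have "(\<lambda>x. x i) \<in> borel_measurable (restrict_space (Pi\<^sub>M {..<d} (\<lambda>_. borel)) (unit_ball d))" if "i < d"
    using that by (intro measurable_restrict_space1 measurable_component_singleton) simp
  from measurable_compose[OF 1 this]
  show "(\<lambda>e. fst e i) \<in> borel_measurable D" if "i < d"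
    using that by (simp add: measurable_cong_sets[OF sets refl])
  have "snd \<in> measurable (example_space d) (count_space labels)"
    unfolding example_space_def by simp
  from measurable_compose[OF this, of "\<lambda>y. y" borel]
  show "snd \<in> borel_measurable D"
    by (simp add: measurable_cong_sets[OF sets refl])
qed

lemma measurable_margin:
  assumes D: "distribution d D" and f: "f \<in> measurable M D"
    and w: "\<And>i. (\<lambda>x. w x i) \<in> borel_measurable M"
  shows "(\<lambda>x. margin d \<gamma> (w x) (f x)) \<in> borel_measurable M"
    and "(\<lambda>x. sgd_step d \<gamma> \<eta> (f x) (w x) i) \<in> borel_measurable M"
proof -
  note [measurable] = w
  have fi: "(\<lambda>x. fst (f x) i) \<in> borel_measurable M" if "i < d" for i
    using measurable_compose[OF f measurable_distribution(1)[OF D that]] .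
  have [measurable]: "(\<lambda>x. augment d \<gamma> (fst (f x)) i) \<in> borel_measurable M" for i
    unfolding augment_def by (cases "i < d") (simp_all add: fi)
  have [measurable]: "(\<lambda>x. snd (f x)) \<in> borel_measurable M"
    using measurable_compose[OF f measurable_distribution(2)[OF D]] .
  show 1[measurable]: "(\<lambda>x. margin d \<gamma> (w x) (f x)) \<in> borel_measurable M"
    unfolding margin_def ip_def by measurable
  have [measurable]: "(\<lambda>x. gradient_step d \<gamma> \<eta> (f x) (w x) i) \<in> borel_measurable M" for i
    unfolding gradient_step_def pull_def by measurable
  show "(\<lambda>x. sgd_step d \<gamma> \<eta> (f x) (w x) i) \<in> borel_measurable M"
    unfolding sgd_step_def project_def ip_def by measurable
qed

lemma measurable_sgd:
  assumes D: "distribution d D" and k: "k \<le> n"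
  shows "(\<lambda>s. sgd d \<gamma> \<eta> (map s [0..<k]) (\<lambda>_. 0) i) \<in> borel_measurable (Pi\<^sub>M {..<n} (\<lambda>_. D))"
  using k
proof (induction k arbitrary: i)
  case (Suc k)
  then have "(\<lambda>s. sgd d \<gamma> \<eta> (map s [0..<k]) (\<lambda>_. 0) i) \<in> borel_measurable (Pi\<^sub>M {..<n} (\<lambda>_. D))" for i
    by simp
  moreover have "(\<lambda>s. s k) \<in> measurable (Pi\<^sub>M {..<n} (\<lambda>_. D)) D"
    using Suc.prems by (intro measurable_component_singleton) simp
  ultimately have "(\<lambda>s. sgd_step d \<gamma> \<eta> (s k) (sgd d \<gamma> \<eta> (map s [0..<k]) (\<lambda>_. 0)) i) \<in> borel_measurable (Pi\<^sub>M {..<n} (\<lambda>_. D))"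
    by (intro measurable_margin(2)[OF D])
  then show ?case by simp
qed simp

text \<open>The quantity controlled by the regret, \<open>pull\<close> times
  \<open>\<gamma> - t\<close>, is not convex in the margin \<open>t\<close>: its slope drops from
  \<open>- \<gamma>\<close> to \<open>- 2 * \<gamma>\<close> at 0. Averaging the iterates needs
  convexity, so this hinge serves as a convex minorant up to scale. Its level lies below
  \<open>\<gamma>\<close> so that \<open>pull\<close> is at least \<open>0.02 * \<gamma>\<close>
  wherever the hinge is positive.\<close>

definition hinge :: "nat \<Rightarrow> real \<Rightarrow> point \<Rightarrow> example \<Rightarrow> real" where
  "hinge d \<gamma> w e = max 0 (0.98 * \<gamma> - margin d \<gamma> w e)"

lemma hinge_le_pull:
  assumes "0 < \<gamma>"
  shows "0.02 * \<gamma> * hinge d \<gamma> w e \<le> pull \<gamma> (margin d \<gamma> w e) * (\<gamma> - margin d \<gamma> w e)"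
proof (cases "margin d \<gamma> w e \<le> 0.98 * \<gamma>")
  case True
  then show ?thesis
    unfolding hinge_def pull_def using assms by (intro mult_mono) auto
next
  case False
  then show ?thesis
    unfolding hinge_def pull_def using assms by (cases "margin d \<gamma> w e \<le> \<gamma>") auto
qed

lemma margin_sgd_mean:
  assumes "length X = n"
  shows "margin d \<gamma> (sgd_mean d \<gamma> \<eta> n X) e
    = (\<Sum>k<n. margin d \<gamma> (sgd d \<gamma> \<eta> (take k X) (\<lambda>_. 0)) e) / n"
  using assms unfolding sgd_mean_def margin_def ip_def trajectory_sum_def
  by (simp add: sum_distrib_left sum_distrib_right sum_divide_distrib mult.assoc del: sum.lessThan_Suc)
    (subst sum.swap, rule refl)

text \<open>Jensen's inequality: the margin is linear in the weights and the hinge convex in the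
  margin.\<close>

lemma hinge_sgd_mean_le:
  assumes "length X = n" "0 < n"
  shows "hinge d \<gamma> (sgd_mean d \<gamma> \<eta> n X) e
    \<le> (\<Sum>k<n. hinge d \<gamma> (sgd d \<gamma> \<eta> (take k X) (\<lambda>_. 0)) e) / n"
proof -
  let ?m = "\<lambda>k. margin d \<gamma> (sgd d \<gamma> \<eta> (take k X) (\<lambda>_. 0)) e"
  let ?h = "\<lambda>k. hinge d \<gamma> (sgd d \<gamma> \<eta> (take k X) (\<lambda>_. 0)) e"
  have "c - (\<Sum>k<n. ?m k) / n = (\<Sum>k<n. c - ?m k) / n" for c
    using assms by (simp add: sum_subtractf field_simps)
  then have "0.98 * \<gamma> - (\<Sum>k<n. ?m k) / n = (\<Sum>k<n. 0.98 * \<gamma> - ?m k) / n" .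
  also have "\<dots> \<le> (\<Sum>k<n. ?h k) / n"
    by (intro divide_right_mono sum_mono) (auto simp: hinge_def)
  finally have "0.98 * \<gamma> - (\<Sum>k<n. ?m k) / n \<le> (\<Sum>k<n. ?h k) / n" .
  moreover have "0 \<le> (\<Sum>k<n. ?h k) / n"
    by (intro divide_nonneg_nonneg sum_nonneg) (auto simp: hinge_def)
  ultimately show ?thesis
    unfolding hinge_def[of d \<gamma> "sgd_mean d \<gamma> \<eta> n X"] margin_sgd_mean[OF assms(1)] by simp
qed

text \<open>Jensen passes to the single iterates, freshness replaces the test example by the next
  training example, and the pathwise regret bound finishes. The 50 is \<open>1 / 0.02\<close>, the
  price of comparing the hinge with \<open>pull\<close>.\<close>

lemma nn_integral_hinge_sgd_mean:
  assumes D: "distribution d D" "realizable d \<gamma> D" and g: "0 < \<gamma>" "\<gamma> \<le> 1" and h: "0 < \<eta>" "\<eta> \<le> 1/2"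
    and n: "0 < n"
  shows "(\<integral>\<^sup>+s. (\<integral>\<^sup>+e. ennreal (hinge d \<gamma> (sgd_mean d \<gamma> \<eta> n (map s [0..<n])) e) \<partial>D) \<partial>Pi\<^sub>M {..<n} (\<lambda>_. D))
    \<le> ennreal (50 / (n * \<gamma> * \<eta>))"
proof -
  let ?P = "Pi\<^sub>M {..<n} (\<lambda>_. D)"
  have D': "prob_space D" using D(1) by (simp add: distribution_def)
  interpret D: prob_space D by (rule D')
  interpret P: prob_space ?P by (intro prob_space_PiM D')
  define H where "H k s e = ennreal (hinge d \<gamma> (sgd d \<gamma> \<eta> (map s [0..<k]) (\<lambda>_. 0)) e)" for k s e
  have H[measurable]: "case_prod (H k) \<in> borel_measurable (?P \<Otimes>\<^sub>M D)" if "k \<le> n" for k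
  proof -
    have "(\<lambda>x. sgd d \<gamma> \<eta> (map (fst x) [0..<k]) (\<lambda>_. 0) i) \<in> borel_measurable (?P \<Otimes>\<^sub>M D)" for i
      using measurable_compose[OF measurable_fst measurable_sgd[OF D(1) that]] .
    then have [measurable]: "(\<lambda>x. margin d \<gamma> (sgd d \<gamma> \<eta> (map (fst x) [0..<k]) (\<lambda>_. 0)) (snd x)) \<in> borel_measurable (?P \<Otimes>\<^sub>M D)"
      by (intro measurable_margin(1)[OF D(1)]) measurable
    show ?thesis
      unfolding H_def hinge_def case_prod_beta by measurable
  qed
  obtain u where u: "ip (Suc d) u u \<le> 1" "AE e in D. \<gamma> \<le> margin d \<gamma> u e"
    using realizable_separator[OF D g] .
  have take_eq: "take k (map s [0..<n]) = map s [0..<k]" if "k < n" for k and s :: "nat \<Rightarrow> example"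
    using that by (simp add: take_map)
  have "(\<integral>\<^sup>+s. (\<integral>\<^sup>+e. ennreal (hinge d \<gamma> (sgd_mean d \<gamma> \<eta> n (map s [0..<n])) e) \<partial>D) \<partial>?P)
      \<le> (\<integral>\<^sup>+s. (\<integral>\<^sup>+e. ennreal (1 / n) * (\<Sum>k<n. H k s e) \<partial>D) \<partial>?P)"
  proof (intro nn_integral_mono)
    fix s :: "nat \<Rightarrow> example" and e
    have "hinge d \<gamma> (sgd_mean d \<gamma> \<eta> n (map s [0..<n])) e
        \<le> 1 / n * (\<Sum>k<n. hinge d \<gamma> (sgd d \<gamma> \<eta> (map s [0..<k]) (\<lambda>_. 0)) e)"
      using hinge_sgd_mean_le[of "map s [0..<n]" n d \<gamma> \<eta> e] n by (simp add: take_eq)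
    then show "ennreal (hinge d \<gamma> (sgd_mean d \<gamma> \<eta> n (map s [0..<n])) e) \<le> ennreal (1 / n) * (\<Sum>k<n. H k s e)"
      unfolding H_def
      by (subst sum_ennreal, simp add: hinge_def)
        (subst ennreal_mult[symmetric], auto intro!: ennreal_leI sum_nonneg simp: hinge_def)
  qed
  also have "\<dots> = ennreal (1 / n) * (\<Sum>k<n. \<integral>\<^sup>+s. (\<integral>\<^sup>+e. H k s e \<partial>D) \<partial>?P)"
  proof -
    have "(\<integral>\<^sup>+e. ennreal (1 / n) * (\<Sum>k<n. H k s e) \<partial>D) = ennreal (1 / n) * (\<Sum>k<n. \<integral>\<^sup>+e. H k s e \<partial>D)"
      if "s \<in> space ?P" for s
    proof -
      have "(\<lambda>e. H k s e) \<in> borel_measurable D" if "k < n" for k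
        using measurable_compose_Pair1[OF \<open>s \<in> space ?P\<close> H[of k]] that by simp
      then show ?thesis
        by (subst nn_integral_cmult, (measurable; simp)) (subst nn_integral_sum, auto)
    qed
    moreover have "(\<lambda>s. \<integral>\<^sup>+e. H k s e \<partial>D) \<in> borel_measurable ?P" if "k < n" for k
      using H[of k] that by (intro D.borel_measurable_nn_integral) simp
    ultimately show ?thesis
      by (simp cong: nn_integral_cong) (subst nn_integral_cmult, (measurable; simp), subst nn_integral_sum, auto)
  qed
  also have "\<dots> = ennreal (1 / n) * (\<Sum>k<n. \<integral>\<^sup>+s. H k s (s k) \<partial>?P)"
  proof (intro arg_cong2[where f="(*)"] refl sum.cong)
    fix k assume k: "k \<in> {..<n}"
    show "(\<integral>\<^sup>+s. (\<integral>\<^sup>+e. H k s e \<partial>D) \<partial>?P) = (\<integral>\<^sup>+s. H k s (s k) \<partial>?P)"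
    proof (rule nn_integral_fresh_sample[OF D' _ k])
      show "case_prod (H k) \<in> borel_measurable (?P \<Otimes>\<^sub>M D)" using k by (intro H) simp
      fix s and y :: example
      \<comment> \<open>Iterate \<open>k\<close> reads only the examples with index below
        \<open>k\<close>.\<close>
      have "map (s(k := y)) [0..<k] = map s [0..<k]" by simp
      then show "H k (s(k := y)) = H k s" by (simp only: H_def[abs_def])
    qed simp
  qed
  also have "\<dots> = ennreal (1 / n) * (\<integral>\<^sup>+s. (\<Sum>k<n. H k s (s k)) \<partial>?P)"
  proof -
    have "(\<lambda>s. H k s (s k)) \<in> borel_measurable ?P" if "k < n" for k
    proof -
      have "(\<lambda>s. (s, s k)) \<in> measurable ?P (?P \<Otimes>\<^sub>M D)"
        using that by (intro measurable_Pair measurable_ident_sets measurable_component_singleton) simp_all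
      from measurable_compose[OF this H[of k]] that show ?thesis by simp
    qed
    then show ?thesis by (subst nn_integral_sum) auto
  qed
  \<comment> \<open>From here the argument is pathwise: almost surely \<open>u\<close> has margin at
    least \<open>\<gamma>\<close> on all \<open>n\<close> examples at once, and then
    \<open>sgd_regret\<close> bounds the sum deterministically.\<close>
  also have "\<dots> \<le> ennreal (1 / n) * (\<integral>\<^sup>+s. ennreal (50 / (\<gamma> * \<eta>)) \<partial>?P)"
  proof (intro mult_left_mono nn_integral_mono_AE)
    have "AE s in ?P. \<forall>k<n. \<gamma> \<le> margin d \<gamma> u (s k)"
      using AE_PiM_component[of "{..<n}" "\<lambda>_. D", OF D' _ u(2)] by (subst AE_all_countable) simp
    then show "AE s in ?P. (\<Sum>k<n. H k s (s k)) \<le> ennreal (50 / (\<gamma> * \<eta>))"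
      using AE_space
    proof eventually_elim
      case (elim s)
      define X where "X = map s [0..<n]"
      have X: "X \<in> datasets d"
      proof -
        have "s k \<in> unit_ball d \<times> labels" if "k < n" for k
          using elim(2) that by (simp add: space_PiM PiE_iff space_distribution[OF D(1)])
        then show ?thesis
          unfolding datasets_def X_def lists_eq_set by (simp add: image_subset_iff)
      qed
      let ?w = "\<lambda>k. sgd d \<gamma> \<eta> (map s [0..<k]) (\<lambda>_. 0)"
      let ?t = "\<lambda>k. margin d \<gamma> (?w k) (s k)"
      have "\<eta> * (\<Sum>k<n. 0.02 * \<gamma> * hinge d \<gamma> (?w k) (s k)) \<le> \<eta> * (\<Sum>k<n. pull \<gamma> (?t k) * (\<gamma> - ?t k))"
        using h by (intro mult_left_mono sum_mono hinge_le_pull g) simp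
      also have "\<dots> \<le> 1"
      proof -
        have "\<gamma> \<le> margin d \<gamma> u e" if e: "e \<in> set X" for e
        proof -
          obtain k where "k < n" "e = s k" using e by (auto simp only: X_def set_map set_upt image_iff atLeastLessThan_iff)
          then show ?thesis using elim(1) by simp
        qed
        from sgd_regret[OF X _ g(2) _ h(2) u(1) this] g h show ?thesis
          by (simp add: X_def take_eq)
      qed
      finally have le: "\<eta> * (\<Sum>k<n. 0.02 * \<gamma> * hinge d \<gamma> (?w k) (s k)) \<le> 1" .
      have "(\<Sum>k<n. hinge d \<gamma> (?w k) (s k)) \<le> 50 / (\<gamma> * \<eta>)"
      proof -
        have eq: "(\<Sum>k<n. 0.02 * \<gamma> * hinge d \<gamma> (?w k) (s k)) = 0.02 * \<gamma> * (\<Sum>k<n. hinge d \<gamma> (?w k) (s k))"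
          by (simp only: sum_distrib_left)
        show ?thesis using le[unfolded eq] g h by (simp add: field_simps)
      qed
      then show ?case
        unfolding H_def by (subst sum_ennreal) (auto simp: hinge_def intro!: ennreal_leI)
    qed
  qed simp
  also have "\<dots> = ennreal (50 / (n * \<gamma> * \<eta>))"
    using g h by (simp add: P.emeasure_space_1 ennreal_mult[symmetric] mult.assoc)
  finally show ?thesis .
qed

section \<open>Affine scores under perturbation of the point\<close>

definition score :: "nat \<Rightarrow> real \<Rightarrow> point \<Rightarrow> point \<Rightarrow> real" where
  "score d \<gamma> v x = ip (Suc d) v (augment d \<gamma> x)"

text \<open>The additional coordinate is the same for both points and cancels, so robustness depends
  only on the norm of the first \<open>d\<close> weights.\<close>

lemma score_diff: "score d \<gamma> v x - score d \<gamma> v z = ip d v (\<lambda>i. x i - z i)"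
  unfolding score_def by (simp add: ip_def augment_def sum_subtractf algebra_simps)

lemma score_Lipschitz: "\<bar>score d \<gamma> v x - score d \<gamma> v z\<bar> \<le> L2_set v {..<d} * L2_set (\<lambda>i. x i - z i) {..<d}"
  unfolding score_diff by (rule ip_le_L2_set)

definition affine_hypothesis :: "nat \<Rightarrow> real \<Rightarrow> point \<Rightarrow> hypothesis" where
  "affine_hypothesis d \<gamma> v x = sgn_pm (score d \<gamma> v x)"

text \<open>At the perturbed point the signed score is at most 0, a tie included, and returning to
  the original point raises it by no more than the Lipschitz bound.\<close>

lemma robust_error_margin:
  assumes "e \<in> robust_error d \<gamma>' (affine_hypothesis d \<gamma> v)"
  shows "margin d \<gamma> v e \<le> \<gamma>' * L2_set v {..<d}"
proof -
  obtain x y z where e: "e = (x, y)" "y \<in> labels" and z: "L2_set (\<lambda>i. z i - x i) {..<d} \<le> \<gamma>'"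
    and ne: "sgn_pm (score d \<gamma> v z) \<noteq> y"
    using assms by (auto simp: robust_error_def affine_hypothesis_def)
  have "y * score d \<gamma> v z \<le> 0"
    using ne e(2) by (auto simp: labels_def sgn_pm_def split: if_splits)
  moreover have "y * (score d \<gamma> v x - score d \<gamma> v z) \<le> \<bar>score d \<gamma> v z - score d \<gamma> v x\<bar>"
    using e(2) by (auto simp: labels_def)
  moreover have "\<dots> \<le> \<gamma>' * L2_set v {..<d}"
    using score_Lipschitz[of d \<gamma> v z x] mult_left_mono[OF z L2_set_nonneg[of v "{..<d}"]]
    by (simp add: mult.commute)
  ultimately have "y * score d \<gamma> v x \<le> \<gamma>' * L2_set v {..<d}"
    by (simp add: right_diff_distrib)
  then show ?thesis by (simp add: margin_def score_def e)
qed

section \<open>Measurability of the robust risk\<close>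

definition ball_in_ball :: "nat \<Rightarrow> real \<Rightarrow> point \<Rightarrow> point set" where
  "ball_in_ball d r x = {z \<in> unit_ball d. L2_set (\<lambda>i. z i - x i) {..<d} \<le> r}"

text \<open>Points are functions on all of \<open>nat\<close>, but extensionality pins the
  coordinates from \<open>d\<close> on to \<open>undefined\<close>. The set is thus closed inside a
  Tychonoff product of intervals and singletons.\<close>

lemma compact_ball_in_ball: "compact (ball_in_ball d r x)"
proof -
  define T where "T = PiE UNIV (\<lambda>i. if i < d then {-1..1} else {undefined :: real})"
  have "compactin (product_topology (\<lambda>i::nat. euclidean) UNIV) T"
    unfolding T_def compactin_PiE by simp
  then have "compact T" by (simp add: euclidean_product_topology)
  moreover have "closed {z. L2_set z {..<d} \<le> 1}" "closed {z. L2_set (\<lambda>i. z i - x i) {..<d} \<le> r}"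
    unfolding L2_set_def by (intro closed_Collect_le continuous_intros continuous_on_product_coordinates)+
  ultimately have "compact (T \<inter> {z. L2_set z {..<d} \<le> 1} \<inter> {z. L2_set (\<lambda>i. z i - x i) {..<d} \<le> r})"
    by (intro compact_Int_closed)
  moreover have "T \<inter> {z. L2_set z {..<d} \<le> 1} \<inter> {z. L2_set (\<lambda>i. z i - x i) {..<d} \<le> r} = ball_in_ball d r x"
  proof -
    have "z \<in> T" if z: "z \<in> extensional {..<d}" "L2_set z {..<d} \<le> 1" for z
    proof -
      have "\<bar>z i\<bar> \<le> 1" if "i < d" for i
      proof -
        have "\<bar>z i\<bar> \<le> L2_set (\<lambda>i. \<bar>z i\<bar>) {..<d}"
          using that by (intro member_le_L2_set) auto
        also have "\<dots> = L2_set z {..<d}" by (simp add: L2_set_def)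
        finally show ?thesis using z(2) by simp
      qed
      then show ?thesis using z(1) by (auto simp: T_def extensional_def abs_le_iff)
    qed
    moreover have "z \<in> extensional {..<d}" if "z \<in> T" for z
      using that by (auto simp: T_def extensional_def PiE_iff split: if_splits)
    ultimately show ?thesis by (auto simp: ball_in_ball_def unit_ball_def)
  qed
  ultimately show ?thesis by simp
qed

lemma continuous_on_score: "continuous_on S (score d \<gamma> v)"
proof -
  have "continuous_on UNIV (score d \<gamma> v)"
    unfolding score_def[abs_def] ip_def augment_def
    by (simp add: continuous_intros)
  then show ?thesis by (rule continuous_on_subset) simp
qed

definition rational_points :: "nat \<Rightarrow> point set" where
  "rational_points d = PiE {..<d} (\<lambda>_. \<rat>)"

lemma rational_points: "countable (rational_points d)" "rational_points d \<noteq> {}"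
proof -
  show "countable (rational_points d)"
    unfolding rational_points_def by (intro countable_PiE) (auto simp: countable_rat)
  have "(\<lambda>i\<in>{..<d}. 0) \<in> rational_points d" by (auto simp: rational_points_def)
  then show "rational_points d \<noteq> {}" by blast
qed

text \<open>A point on the boundary of one of the two balls cannot simply be rounded. It is first
  moved slightly towards a point interior to both, which creates room \<open>\<rho>\<close> for
  rounding all coordinates.\<close>

lemma rational_point_approx:
  assumes x: "x \<in> unit_ball d" and z: "z \<in> ball_in_ball d r x" and r: "0 < r" "r \<le> 1" and e: "0 < e"
  obtains q where "q \<in> rational_points d" "q \<in> ball_in_ball d r x" "\<bar>score d \<gamma> v q - score d \<gamma> v z\<bar> < e"
proof -
  define V where "V = L2_set v {..<d}"
  have V: "0 \<le> V" by (simp add: V_def)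
  define l where "l = min 1 (e / (4 * (V + 1)))"
  have l: "0 < l" "l \<le> 1" "l \<le> e / (4 * (V + 1))" using e V by (auto simp: l_def)
  define \<rho> where "\<rho> = l * (r / 2)"
  have rho: "0 < \<rho>" "\<rho> \<le> l" using l r by (auto simp: \<rho>_def)
  \<comment> \<open>The point \<open>(1 - r / 2) * x\<close> has norm at most
    \<open>1 - r / 2\<close> and distance at most \<open>r / 2\<close> from \<open>x\<close>. Mixing
    it into \<open>z\<close> with weight \<open>l\<close> therefore leaves slack
    \<open>l * r / 2\<close> in both constraints, while the move has length at most
    \<open>2 * l\<close>.\<close>
  define c where "c = (\<lambda>i. (1 - l) * z i + l * (1 - r / 2) * x i)"
  have "\<exists>t\<in>\<rat>. \<bar>t - c i\<bar> < \<rho> / (d + 1)" for i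
  proof -
    have "0 < \<rho> / (d + 1)" using rho by simp
    then obtain t where "t \<in> \<rat>" "c i < t" "t < c i + \<rho> / (d + 1)"
      using Rats_dense_in_real[of "c i" "c i + \<rho> / (d + 1)"] by auto
    then show ?thesis by (intro bexI[of _ t]) auto
  qed
  then obtain t where t: "\<And>i. t i \<in> \<rat>" "\<And>i. \<bar>t i - c i\<bar> < \<rho> / (d + 1)" by metis
  define q where "q = restrict t {..<d}"
  have "L2_set (\<lambda>i. q i - c i) {..<d} \<le> (\<Sum>i<d. \<bar>q i - c i\<bar>)"
    by (rule L2_set_le_sum_abs)
  also have "\<dots> \<le> (\<Sum>i<d. \<rho> / (d + 1))"
    using t(2) by (intro sum_mono) (auto simp: q_def less_imp_le)
  also have "\<dots> \<le> \<rho>" using rho by (simp add: field_simps)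
  finally have qc: "L2_set (\<lambda>i. q i - c i) {..<d} \<le> \<rho>" .
  have zb: "L2_set z {..<d} \<le> 1" "L2_set (\<lambda>i. z i - x i) {..<d} \<le> r" and xb: "L2_set x {..<d} \<le> 1"
    using x z by (auto simp: ball_in_ball_def unit_ball_def)
  have scale: "L2_set (\<lambda>i. a * u i) {..<d} = \<bar>a\<bar> * L2_set u {..<d}" for a and u :: point
    unfolding L2_set_eq_sqrt_ip ip_scale_left ip_scale_right mult.assoc[symmetric] real_sqrt_mult
    by simp
  have cn: "L2_set c {..<d} \<le> 1 - \<rho>"
  proof -
    have "L2_set c {..<d} \<le> L2_set (\<lambda>i. (1 - l) * z i) {..<d} + L2_set (\<lambda>i. l * (1 - r / 2) * x i) {..<d}"
      unfolding c_def by (rule L2_set_triangle_ineq)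
    also have "\<dots> \<le> (1 - l) * 1 + (l * (1 - r / 2)) * 1"
      unfolding scale using l r zb xb by (intro add_mono mult_mono) auto
    also have "\<dots> = 1 - \<rho>" by (simp add: \<rho>_def algebra_simps)
    finally show ?thesis .
  qed
  have cx: "L2_set (\<lambda>i. c i - x i) {..<d} \<le> r - \<rho>"
  proof -
    have "L2_set (\<lambda>i. c i - x i) {..<d} = L2_set (\<lambda>i. (1 - l) * (z i - x i) + (- \<rho>) * x i) {..<d}"
      by (rule L2_set_cong) (auto simp: c_def \<rho>_def algebra_simps)
    also have "\<dots> \<le> L2_set (\<lambda>i. (1 - l) * (z i - x i)) {..<d} + L2_set (\<lambda>i. (- \<rho>) * x i) {..<d}"
      by (rule L2_set_triangle_ineq)
    also have "\<dots> \<le> (1 - l) * r + \<rho> * 1"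
      unfolding scale using l r zb xb rho by (intro add_mono mult_mono) auto
    also have "\<dots> = r - \<rho>" by (simp add: \<rho>_def algebra_simps)
    finally show ?thesis .
  qed
  have cz: "L2_set (\<lambda>i. c i - z i) {..<d} \<le> 2 * l"
  proof -
    have "L2_set (\<lambda>i. c i - z i) {..<d} = L2_set (\<lambda>i. (- l) * z i + (l * (1 - r / 2)) * x i) {..<d}"
      by (rule L2_set_cong) (auto simp: c_def algebra_simps)
    also have "\<dots> \<le> L2_set (\<lambda>i. (- l) * z i) {..<d} + L2_set (\<lambda>i. (l * (1 - r / 2)) * x i) {..<d}"
      by (rule L2_set_triangle_ineq)
    also have "\<dots> \<le> l * 1 + l * 1"
      unfolding scale using l r zb xb by (intro add_mono mult_mono) (auto simp: abs_mult mult_le_cancel_left1)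
    finally show ?thesis by simp
  qed
  show ?thesis
  proof (rule that[of q])
    show "q \<in> rational_points d" using t(1) by (auto simp: q_def rational_points_def)
    have "L2_set q {..<d} \<le> 1"
      using L2_set_triangle_ineq[of "\<lambda>i. q i - c i" c "{..<d}"] qc cn by simp
    moreover have "L2_set (\<lambda>i. q i - x i) {..<d} \<le> r"
      using L2_set_diff_triangle[of q x "{..<d}" c] qc cx by simp
    ultimately show "q \<in> ball_in_ball d r x"
      by (simp add: ball_in_ball_def unit_ball_def q_def)
    have "\<bar>score d \<gamma> v q - score d \<gamma> v z\<bar> \<le> V * L2_set (\<lambda>i. q i - z i) {..<d}"
      unfolding V_def by (rule score_Lipschitz)
    also have "\<dots> \<le> V * (3 * l)"
      using L2_set_diff_triangle[of q z "{..<d}" c] qc cz rho V by (intro mult_left_mono) auto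
    also have "\<dots> \<le> V * (3 * (e / (4 * (V + 1))))"
      using l V by (intro mult_left_mono) auto
    also have "\<dots> < e" using V e by (simp add: field_simps add_nonneg_pos)
    finally show "\<bar>score d \<gamma> v q - score d \<gamma> v z\<bar> < e" .
  qed
qed

text \<open>A positive label is violated on an open and a negative label on a closed set of points, so
  in the latter case the countable quantifier over rational points needs compactness.\<close>

lemma robust_error_iff_rational:
  assumes e: "(x, y) \<in> unit_ball d \<times> labels" and r: "0 < r" "r \<le> 1"
  shows "(x, y) \<in> robust_error d r (affine_hypothesis d \<gamma> v) \<longleftrightarrow>
    (y = 1 \<and> (\<exists>n. from_nat_into (rational_points d) n \<in> ball_in_ball d r x \<and>
        score d \<gamma> v (from_nat_into (rational_points d) n) < 0)) \<or>
    (y = - 1 \<and> (\<forall>k::nat. \<exists>n. from_nat_into (rational_points d) n \<in> ball_in_ball d r x \<and>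
        - (1 / real (Suc k)) < score d \<gamma> v (from_nat_into (rational_points d) n)))"
proof -
  let ?B = "ball_in_ball d r x" and ?Q = "rational_points d" and ?f = "score d \<gamma> v"
  have x: "x \<in> unit_ball d" using e by simp
  have ex: "(\<exists>n. P (from_nat_into ?Q n)) \<longleftrightarrow> (\<exists>q\<in>?Q. P q)" for P
    using rational_points[of d] by (metis from_nat_into from_nat_into_surj)
  have "(\<exists>z\<in>?B. ?f z < 0) \<longleftrightarrow> (\<exists>q\<in>?Q. q \<in> ?B \<and> ?f q < 0)"
  proof
    assume "\<exists>z\<in>?B. ?f z < 0"
    then obtain z where z: "z \<in> ?B" "?f z < 0" by blast
    from rational_point_approx[OF x z(1) r, of "- ?f z" \<gamma> v] z(2)
    obtain q where "q \<in> ?Q" "q \<in> ?B" "\<bar>?f q - ?f z\<bar> < - ?f z" by auto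
    then show "\<exists>q\<in>?Q. q \<in> ?B \<and> ?f q < 0" by (intro bexI[of _ q]) auto
  qed auto
  moreover have "(\<exists>z\<in>?B. 0 \<le> ?f z) \<longleftrightarrow> (\<forall>k::nat. \<exists>q\<in>?Q. q \<in> ?B \<and> - (1 / real (Suc k)) < ?f q)"
  proof (intro iffI allI)
    fix k :: nat
    assume "\<exists>z\<in>?B. 0 \<le> ?f z"
    then obtain z where z: "z \<in> ?B" "0 \<le> ?f z" by blast
    obtain q where "q \<in> ?Q" "q \<in> ?B" "\<bar>?f q - ?f z\<bar> < 1 / real (Suc k)"
      by (rule rational_point_approx[OF x z(1) r, of "1 / real (Suc k)" \<gamma> v]) auto
    then show "\<exists>q\<in>?Q. q \<in> ?B \<and> - (1 / real (Suc k)) < ?f q"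
      using z(2) by (intro bexI[of _ q]) auto
  next
    assume *: "\<forall>k::nat. \<exists>q\<in>?Q. q \<in> ?B \<and> - (1 / real (Suc k)) < ?f q"
    then have "?B \<noteq> {}" by blast
    then obtain z where z: "z \<in> ?B" "\<And>q. q \<in> ?B \<Longrightarrow> ?f q \<le> ?f z"
      using continuous_attains_sup[OF compact_ball_in_ball _ continuous_on_score] by metis
    have "0 \<le> ?f z"
    proof (rule ccontr)
      assume "\<not> 0 \<le> ?f z"
      then obtain k :: nat where "1 / real (Suc k) < - ?f z"
        using nat_approx_posE[of "- ?f z"] by (auto simp: of_nat_Suc)
      with * z show False by (metis less_le_not_le minus_less_iff order_less_le_trans order_less_trans)
    qed
    with z show "\<exists>z\<in>?B. 0 \<le> ?f z" by blast
  qed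
  moreover have "(x, y) \<in> robust_error d r (affine_hypothesis d \<gamma> v) \<longleftrightarrow>
      (y = 1 \<and> (\<exists>z\<in>?B. ?f z < 0)) \<or> (y = - 1 \<and> (\<exists>z\<in>?B. 0 \<le> ?f z))"
    using e by (auto simp: robust_error_def affine_hypothesis_def ball_in_ball_def labels_def sgn_pm_def not_le split: if_splits)
  moreover have "(\<exists>n. from_nat_into ?Q n \<in> ?B \<and> ?f (from_nat_into ?Q n) < 0) \<longleftrightarrow> (\<exists>q\<in>?Q. q \<in> ?B \<and> ?f q < 0)"
    by (rule ex)
  moreover have "(\<exists>n. from_nat_into ?Q n \<in> ?B \<and> - (1 / real (Suc k)) < ?f (from_nat_into ?Q n))
      \<longleftrightarrow> (\<exists>q\<in>?Q. q \<in> ?B \<and> - (1 / real (Suc k)) < ?f q)" for k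
    by (rule ex)
  ultimately show ?thesis by (simp only:)
qed

text \<open>Stated jointly in weights and example because both consequences are used: sections make
  each robust error event measurable, and integrating them out makes the risk a measurable function
  of the random weights.\<close>

lemma measurable_affine_hypothesis_robust_error:
  assumes D: "distribution d D" and r: "0 < r" "r \<le> 1"
  shows "{(v, e) \<in> space (Pi\<^sub>M UNIV (\<lambda>_. borel) \<Otimes>\<^sub>M D). e \<in> robust_error d r (affine_hypothesis d \<gamma> v)}
    \<in> sets (Pi\<^sub>M UNIV (\<lambda>_. borel) \<Otimes>\<^sub>M D)"
proof -
  let ?M = "Pi\<^sub>M UNIV (\<lambda>_::nat. borel :: real measure) \<Otimes>\<^sub>M D"
  let ?q = "from_nat_into (rational_points d)"
  have q: "?q n \<in> extensional {..<d}" for n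
    using from_nat_into[OF rational_points(2), of d n] by (auto simp: rational_points_def PiE_def)
  have fi: "(\<lambda>p. fst (snd p) i) \<in> borel_measurable ?M" if "i < d" for i
    using measurable_compose[OF measurable_snd measurable_distribution(1)[OF D that]] .
  have [measurable]: "(\<lambda>p. snd (snd p)) \<in> borel_measurable ?M"
    using measurable_compose[OF measurable_snd measurable_distribution(2)[OF D]] .
  have [measurable]: "(\<lambda>p. L2_set (\<lambda>i. ?q n i - fst (snd p) i) {..<d}) \<in> borel_measurable ?M" for n
  proof -
    have [measurable]: "(\<lambda>p. \<Sum>i<d. (?q n i - fst (snd p) i)\<^sup>2) \<in> borel_measurable ?M"
      by (intro borel_measurable_sum borel_measurable_power borel_measurable_diff fi) auto
    show ?thesis unfolding L2_set_def by measurable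
  qed
  have [measurable]: "(\<lambda>p. score d \<gamma> (fst p) z) \<in> borel_measurable ?M" for z
    unfolding score_def ip_def by measurable
  have "{p \<in> space ?M. (snd (snd p) = 1 \<and> (\<exists>n. ?q n \<in> unit_ball d \<and> L2_set (\<lambda>i. ?q n i - fst (snd p) i) {..<d} \<le> r \<and>
        score d \<gamma> (fst p) (?q n) < 0)) \<or>
      (snd (snd p) = - 1 \<and> (\<forall>k::nat. \<exists>n. ?q n \<in> unit_ball d \<and> L2_set (\<lambda>i. ?q n i - fst (snd p) i) {..<d} \<le> r \<and>
        - (1 / real (Suc k)) < score d \<gamma> (fst p) (?q n)))} \<in> sets ?M"
    by measurable
  also have "{p \<in> space ?M. (snd (snd p) = 1 \<and> (\<exists>n. ?q n \<in> unit_ball d \<and> L2_set (\<lambda>i. ?q n i - fst (snd p) i) {..<d} \<le> r \<and>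
        score d \<gamma> (fst p) (?q n) < 0)) \<or>
      (snd (snd p) = - 1 \<and> (\<forall>k::nat. \<exists>n. ?q n \<in> unit_ball d \<and> L2_set (\<lambda>i. ?q n i - fst (snd p) i) {..<d} \<le> r \<and>
        - (1 / real (Suc k)) < score d \<gamma> (fst p) (?q n)))}
    = {(v, e) \<in> space ?M. e \<in> robust_error d r (affine_hypothesis d \<gamma> v)}"
  proof (intro set_eqI)
    fix p :: "point \<times> example"
    obtain v x y where p: "p = (v, (x, y))" by (cases p) auto
    show "p \<in> {p \<in> space ?M. (snd (snd p) = 1 \<and> (\<exists>n. ?q n \<in> unit_ball d \<and> L2_set (\<lambda>i. ?q n i - fst (snd p) i) {..<d} \<le> r \<and>
        score d \<gamma> (fst p) (?q n) < 0)) \<or>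
      (snd (snd p) = - 1 \<and> (\<forall>k::nat. \<exists>n. ?q n \<in> unit_ball d \<and> L2_set (\<lambda>i. ?q n i - fst (snd p) i) {..<d} \<le> r \<and>
        - (1 / real (Suc k)) < score d \<gamma> (fst p) (?q n)))}
      \<longleftrightarrow> p \<in> {(v, e) \<in> space ?M. e \<in> robust_error d r (affine_hypothesis d \<gamma> v)}"
    proof (cases "p \<in> space ?M")
      case True
      then have "(x, y) \<in> unit_ball d \<times> labels"
        by (auto simp: p space_pair_measure space_distribution[OF D])
      from robust_error_iff_rational[OF this r, of \<gamma> v] True show ?thesis
        by (simp add: p ball_in_ball_def)
    qed auto
  qed
  finally show ?thesis .
qed

lemma robust_risk_affine_hypothesis:
  assumes D: "distribution d D" and r: "0 < r" "r \<le> 1"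
  shows "robust_risk d r (affine_hypothesis d \<gamma> v) D = emeasure D (robust_error d r (affine_hypothesis d \<gamma> v))"
    and "(\<lambda>v. robust_risk d r (affine_hypothesis d \<gamma> v) D) \<in> borel_measurable (Pi\<^sub>M UNIV (\<lambda>_. borel))"
    and "robust_error d r (affine_hypothesis d \<gamma> v) \<in> sets D"
proof -
  interpret D: prob_space D using D by (simp add: distribution_def)
  let ?R = "{(v, e) \<in> space (Pi\<^sub>M UNIV (\<lambda>_. borel) \<Otimes>\<^sub>M D). e \<in> robust_error d r (affine_hypothesis d \<gamma> v)}"
  have R: "?R \<in> sets (Pi\<^sub>M UNIV (\<lambda>_. borel) \<Otimes>\<^sub>M D)"
    by (rule measurable_affine_hypothesis_robust_error[OF assms])
  have sec: "Pair v -` ?R = robust_error d r (affine_hypothesis d \<gamma> v)" for v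
    by (auto simp: space_pair_measure space_PiM space_distribution[OF D] robust_error_def)
  show m: "robust_error d r (affine_hypothesis d \<gamma> v) \<in> sets D" for v
    using sets_Pair1[OF R, of v] by (simp only: sec)
  show eq: "robust_risk d r (affine_hypothesis d \<gamma> v) D = emeasure D (robust_error d r (affine_hypothesis d \<gamma> v))" for v
    unfolding robust_risk_def by (rule outer_measure_of_eq[OF m])
  show "(\<lambda>v. robust_risk d r (affine_hypothesis d \<gamma> v) D) \<in> borel_measurable (Pi\<^sub>M UNIV (\<lambda>_. borel))"
    using D.measurable_emeasure_Pair[OF R] by (simp only: sec eq)
qed

section \<open>Privacy and utility of the noisy average\<close>

text \<open>Cells beyond the weights are 0 because array \<open>Out\<close> starts out as 0; in this
  form it equals the whole released array, which is what privacy is about.\<close>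

definition noisy_mean :: "nat \<Rightarrow> real \<Rightarrow> real \<Rightarrow> real \<Rightarrow> nat \<Rightarrow> example list \<Rightarrow> coins \<Rightarrow> point" where
  "noisy_mean d \<gamma> \<eta> \<sigma> n X \<omega> = (\<lambda>i. if i < Suc d then sgd_mean d \<gamma> \<eta> n X i + \<sigma> * snd \<omega> i else 0)"

lemma sgd_mean_norm: "0 < n \<Longrightarrow> L2_set (sgd_mean d \<gamma> \<eta> n X) {..<Suc d} \<le> 1"
proof -
  assume n: "0 < n"
  let ?w = "\<lambda>k. sgd d \<gamma> \<eta> (take k (take n X)) (\<lambda>_. 0)"
  let ?T = "trajectory_sum d \<gamma> \<eta> (take n X) (\<lambda>_. 0)"
  have "L2_set ?T {..<Suc d} \<le> (\<Sum>k<length (take n X). L2_set (?w k) {..<Suc d})"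
    unfolding trajectory_sum_def by (rule L2_set_sum_le)
  also have "\<dots> \<le> (\<Sum>k<length (take n X). 1)"
    by (intro sum_mono) (simp add: L2_set_eq_sqrt_ip sgd_ip_le_1 ip_def[of _ "\<lambda>_. 0"])
  also have "\<dots> \<le> n" by simp
  finally have "(1 / n) * L2_set ?T {..<Suc d} \<le> (1 / n) * n"
    by (intro mult_left_mono) auto
  also have "(1 / n) * L2_set ?T {..<Suc d} = L2_set (sgd_mean d \<gamma> \<eta> n X) {..<Suc d}"
    by (subst L2_set_right_distrib) (auto simp: sgd_mean_def)
  finally show ?thesis using n by simp
qed

text \<open>A union bound in additive form, ready for expectations: one of the three terms alone
  reaches 1. If the noise has norm at most \<open>1 / 30\<close> and changes the margin by at most
  \<open>0.03 * \<gamma>\<close>, the margin of the mean is at most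
  \<open>0.9 * (1 + 1 / 30) + 0.03 = 0.96\<close> times \<open>\<gamma>\<close>, so the hinge is at
  least \<open>0.02 * \<gamma>\<close>. The factors are \<open>50 = 1 / 0.02\<close>,
  \<open>10000 / 9 = (100 / 3)\<^sup>2\<close> and \<open>900 = 30\<^sup>2\<close>.\<close>

lemma noisy_mean_robust_error:
  assumes e: "e \<in> robust_error d (0.9 * \<gamma>) (affine_hypothesis d \<gamma> (noisy_mean d \<gamma> \<eta> \<sigma> n X \<omega>))"
    and g: "0 < \<gamma>" and n: "0 < n"
  shows "1 \<le> 50 / \<gamma> * hinge d \<gamma> (sgd_mean d \<gamma> \<eta> n X) e
    + 10000 * \<sigma>\<^sup>2 / (9 * \<gamma>\<^sup>2) * (margin d \<gamma> (snd \<omega>) e)\<^sup>2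
    + 900 * \<sigma>\<^sup>2 * (\<Sum>i<Suc d. (snd \<omega> i)\<^sup>2)"
proof -
  let ?v = "noisy_mean d \<gamma> \<eta> \<sigma> n X \<omega>" and ?w = "sgd_mean d \<gamma> \<eta> n X" and ?z = "snd \<omega>"
  define N where "N = L2_set (\<lambda>i. \<sigma> * ?z i) {..<Suc d}"
  have N2: "N\<^sup>2 = \<sigma>\<^sup>2 * (\<Sum>i<Suc d. (?z i)\<^sup>2)"
    unfolding N_def L2_set_def by (simp add: sum_nonneg power_mult_distrib sum_distrib_left del: sum.lessThan_Suc)
  have "L2_set ?v {..<d} \<le> L2_set ?v {..<Suc d}"
    unfolding L2_set_def by (intro real_sqrt_le_mono sum_mono2) auto
  also have "\<dots> = L2_set (\<lambda>i. ?w i + \<sigma> * ?z i) {..<Suc d}"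
    by (rule L2_set_cong) (auto simp: noisy_mean_def)
  also have "\<dots> \<le> 1 + N"
    unfolding N_def using L2_set_triangle_ineq[of ?w "\<lambda>i. \<sigma> * ?z i" "{..<Suc d}"] sgd_mean_norm[OF n, of d \<gamma> \<eta> X]
    by linarith
  finally have v: "L2_set ?v {..<d} \<le> 1 + N" .
  have "margin d \<gamma> ?v e = snd e * ip (Suc d) (\<lambda>i. ?w i + \<sigma> * ?z i) (augment d \<gamma> (fst e))"
    unfolding margin_def by (intro arg_cong2[where f="(*)"] refl ip_cong) (auto simp: noisy_mean_def)
  also have "\<dots> = margin d \<gamma> ?w e + \<sigma> * margin d \<gamma> ?z e"
    unfolding margin_def by (simp only: ip_bilinear) (simp add: algebra_simps)
  finally have eq: "margin d \<gamma> ?v e = margin d \<gamma> ?w e + \<sigma> * margin d \<gamma> ?z e" .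
  have m: "margin d \<gamma> ?w e + \<sigma> * margin d \<gamma> ?z e \<le> 0.9 * \<gamma> * (1 + N)"
  proof -
    have "0.9 * \<gamma> * L2_set ?v {..<d} \<le> 0.9 * \<gamma> * (1 + N)"
      by (rule mult_left_mono[OF v]) (use g in simp)
    with robust_error_margin[OF e] show ?thesis unfolding eq by (rule order_trans)
  qed
  have h0: "0 \<le> 50 / \<gamma> * hinge d \<gamma> ?w e" using g by (simp add: hinge_def)
  have z0: "0 \<le> 10000 * \<sigma>\<^sup>2 / (9 * \<gamma>\<^sup>2) * (margin d \<gamma> ?z e)\<^sup>2" by simp
  have n0: "0 \<le> 900 * \<sigma>\<^sup>2 * (\<Sum>i<Suc d. (?z i)\<^sup>2)" by (intro mult_nonneg_nonneg sum_nonneg) auto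
  consider "1 / 30 < N" | "3 / 100 * \<gamma> < \<bar>\<sigma> * margin d \<gamma> ?z e\<bar>" | "N \<le> 1 / 30" "\<bar>\<sigma> * margin d \<gamma> ?z e\<bar> \<le> 3 / 100 * \<gamma>"
    by linarith
  then show ?thesis
  proof cases
    case 1
    then have "(1 / 30)\<^sup>2 \<le> N\<^sup>2" by (intro power_mono) auto
    then have "1 \<le> 900 * \<sigma>\<^sup>2 * (\<Sum>i<Suc d. (?z i)\<^sup>2)"
      unfolding N2 by (simp add: power2_eq_square del: sum.lessThan_Suc)
    then show ?thesis using h0 z0 by linarith
  next
    case 2
    then have "(3 / 100 * \<gamma>)\<^sup>2 \<le> \<bar>\<sigma> * margin d \<gamma> ?z e\<bar>\<^sup>2" using g by (intro power_mono) auto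
    then have "9 * \<gamma>\<^sup>2 \<le> 10000 * (\<sigma>\<^sup>2 * (margin d \<gamma> ?z e)\<^sup>2)"
      by (simp add: power2_eq_square algebra_simps)
    then have "1 \<le> 10000 * \<sigma>\<^sup>2 / (9 * \<gamma>\<^sup>2) * (margin d \<gamma> ?z e)\<^sup>2"
      using g by (simp add: field_simps)
    then show ?thesis using h0 n0 by linarith
  next
    case 3
    have "0.9 * \<gamma> * (1 + N) \<le> 0.9 * \<gamma> * (1 + 1 / 30)"
      using 3 g by (intro mult_left_mono) auto
    then have "margin d \<gamma> ?w e \<le> 0.96 * \<gamma>" using m 3(2) by (simp add: abs_le_iff)
    then have "0.02 * \<gamma> \<le> 0.98 * \<gamma> - margin d \<gamma> ?w e" by simp
    then have "0.02 * \<gamma> \<le> hinge d \<gamma> ?w e" unfolding hinge_def by (rule max.coboundedI2)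
    then have "1 \<le> 50 / \<gamma> * hinge d \<gamma> ?w e" using g by (simp add: field_simps)
    then show ?thesis using z0 n0 by linarith
  qed
qed

lemma measurable_sgd_mean:
  assumes D: "distribution d D"
  shows "(\<lambda>s. sgd_mean d \<gamma> \<eta> n (map s [0..<n]) i) \<in> borel_measurable (Pi\<^sub>M {..<n} (\<lambda>_. D))"
proof -
  have "(\<lambda>s. \<Sum>k<n. sgd d \<gamma> \<eta> (map s [0..<k]) (\<lambda>_. 0) i) \<in> borel_measurable (Pi\<^sub>M {..<n} (\<lambda>_. D))"
    by (intro borel_measurable_sum measurable_sgd[OF D]) simp
  then show ?thesis
    unfolding sgd_mean_def trajectory_sum_def by (simp add: take_map)
qed

lemma measurable_coin_normal [measurable]: "(\<lambda>\<omega>. snd \<omega> i) \<in> borel_measurable coin_space"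
  by measurable

lemma nn_integral_coins_square_le:
  "(\<integral>\<^sup>+\<omega>. ennreal ((\<Sum>i<m. c i * snd \<omega> i)\<^sup>2) \<partial>coin_space) \<le> ennreal (2 * exp ((\<Sum>i<m. (c i)\<^sup>2) / 2))"
proof -
  have "(\<integral>\<^sup>+\<omega>. ennreal ((\<Sum>i<m. c i * snd \<omega> i)\<^sup>2) \<partial>coin_space)
      = (\<integral>\<^sup>+\<omega>. ennreal ((\<Sum>i<m. c i * restrict (snd \<omega>) {..<m} i)\<^sup>2) \<partial>coin_space)"
    by simp
  also have "\<dots> = (\<integral>\<^sup>+x. ennreal ((\<Sum>i<m. c i * x i)\<^sup>2) \<partial>Pi\<^sub>M {..<m} (\<lambda>_. gauss))"
    by (rule nn_integral_coins) measurable
  also have "\<dots> \<le> ennreal (2 * exp ((\<Sum>i<m. (c i)\<^sup>2) / 2))"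
    by (rule nn_integral_gauss_square_le) simp
  finally show ?thesis .
qed

text \<open>The three terms of \<open>noisy_mean_robust_error\<close> separate the randomness:
  \<open>F1\<close> depends on the sample and the test example, \<open>F2\<close> on the coins and
  the test example, \<open>F3\<close> on the coins only, and each is integrated separately. The
  first constant is 50 times the 50 of the expected hinge.\<close>

lemma nn_integral_robust_risk:
  assumes D: "distribution d D" "realizable d \<gamma> D" and g: "0 < \<gamma>" "\<gamma> \<le> 1" and h: "0 < \<eta>" "\<eta> \<le> 1/2"
    and n: "0 < n"
  shows "(\<integral>\<^sup>+s. (\<integral>\<^sup>+\<omega>. robust_risk d (0.9 * \<gamma>) (affine_hypothesis d \<gamma> (noisy_mean d \<gamma> \<eta> \<sigma> n (map s [0..<n]) \<omega>)) D \<partial>coin_space)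
      \<partial>Pi\<^sub>M {..<n} (\<lambda>_. D))
    \<le> ennreal (2500 / (n * \<gamma>\<^sup>2 * \<eta>) + 6 * (10000 * \<sigma>\<^sup>2 / (9 * \<gamma>\<^sup>2)) + 900 * \<sigma>\<^sup>2 * (4 * real (Suc d)))"
proof -
  let ?P = "Pi\<^sub>M {..<n} (\<lambda>_. D)"
  have D': "prob_space D" using D(1) by (simp add: distribution_def)
  interpret D: prob_space D by (rule D')
  interpret P: prob_space ?P by (intro prob_space_PiM D')
  interpret C: prob_space coin_space by (rule prob_space_coin_space)
  interpret CD: pair_sigma_finite coin_space D by standard
  let ?w = "\<lambda>s. sgd_mean d \<gamma> \<eta> n (map s [0..<n])"
  define F1 where "F1 s e = ennreal (50 / \<gamma>) * ennreal (hinge d \<gamma> (?w s) e)" for s e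
  define F2 where "F2 \<omega> e = ennreal (10000 * \<sigma>\<^sup>2 / (9 * \<gamma>\<^sup>2)) * ennreal ((margin d \<gamma> (snd \<omega>) e)\<^sup>2)" for \<omega> :: coins and e
  define F3 where "F3 \<omega> = ennreal (900 * \<sigma>\<^sup>2) * (\<Sum>i<Suc d. ennreal ((snd \<omega> i)\<^sup>2))" for \<omega> :: coins
  have [measurable]: "case_prod F1 \<in> borel_measurable (?P \<Otimes>\<^sub>M D)"
  proof -
    have "(\<lambda>x. ?w (fst x) i) \<in> borel_measurable (?P \<Otimes>\<^sub>M D)" for i
      using measurable_compose[OF measurable_fst measurable_sgd_mean[OF D(1)]] .
    then have [measurable]: "(\<lambda>x. margin d \<gamma> (?w (fst x)) (snd x)) \<in> borel_measurable (?P \<Otimes>\<^sub>M D)"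
      by (intro measurable_margin(1)[OF D(1)]) measurable
    show ?thesis unfolding F1_def hinge_def case_prod_beta by measurable
  qed
  have [measurable]: "case_prod F2 \<in> borel_measurable (coin_space \<Otimes>\<^sub>M D)"
  proof -
    have [measurable]: "(\<lambda>x. margin d \<gamma> (snd (fst x)) (snd x)) \<in> borel_measurable (coin_space \<Otimes>\<^sub>M D)"
      by (intro measurable_margin(1)[OF D(1)] measurable_compose[OF measurable_fst measurable_coin_normal]) measurable
    show ?thesis unfolding F2_def case_prod_beta by measurable
  qed
  have [measurable]: "F3 \<in> borel_measurable coin_space"
    unfolding F3_def by measurable
  have F1s: "F1 s \<in> borel_measurable D" if "s \<in> space ?P" for s
    using measurable_compose_Pair1[OF that, of "case_prod F1" D borel] by simp
  have F2w: "F2 \<omega> \<in> borel_measurable D" for \<omega>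
    using measurable_compose_Pair1[of \<omega> coin_space "case_prod F2" D borel] by simp
  have risk: "robust_risk d (0.9 * \<gamma>) (affine_hypothesis d \<gamma> (noisy_mean d \<gamma> \<eta> \<sigma> n (map s [0..<n]) \<omega>)) D
      \<le> (\<integral>\<^sup>+e. F1 s e \<partial>D) + (\<integral>\<^sup>+e. F2 \<omega> e \<partial>D) + F3 \<omega>" if s: "s \<in> space ?P" for s \<omega>
  proof -
    let ?E = "robust_error d (0.9 * \<gamma>) (affine_hypothesis d \<gamma> (noisy_mean d \<gamma> \<eta> \<sigma> n (map s [0..<n]) \<omega>))"
    have E: "?E \<in> sets D" by (rule robust_risk_affine_hypothesis(3)[OF D(1)]) (use g in auto)
    have "robust_risk d (0.9 * \<gamma>) (affine_hypothesis d \<gamma> (noisy_mean d \<gamma> \<eta> \<sigma> n (map s [0..<n]) \<omega>)) D = emeasure D ?E"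
      by (rule robust_risk_affine_hypothesis(1)[OF D(1)]) (use g in auto)
    also have "\<dots> = (\<integral>\<^sup>+e. indicator ?E e \<partial>D)" using E by simp
    also have "\<dots> \<le> (\<integral>\<^sup>+e. F1 s e + F2 \<omega> e + F3 \<omega> \<partial>D)"
    proof (intro nn_integral_mono)
      fix e
      show "indicator ?E e \<le> F1 s e + F2 \<omega> e + F3 \<omega>"
      proof (cases "e \<in> ?E")
        case True
        have hn: "0 \<le> hinge d \<gamma> (?w s) e" by (simp add: hinge_def)
        have h0: "0 \<le> 50 / \<gamma> * hinge d \<gamma> (?w s) e" using g by (simp add: hinge_def)
        have z0: "0 \<le> 10000 * \<sigma>\<^sup>2 / (9 * \<gamma>\<^sup>2) * (margin d \<gamma> (snd \<omega>) e)\<^sup>2" by simp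
        have n0: "0 \<le> 900 * \<sigma>\<^sup>2 * (\<Sum>i<Suc d. (snd \<omega> i)\<^sup>2)" by (intro mult_nonneg_nonneg sum_nonneg) auto
        have "F1 s e + F2 \<omega> e + F3 \<omega> = ennreal (50 / \<gamma> * hinge d \<gamma> (?w s) e
            + 10000 * \<sigma>\<^sup>2 / (9 * \<gamma>\<^sup>2) * (margin d \<gamma> (snd \<omega>) e)\<^sup>2 + 900 * \<sigma>\<^sup>2 * (\<Sum>i<Suc d. (snd \<omega> i)\<^sup>2))"
        proof -
          have "F1 s e = ennreal (50 / \<gamma> * hinge d \<gamma> (?w s) e)"
            unfolding F1_def by (rule ennreal_mult[symmetric]) (use g hn in auto)
          moreover have "F2 \<omega> e = ennreal (10000 * \<sigma>\<^sup>2 / (9 * \<gamma>\<^sup>2) * (margin d \<gamma> (snd \<omega>) e)\<^sup>2)"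
            unfolding F2_def by (rule ennreal_mult[symmetric]) auto
          moreover have "F3 \<omega> = ennreal (900 * \<sigma>\<^sup>2 * (\<Sum>i<Suc d. (snd \<omega> i)\<^sup>2))"
            unfolding F3_def by (subst sum_ennreal) (auto intro!: ennreal_mult[symmetric] sum_nonneg simp del: sum.lessThan_Suc)
          ultimately show ?thesis
            using h0 z0 n0 by (simp only: ennreal_plus add_nonneg_nonneg)
        qed
        moreover have "ennreal 1 \<le> ennreal (50 / \<gamma> * hinge d \<gamma> (?w s) e
            + 10000 * \<sigma>\<^sup>2 / (9 * \<gamma>\<^sup>2) * (margin d \<gamma> (snd \<omega>) e)\<^sup>2 + 900 * \<sigma>\<^sup>2 * (\<Sum>i<Suc d. (snd \<omega> i)\<^sup>2))"
          by (intro ennreal_leI noisy_mean_robust_error[OF True g(1) n])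
        ultimately show ?thesis using True by simp
      qed simp
    qed
    also have "\<dots> = (\<integral>\<^sup>+e. F1 s e \<partial>D) + (\<integral>\<^sup>+e. F2 \<omega> e \<partial>D) + F3 \<omega>"
      using F1s[OF s] F2w[of \<omega>] by (simp add: nn_integral_add D.emeasure_space_1)
    finally show ?thesis .
  qed
  have "(\<integral>\<^sup>+s. (\<integral>\<^sup>+\<omega>. robust_risk d (0.9 * \<gamma>) (affine_hypothesis d \<gamma> (noisy_mean d \<gamma> \<eta> \<sigma> n (map s [0..<n]) \<omega>)) D \<partial>coin_space) \<partial>?P)
      \<le> (\<integral>\<^sup>+s. (\<integral>\<^sup>+\<omega>. (\<integral>\<^sup>+e. F1 s e \<partial>D) + (\<integral>\<^sup>+e. F2 \<omega> e \<partial>D) + F3 \<omega> \<partial>coin_space) \<partial>?P)"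
    by (intro nn_integral_mono risk)
  also have "\<dots> = (\<integral>\<^sup>+s. (\<integral>\<^sup>+e. F1 s e \<partial>D) \<partial>?P) + (\<integral>\<^sup>+\<omega>. (\<integral>\<^sup>+e. F2 \<omega> e \<partial>D) \<partial>coin_space) + (\<integral>\<^sup>+\<omega>. F3 \<omega> \<partial>coin_space)"
    using C.emeasure_space_1 by (simp add: nn_integral_add P.emeasure_space_1)
  \<comment> \<open>With the example fixed first, the noise is seen in one direction of squared norm
    at most 2, so its second moment is at most \<open>2 * exp 1 \<le> 6\<close> independently of the
    dimension.\<close>
  also have "(\<integral>\<^sup>+\<omega>. (\<integral>\<^sup>+e. F2 \<omega> e \<partial>D) \<partial>coin_space) = (\<integral>\<^sup>+e. (\<integral>\<^sup>+\<omega>. F2 \<omega> e \<partial>coin_space) \<partial>D)"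
    by (rule CD.Fubini'[symmetric]) measurable
  also have "(\<integral>\<^sup>+s. (\<integral>\<^sup>+e. F1 s e \<partial>D) \<partial>?P) + (\<integral>\<^sup>+e. (\<integral>\<^sup>+\<omega>. F2 \<omega> e \<partial>coin_space) \<partial>D) + (\<integral>\<^sup>+\<omega>. F3 \<omega> \<partial>coin_space)
      \<le> ennreal (2500 / (n * \<gamma>\<^sup>2 * \<eta>)) + ennreal (6 * (10000 * \<sigma>\<^sup>2 / (9 * \<gamma>\<^sup>2))) + ennreal (900 * \<sigma>\<^sup>2 * (4 * real (Suc d)))"
  proof (intro add_mono)
    have hm: "(\<lambda>e. ennreal (hinge d \<gamma> (?w s) e)) \<in> borel_measurable D" for s
      unfolding hinge_def using measurable_margin(1)[OF D(1), of "\<lambda>e. e" D "\<lambda>_. ?w s" \<gamma>] by measurable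
    have "(\<integral>\<^sup>+s. (\<integral>\<^sup>+e. F1 s e \<partial>D) \<partial>?P) = (\<integral>\<^sup>+s. ennreal (50 / \<gamma>) * (\<integral>\<^sup>+e. ennreal (hinge d \<gamma> (?w s) e) \<partial>D) \<partial>?P)"
      unfolding F1_def by (simp add: nn_integral_cmult hm)
    also have "\<dots> = ennreal (50 / \<gamma>) * (\<integral>\<^sup>+s. (\<integral>\<^sup>+e. ennreal (hinge d \<gamma> (?w s) e) \<partial>D) \<partial>?P)"
    proof (rule nn_integral_cmult)
      have "(\<lambda>x. ?w (fst x) i) \<in> borel_measurable (?P \<Otimes>\<^sub>M D)" for i
        using measurable_compose[OF measurable_fst measurable_sgd_mean[OF D(1)]] .
      then have [measurable]: "(\<lambda>x. margin d \<gamma> (?w (fst x)) (snd x)) \<in> borel_measurable (?P \<Otimes>\<^sub>M D)"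
        by (intro measurable_margin(1)[OF D(1)]) measurable
      show "(\<lambda>s. \<integral>\<^sup>+e. ennreal (hinge d \<gamma> (?w s) e) \<partial>D) \<in> borel_measurable ?P"
        by (rule D.borel_measurable_nn_integral) (simp add: hinge_def case_prod_beta)
    qed
    also have "\<dots> \<le> ennreal (50 / \<gamma>) * ennreal (50 / (n * \<gamma> * \<eta>))"
      by (intro mult_left_mono nn_integral_hinge_sgd_mean[OF D g h n]) simp
    also have "\<dots> = ennreal (2500 / (n * \<gamma>\<^sup>2 * \<eta>))"
      using g h by (simp add: ennreal_mult[symmetric] power2_eq_square ac_simps)
    finally show "(\<integral>\<^sup>+s. (\<integral>\<^sup>+e. F1 s e \<partial>D) \<partial>?P) \<le> ennreal (2500 / (n * \<gamma>\<^sup>2 * \<eta>))" .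
  next
    have exp1: "2 * exp 1 \<le> (6::real)" using exp_le by simp
    have "(\<integral>\<^sup>+e. (\<integral>\<^sup>+\<omega>. F2 \<omega> e \<partial>coin_space) \<partial>D) \<le> (\<integral>\<^sup>+e. ennreal (6 * (10000 * \<sigma>\<^sup>2 / (9 * \<gamma>\<^sup>2))) \<partial>D)"
    proof (intro nn_integral_mono)
      fix e assume "e \<in> space D"
      then have e: "fst e \<in> unit_ball d" "snd e \<in> labels" by (auto simp: space_distribution[OF D(1)])
      let ?x = "augment d \<gamma> (fst e)"
      have "(\<integral>\<^sup>+\<omega>. F2 \<omega> e \<partial>coin_space) = ennreal (10000 * \<sigma>\<^sup>2 / (9 * \<gamma>\<^sup>2)) * (\<integral>\<^sup>+\<omega>. ennreal ((\<Sum>i<Suc d. ?x i * snd \<omega> i)\<^sup>2) \<partial>coin_space)"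
        unfolding F2_def margin_def ip_def power_mult_distrib
        using e(2) by (subst nn_integral_cmult[symmetric], measurable)
          (auto simp: labels_def mult.commute[of "?x _"] simp del: sum.lessThan_Suc)
      also have "\<dots> \<le> ennreal (10000 * \<sigma>\<^sup>2 / (9 * \<gamma>\<^sup>2)) * ennreal 6"
      proof (intro mult_left_mono order_trans[OF nn_integral_coins_square_le] ennreal_leI)
        have "(\<Sum>i<Suc d. (?x i)\<^sup>2) / 2 \<le> 1"
          using augment_ip_le[OF e(1), of \<gamma>] g by (simp add: ip_def power2_eq_square del: sum.lessThan_Suc)
        then have "exp ((\<Sum>i<Suc d. (?x i)\<^sup>2) / 2) \<le> exp 1" by (simp only: exp_le_cancel_iff)
        then show "2 * exp ((\<Sum>i<Suc d. (?x i)\<^sup>2) / 2) \<le> 6" using exp1 by linarith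
      qed simp
      also have "\<dots> = ennreal (6 * (10000 * \<sigma>\<^sup>2 / (9 * \<gamma>\<^sup>2)))"
        by (subst ennreal_mult[symmetric]) (simp_all add: mult.commute)
      finally show "(\<integral>\<^sup>+\<omega>. F2 \<omega> e \<partial>coin_space) \<le> ennreal (6 * (10000 * \<sigma>\<^sup>2 / (9 * \<gamma>\<^sup>2)))" .
    qed
    then show "(\<integral>\<^sup>+e. (\<integral>\<^sup>+\<omega>. F2 \<omega> e \<partial>coin_space) \<partial>D) \<le> ennreal (6 * (10000 * \<sigma>\<^sup>2 / (9 * \<gamma>\<^sup>2)))"
      by (simp add: D.emeasure_space_1)
  next
    have "(\<integral>\<^sup>+\<omega>. ennreal ((snd \<omega> i)\<^sup>2) \<partial>coin_space) \<le> ennreal 4" if "i < Suc d" for i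
    proof -
      have "exp (1 / 2) \<le> (2 :: real)"
        using exp_bound[of "1/2"] by (simp add: power2_eq_square)
      \<comment> \<open>The second moment of one coordinate is obtained from the bound for linear
        forms, with the \<open>i\<close>-th unit vector as coefficients.\<close>
      then have "2 * exp ((\<Sum>j<Suc d. (if j = i then 1 else 0 :: real)\<^sup>2) / 2) \<le> 4"
        using that by (simp add: if_distrib[of "\<lambda>x. x\<^sup>2"] cong: if_cong del: sum.lessThan_Suc)
      from order_trans[OF nn_integral_coins_square_le ennreal_leI[OF this]] that show ?thesis
        by (simp add: if_distrib[of "\<lambda>x. x * _"] cong: if_cong del: sum.lessThan_Suc)
    qed
    then have "(\<Sum>i<Suc d. \<integral>\<^sup>+\<omega>. ennreal ((snd \<omega> i)\<^sup>2) \<partial>coin_space) \<le> (\<Sum>i<Suc d. ennreal 4)"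
      by (intro sum_mono) simp
    also have "\<dots> = ennreal (4 * real (Suc d))"
      by (subst sum_ennreal) (simp_all del: sum.lessThan_Suc)
    finally have "ennreal (900 * \<sigma>\<^sup>2) * (\<Sum>i<Suc d. \<integral>\<^sup>+\<omega>. ennreal ((snd \<omega> i)\<^sup>2) \<partial>coin_space)
        \<le> ennreal (900 * \<sigma>\<^sup>2) * ennreal (4 * real (Suc d))"
      by (intro mult_left_mono) auto
    also have "ennreal (900 * \<sigma>\<^sup>2) * (\<Sum>i<Suc d. \<integral>\<^sup>+\<omega>. ennreal ((snd \<omega> i)\<^sup>2) \<partial>coin_space) = (\<integral>\<^sup>+\<omega>. F3 \<omega> \<partial>coin_space)"
    proof -
      have "(\<integral>\<^sup>+\<omega>. (\<Sum>i<Suc d. ennreal ((snd \<omega> i)\<^sup>2)) \<partial>coin_space) = (\<Sum>i<Suc d. \<integral>\<^sup>+\<omega>. ennreal ((snd \<omega> i)\<^sup>2) \<partial>coin_space)"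
        by (rule nn_integral_sum) measurable
      moreover have "(\<integral>\<^sup>+\<omega>. F3 \<omega> \<partial>coin_space) = ennreal (900 * \<sigma>\<^sup>2) * (\<integral>\<^sup>+\<omega>. (\<Sum>i<Suc d. ennreal ((snd \<omega> i)\<^sup>2)) \<partial>coin_space)"
        unfolding F3_def by (rule nn_integral_cmult) measurable
      ultimately show ?thesis by (simp only:)
    qed
    finally show "(\<integral>\<^sup>+\<omega>. F3 \<omega> \<partial>coin_space) \<le> ennreal (900 * \<sigma>\<^sup>2 * (4 * real (Suc d)))"
      by (simp only: ennreal_mult'')
  qed
  also have "\<dots> = ennreal (2500 / (n * \<gamma>\<^sup>2 * \<eta>) + 6 * (10000 * \<sigma>\<^sup>2 / (9 * \<gamma>\<^sup>2)) + 900 * \<sigma>\<^sup>2 * (4 * real (Suc d)))"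
  proof -
    have plus: "ennreal a + ennreal b + ennreal c = ennreal (a + b + c)" if "0 \<le> a" "0 \<le> b" "0 \<le> c" for a b c
      using that by simp
    show ?thesis by (rule plus) (use g h in auto)
  qed
  finally show ?thesis .
qed

lemma measurable_noisy_mean:
  assumes D: "distribution d D"
  shows "(\<lambda>(s, \<omega>). noisy_mean d \<gamma> \<eta> \<sigma> n (map s [0..<n]) \<omega>)
    \<in> measurable (Pi\<^sub>M {..<n} (\<lambda>_. D) \<Otimes>\<^sub>M coin_space) (Pi\<^sub>M UNIV (\<lambda>_. borel))"
proof (rule measurable_PiM_single')
  fix i
  have [measurable]: "(\<lambda>p. sgd_mean d \<gamma> \<eta> n (map (fst p) [0..<n]) i) \<in> borel_measurable (Pi\<^sub>M {..<n} (\<lambda>_. D) \<Otimes>\<^sub>M coin_space)"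
    using measurable_compose[OF measurable_fst measurable_sgd_mean[OF D]] .
  have [measurable]: "(\<lambda>p. snd (snd p) i) \<in> borel_measurable (Pi\<^sub>M {..<n} (\<lambda>_. D) \<Otimes>\<^sub>M coin_space)"
    using measurable_compose[OF measurable_snd measurable_coin_normal] .
  show "(\<lambda>p. (case p of (s, \<omega>) \<Rightarrow> noisy_mean d \<gamma> \<eta> \<sigma> n (map s [0..<n]) \<omega>) i) \<in> borel_measurable (Pi\<^sub>M {..<n} (\<lambda>_. D) \<Otimes>\<^sub>M coin_space)"
    unfolding noisy_mean_def case_prod_beta by (cases "i < Suc d") simp_all
qed auto

text \<open>Markov's inequality over sample and coins together: an expected risk of at most
  \<open>\<alpha> * \<xi>\<close> exceeds \<open>\<alpha>\<close> with probability at most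
  \<open>\<xi>\<close>.\<close>

lemma robust_learner_noisy_mean:
  assumes g: "0 < \<gamma>" "\<gamma> \<le> 1" and h: "0 < \<eta>" "\<eta> \<le> 1/2" and n: "0 < n" and a: "0 < \<alpha>" and xi: "0 \<le> \<xi>"
    and bound: "2500 / (n * \<gamma>\<^sup>2 * \<eta>) + 6 * (10000 * \<sigma>\<^sup>2 / (9 * \<gamma>\<^sup>2)) + 900 * \<sigma>\<^sup>2 * (4 * real (Suc d)) \<le> \<alpha> * \<xi>"
  shows "robust_learner d \<gamma> (0.9 * \<gamma>) \<alpha> \<xi> n coin_space
    (\<lambda>X \<omega>. affine_hypothesis d \<gamma> (noisy_mean d \<gamma> \<eta> \<sigma> n X \<omega>))"
  unfolding robust_learner_def
proof (intro allI impI, elim conjE)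
  fix D assume D: "distribution d D" "realizable d \<gamma> D"
  have D': "prob_space D" using D(1) by (simp add: distribution_def)
  let ?P = "Pi\<^sub>M {..<n} (\<lambda>_. D)"
  interpret C: prob_space coin_space by (rule prob_space_coin_space)
  have "prob_space (?P \<Otimes>\<^sub>M coin_space)"
    by (intro prob_space_pair prob_space_PiM D' prob_space_coin_space)
  then interpret M: prob_space "?P \<Otimes>\<^sub>M coin_space" .
  define R where "R p = robust_risk d (0.9 * \<gamma>) (affine_hypothesis d \<gamma> (noisy_mean d \<gamma> \<eta> \<sigma> n (map (fst p) [0..<n]) (snd p))) D" for p
  have R[measurable]: "R \<in> borel_measurable (?P \<Otimes>\<^sub>M coin_space)"
  proof -
    have "(\<lambda>v. robust_risk d (0.9 * \<gamma>) (affine_hypothesis d \<gamma> v) D) \<in> borel_measurable (Pi\<^sub>M UNIV (\<lambda>_. borel))"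
      by (rule robust_risk_affine_hypothesis(2)[OF D(1)]) (use g in auto)
    from measurable_compose[OF measurable_noisy_mean[OF D(1)] this] show ?thesis
      by (simp add: R_def[abs_def] case_prod_beta)
  qed
  have "(\<integral>\<^sup>+p. R p \<partial>(?P \<Otimes>\<^sub>M coin_space)) = (\<integral>\<^sup>+s. (\<integral>\<^sup>+\<omega>. R (s, \<omega>) \<partial>coin_space) \<partial>?P)"
    by (rule C.nn_integral_fst[symmetric]) measurable
  also have "\<dots> \<le> ennreal (\<alpha> * \<xi>)"
    unfolding R_def fst_conv snd_conv using nn_integral_robust_risk[OF D g h n, of \<sigma>] bound
    by (rule order_trans[OF _ ennreal_leI])
  finally have int: "(\<integral>\<^sup>+p. R p \<partial>(?P \<Otimes>\<^sub>M coin_space)) \<le> ennreal (\<alpha> * \<xi>)" .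
  let ?G = "{p \<in> space (?P \<Otimes>\<^sub>M coin_space). R p \<le> ennreal \<alpha>}"
  let ?B = "{p \<in> space (?P \<Otimes>\<^sub>M coin_space). 1 \<le> ennreal (1 / \<alpha>) * R p}"
  have "emeasure (?P \<Otimes>\<^sub>M coin_space) ?B \<le> ennreal (1 / \<alpha>) * (\<integral>\<^sup>+p. R p \<partial>(?P \<Otimes>\<^sub>M coin_space))"
    using nn_integral_Markov_inequality[of R "space (?P \<Otimes>\<^sub>M coin_space)" "?P \<Otimes>\<^sub>M coin_space" "ennreal (1 / \<alpha>)"]
    by (simp add: nn_set_integral_space)
  also have "\<dots> \<le> ennreal (1 / \<alpha>) * ennreal (\<alpha> * \<xi>)"
    by (intro mult_left_mono int) simp
  also have "\<dots> = ennreal \<xi>" using a xi by (simp add: ennreal_mult[symmetric])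
  finally have B: "measure (?P \<Otimes>\<^sub>M coin_space) ?B \<le> \<xi>"
    using xi by (simp add: M.emeasure_eq_measure)
  have "space (?P \<Otimes>\<^sub>M coin_space) - ?G \<subseteq> ?B"
  proof
    fix p assume p: "p \<in> space (?P \<Otimes>\<^sub>M coin_space) - ?G"
    then have "ennreal (1 / \<alpha>) * ennreal \<alpha> \<le> ennreal (1 / \<alpha>) * R p"
      by (intro mult_left_mono) auto
    then show "p \<in> ?B" using p a by (simp add: ennreal_mult[symmetric])
  qed
  then have "measure (?P \<Otimes>\<^sub>M coin_space) (space (?P \<Otimes>\<^sub>M coin_space) - ?G) \<le> measure (?P \<Otimes>\<^sub>M coin_space) ?B"
    by (intro M.finite_measure_mono) measurable
  moreover have "measure (?P \<Otimes>\<^sub>M coin_space) (space (?P \<Otimes>\<^sub>M coin_space) - ?G) = 1 - measure (?P \<Otimes>\<^sub>M coin_space) ?G"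
    by (rule M.prob_compl) measurable
  ultimately have "1 - \<xi> \<le> measure (?P \<Otimes>\<^sub>M coin_space) ?G" using B by linarith
  also have "?G = {(s, \<omega>) \<in> space (?P \<Otimes>\<^sub>M coin_space).
      robust_risk d (0.9 * \<gamma>) (affine_hypothesis d \<gamma> (noisy_mean d \<gamma> \<eta> \<sigma> n (map s [0..<n]) \<omega>)) D \<le> ennreal \<alpha>}"
    by (auto simp: R_def)
  finally show "1 - \<xi> \<le> measure (?P \<Otimes>\<^sub>M coin_space) {(s, \<omega>) \<in> space (?P \<Otimes>\<^sub>M coin_space).
      robust_risk d (0.9 * \<gamma>) (affine_hypothesis d \<gamma> (noisy_mean d \<gamma> \<eta> \<sigma> n (map s [0..<n]) \<omega>)) D \<le> ennreal \<alpha>}" .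
qed

text \<open>In units of \<open>\<sigma>\<close>, replacing \<open>X'\<close> by \<open>X\<close>
  translates the standard Gaussian vector by the difference of the two means. Its squared norm is at
  most \<open>\<kappa>\<close> by \<open>sgd_mean_sensitivity\<close>, and everything after the
  noise is post-processing common to both.\<close>

lemma differentially_private_noisy_mean:
  assumes g: "0 < \<gamma>" "\<gamma> \<le> 1" and h: "0 < \<eta>" "\<eta> \<le> 1" and n: "0 < n" and eps: "0 < \<epsilon>"
    and del: "0 < \<delta>" "\<delta> < 1" and s: "0 < \<sigma>"
    and k: "\<kappa> = ((2 * \<eta> * \<gamma> + 2 / n) / \<sigma>)\<^sup>2" and k1: "2 * \<kappa> \<le> \<epsilon>" and k2: "4 * \<kappa> * ln (1 / \<delta>) \<le> \<epsilon>\<^sup>2"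
  shows "differentially_private (datasets d) coin_space (Pi\<^sub>M UNIV (\<lambda>_. borel)) \<epsilon> \<delta> (noisy_mean d \<gamma> \<eta> \<sigma> n)"
  unfolding differentially_private_def
proof (intro conjI ballI impI)
  interpret C: prob_space coin_space by (rule prob_space_coin_space)
  have meas: "noisy_mean d \<gamma> \<eta> \<sigma> n X \<in> measurable coin_space (Pi\<^sub>M UNIV (\<lambda>_. borel))" for X
  proof (rule measurable_PiM_single')
    fix i
    show "(\<lambda>\<omega>. noisy_mean d \<gamma> \<eta> \<sigma> n X \<omega> i) \<in> borel_measurable coin_space"
      unfolding noisy_mean_def by (cases "i < Suc d") simp_all
  qed auto
  show "noisy_mean d \<gamma> \<eta> \<sigma> n X \<in> measurable coin_space (Pi\<^sub>M UNIV (\<lambda>_. borel))" for X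
    by (rule meas)
  fix X X' :: "example list" and S :: "point set"
  assume X: "X \<in> datasets d" "X' \<in> datasets d" "neighbors X X'" and S: "S \<in> sets (Pi\<^sub>M UNIV (\<lambda>_. borel))"
  let ?m = "Suc d" and ?w = "sgd_mean d \<gamma> \<eta> n"
  define out where "out Y z = (\<lambda>i. if i < ?m then ?w Y i + \<sigma> * z i else 0)" for Y and z :: point
  define c where "c i = (?w X i - ?w X' i) / \<sigma>" for i
  define f where "f Y z = (indicator S (out Y z) :: ennreal)" for Y z
  have f[measurable]: "f Y \<in> borel_measurable (Pi\<^sub>M {..<?m} (\<lambda>_. gauss))" for Y
  proof -
    have "out Y \<in> measurable (Pi\<^sub>M {..<?m} (\<lambda>_. gauss)) (Pi\<^sub>M UNIV (\<lambda>_. borel))"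
    proof (rule measurable_PiM_single')
      fix i
      show "(\<lambda>z. out Y z i) \<in> borel_measurable (Pi\<^sub>M {..<?m} (\<lambda>_. gauss))"
        unfolding out_def by (cases "i < ?m") simp_all
    qed auto
    from measurable_compose[OF this borel_measurable_indicator[OF S]] show ?thesis
      by (simp add: f_def[abs_def])
  qed
  have prob: "emeasure coin_space {\<omega> \<in> space coin_space. noisy_mean d \<gamma> \<eta> \<sigma> n Y \<omega> \<in> S}
      = (\<integral>\<^sup>+z. f Y z \<partial>Pi\<^sub>M {..<?m} (\<lambda>_. gauss))" for Y
  proof -
    have "emeasure coin_space {\<omega> \<in> space coin_space. noisy_mean d \<gamma> \<eta> \<sigma> n Y \<omega> \<in> S}
        = (\<integral>\<^sup>+\<omega>. indicator {\<omega> \<in> space coin_space. noisy_mean d \<gamma> \<eta> \<sigma> n Y \<omega> \<in> S} \<omega> \<partial>coin_space)"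
      using measurable_sets[OF meas S] by (subst nn_integral_indicator) (auto simp: vimage_def)
    also have "\<dots> = (\<integral>\<^sup>+\<omega>. f Y (restrict (snd \<omega>) {..<?m}) \<partial>coin_space)"
    proof (intro nn_integral_cong)
      fix \<omega>
      have "out Y (restrict (snd \<omega>) {..<?m}) = noisy_mean d \<gamma> \<eta> \<sigma> n Y \<omega>"
        by (auto simp: out_def noisy_mean_def)
      then show "indicator {\<omega> \<in> space coin_space. noisy_mean d \<gamma> \<eta> \<sigma> n Y \<omega> \<in> S} \<omega> = f Y (restrict (snd \<omega>) {..<?m})"
        by (simp add: f_def indicator_def)
    qed
    also have "\<dots> = (\<integral>\<^sup>+z. f Y z \<partial>Pi\<^sub>M {..<?m} (\<lambda>_. gauss))"
      by (rule nn_integral_coins) measurable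
    finally show ?thesis .
  qed
  \<comment> \<open>The difference of the means is absorbed into the noise, so both output laws are
    compared through the same test function \<open>f X'\<close>.\<close>
  have shift: "f X z = f X' (\<lambda>i\<in>{..<?m}. z i + c i)" for z
  proof -
    have "out X z = out X' (\<lambda>i\<in>{..<?m}. z i + c i)"
      using s by (auto simp: out_def c_def fun_eq_iff field_simps)
    then show ?thesis by (simp add: f_def)
  qed
  have "(\<Sum>i<?m. (c i)\<^sup>2) = (L2_set (\<lambda>i. ?w X i - ?w X' i) {..<?m} / \<sigma>)\<^sup>2"
    unfolding c_def L2_set_def power_divide
    by (simp add: sum_nonneg sum_divide_distrib del: sum.lessThan_Suc)
  also have "\<dots> \<le> ((2 * \<eta> * \<gamma> + 2 / n) / \<sigma>)\<^sup>2"
    using g h s n by (intro power_mono divide_right_mono sgd_mean_sensitivity X) auto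
  finally have "(\<Sum>i<?m. (c i)\<^sup>2) \<le> \<kappa>" by (simp only: k)
  moreover have "0 < \<kappa>"
  proof -
    have "0 < 2 * \<eta> * \<gamma> + 2 / n"
      using g h n by (intro add_pos_pos mult_pos_pos divide_pos_pos) auto
    then show ?thesis unfolding k using s by simp
  qed
  ultimately have "(\<integral>\<^sup>+z. f X' (\<lambda>i\<in>{..<?m}. z i + c i) \<partial>Pi\<^sub>M {..<?m} (\<lambda>_. gauss))
      \<le> ennreal (exp \<epsilon>) * (\<integral>\<^sup>+z. f X' z \<partial>Pi\<^sub>M {..<?m} (\<lambda>_. gauss)) + ennreal \<delta>"
    by (intro gaussian_mechanism[where \<kappa>=\<kappa>] eps del k1 k2 f finite_lessThan) (auto simp: f_def indicator_def)
  then have "ennreal (measure coin_space {\<omega> \<in> space coin_space. noisy_mean d \<gamma> \<eta> \<sigma> n X \<omega> \<in> S})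
      \<le> ennreal (exp \<epsilon>) * ennreal (measure coin_space {\<omega> \<in> space coin_space. noisy_mean d \<gamma> \<eta> \<sigma> n X' \<omega> \<in> S}) + ennreal \<delta>"
    by (simp only: shift[symmetric] prob[symmetric] C.emeasure_eq_measure)
  then show "measure coin_space {\<omega> \<in> space coin_space. noisy_mean d \<gamma> \<eta> \<sigma> n X \<omega> \<in> S}
      \<le> exp \<epsilon> * measure coin_space {\<omega> \<in> space coin_space. noisy_mean d \<gamma> \<eta> \<sigma> n X' \<omega> \<in> S} + \<delta>"
    using del by (simp add: ennreal_mult[symmetric] ennreal_plus[symmetric] del: ennreal_plus)
qed

section \<open>Program verification\<close>

text \<open>Total correctness with a step bound. The existential form composes along the program;
  determinism later transfers it to \<open>halts\<close>, \<open>steps\<close> and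
  \<open>result\<close>.\<close>

definition runs :: "coins \<Rightarrow> program \<Rightarrow> state \<Rightarrow> nat \<Rightarrow> (state \<Rightarrow> bool) \<Rightarrow> bool" where
  "runs \<omega> P s T A \<longleftrightarrow> (\<exists>t s'. exec \<omega> P s t s' \<and> t \<le> T \<and> A s')"

lemma runs_result:
  assumes "runs \<omega> P s T A"
  shows "halts \<omega> P s" "steps \<omega> P s \<le> T" "A (result \<omega> P s)"
  using assms unfolding runs_def by (auto simp: exec_result)

lemma runs_mono: "runs \<omega> P s T A \<Longrightarrow> T \<le> T' \<Longrightarrow> (\<And>s'. A s' \<Longrightarrow> B s') \<Longrightarrow> runs \<omega> P s T' B"
  unfolding runs_def by (meson order_trans)

lemma runs_Seq:
  assumes "runs \<omega> P s T A" "\<And>s'. A s' \<Longrightarrow> runs \<omega> Q s' U B"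
  shows "runs \<omega> (Seq P Q) s (T + U) B"
  using assms unfolding runs_def by (meson add_mono exec.Seq)

lemma runs_Cond:
  assumes "holds b s \<Longrightarrow> runs \<omega> P s T A" "\<not> holds b s \<Longrightarrow> runs \<omega> Q s T A"
  shows "runs \<omega> (Cond b P Q) s (Suc T) A"
  using assms unfolding runs_def by (meson Suc_le_mono exec.CondTrue exec.CondFalse)

text \<open>Each of the \<open>N\<close> rounds pays for its test and its body, and the final
  \<open>+ 1\<close> is the failing test. The invariant is indexed by the round, so the number of
  rounds is known exactly.\<close>

lemma runs_While:
  assumes "\<And>i s. i < N \<Longrightarrow> I i s \<Longrightarrow> holds b s \<and> runs \<omega> P s T (I (Suc i))"
    and "\<And>s. I N s \<Longrightarrow> \<not> holds b s" and "I 0 s"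
  shows "runs \<omega> (While b P) s (N * Suc T + 1) (I N)"
proof -
  have "i \<le> N \<Longrightarrow> I i s \<Longrightarrow> runs \<omega> (While b P) s ((N - i) * Suc T + 1) (I N)" for i s
  proof (induction "N - i" arbitrary: i s)
    case 0
    then have "\<not> holds b s" using assms(2)[of s] by simp
    then have "exec \<omega> (While b P) s 1 s" by (rule exec.WhileFalse)
    then show ?case using 0 unfolding runs_def by (intro exI[of _ 1] exI[of _ s]) simp
  next
    case (Suc k)
    then have i: "i < N" by simp
    from assms(1)[OF i Suc.prems(2)] obtain t s' where b: "holds b s" and
      1: "exec \<omega> P s t s'" "t \<le> T" "I (Suc i) s'" by (auto simp: runs_def)
    have "runs \<omega> (While b P) s' ((N - Suc i) * Suc T + 1) (I N)"
      by (rule Suc.hyps(1)) (use Suc.hyps(2) i 1(3) in auto)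
    then obtain u s'' where
      2: "exec \<omega> (While b P) s' u s''" "u \<le> (N - Suc i) * Suc T + 1" "I N s''"
      unfolding runs_def by blast
    have "N - i = Suc (N - Suc i)" using i by simp
    then have "Suc (t + u) \<le> (N - i) * Suc T + 1" using 1(2) 2(2) by simp
    then show ?case using exec.WhileTrue[OF b 1(1) 2(1)] 2(3) unfolding runs_def by blast
  qed
  from this[of 0] assms(3) show ?thesis by simp
qed

fun block :: "instr list \<Rightarrow> program" where
  "block [] = Skip"
| "block (i # is) = Seq (Do i) (block is)"

lemma exec_block: "exec \<omega> (block is) s (length is) (fold (exec_instr \<omega>) is s)"
proof (induction "is" arbitrary: s)
  case (Cons i "is")
  have "exec \<omega> (Seq (Do i) (block is)) s (1 + length is) (fold (exec_instr \<omega>) is (exec_instr \<omega> i s))"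
    by (rule exec.Seq[OF exec.Do Cons.IH])
  then show ?case by simp
qed (simp add: exec.Skip)

lemma runs_block: "A (fold (exec_instr \<omega>) is s) \<Longrightarrow> runs \<omega> (block is) s (length is) A"
  unfolding runs_def using exec_block by blast

lemma runs_block': "A (fold (exec_instr \<omega>) is s) \<Longrightarrow> length is \<le> T \<Longrightarrow> runs \<omega> (block is) s T A"
  by (rule runs_mono[OF runs_block])

lemma runs_Cond':
  assumes "holds b s \<Longrightarrow> runs \<omega> P s 1 A" "\<not> holds b s \<Longrightarrow> runs \<omega> Q s 1 A"
  shows "runs \<omega> (Cond b P Q) s 2 A"
  using runs_Cond[OF assms] by (simp add: numeral_2_eq_2)

text \<open>Loops that count register 4 up to the value of register 5; register 6 holds the increment 1.\<close>

definition repeat_block :: "instr list \<Rightarrow> program" where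
  "repeat_block is = While (NLess 4 5) (block (is @ [NAdd 4 4 6]))"

text \<open>The \<open>+ 2\<close> per round is the loop test and the increment.\<close>

lemma runs_repeat_block:
  assumes "\<And>i s. i < N \<Longrightarrow> I i s \<Longrightarrow> nreg s 4 = i \<and> nreg s 5 = N \<and>
      I (Suc i) (exec_instr \<omega> (NAdd 4 4 6) (fold (exec_instr \<omega>) is s))"
    and "\<And>s. I N s \<Longrightarrow> nreg s 4 = N \<and> nreg s 5 = N" and "I 0 s"
    and T: "T = N * (length is + 2) + 1"
  shows "runs \<omega> (repeat_block is) s T (I N)"
proof -
  have "runs \<omega> (While (NLess 4 5) (block (is @ [NAdd 4 4 6]))) s (N * Suc (length (is @ [NAdd 4 4 6])) + 1) (I N)"
    by (rule runs_While[where I=I]) (use assms in \<open>auto intro!: runs_block'\<close>)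
  then show ?thesis by (simp add: repeat_block_def T)
qed

section \<open>The inner loops of the two programs\<close>

definition unchanged :: "nat set \<Rightarrow> nat set \<Rightarrow> state \<Rightarrow> state \<Rightarrow> bool" where
  "unchanged N R s s' \<longleftrightarrow> (\<forall>r. r \<notin> N \<longrightarrow> nreg s' r = nreg s r) \<and> (\<forall>r. r \<notin> R \<longrightarrow> rreg s' r = rreg s r)"

text \<open>One sweep adds the current iterate to the running sum in \<open>Out\<close> and forms
  its inner product with the current row. It has to precede the update, since
  \<open>trajectory_sum\<close> counts iterates before their example.\<close>

definition accumulate_loop :: program where
  "accumulate_loop = repeat_block
    [Load 1 Work 4, Load 2 Out 4, RAdd 2 2 1, Store Out 4 2, NAdd 7 3 4, Load 3 Inp 7, RMul 3 1 3, RAdd 0 0 3]"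

lemma runs_accumulate_loop:
  assumes "nreg s 4 = 0" "nreg s 5 = m" "nreg s 6 = 1" "rreg s 0 = 0"
  shows "runs \<omega> accumulate_loop s (m * 10 + 1) (\<lambda>s'. unchanged {4, 7} {0, 1, 2, 3} s s' \<and> npos s' = npos s \<and>
    mem s' Inp = mem s Inp \<and> mem s' Work = mem s Work \<and>
    mem s' Out = (\<lambda>k. if k < m then mem s Out k + mem s Work k else mem s Out k) \<and>
    rreg s' 0 = (\<Sum>k<m. mem s Work k * mem s Inp (nreg s 3 + k)))"
proof -
  define I where "I j s' \<longleftrightarrow> nreg s' 4 = j \<and> unchanged {4, 7} {0, 1, 2, 3} s s' \<and> npos s' = npos s \<and>
    mem s' Inp = mem s Inp \<and> mem s' Work = mem s Work \<and>
    mem s' Out = (\<lambda>k. if k < j then mem s Out k + mem s Work k else mem s Out k) \<and>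
    rreg s' 0 = (\<Sum>k<j. mem s Work k * mem s Inp (nreg s 3 + k))" for j s'
  have "runs \<omega> accumulate_loop s (m * 10 + 1) (I m)"
    unfolding accumulate_loop_def
  proof (rule runs_repeat_block)
    fix i s' assume i: "i < m" "I i s'"
    then have "nreg s' 5 = m" "nreg s' 6 = 1" "nreg s' 3 = nreg s 3" using assms by (auto simp: I_def unchanged_def)
    with i show "nreg s' 4 = i \<and> nreg s' 5 = m \<and> I (Suc i) (exec_instr \<omega> (NAdd 4 4 6) (fold (exec_instr \<omega>)
      [Load 1 Work 4, Load 2 Out 4, RAdd 2 2 1, Store Out 4 2, NAdd 7 3 4, Load 3 Inp 7, RMul 3 1 3, RAdd 0 0 3] s'))"
      by (auto simp: I_def unchanged_def fun_eq_iff less_Suc_eq)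
  qed (use assms in \<open>auto simp: I_def unchanged_def fun_eq_iff\<close>)
  then show ?thesis
    by (rule runs_mono) (auto simp: I_def)
qed

text \<open>The squared norm that the projection requires is collected in register 12 during the
  same sweep.\<close>

definition update_loop :: program where
  "update_loop = repeat_block
    [NAdd 7 3 4, Load 1 Inp 7, RMul 1 11 1, Load 2 Work 4, RAdd 2 2 1, Store Work 4 2, RMul 2 2 2, RAdd 12 12 2]"

lemma runs_update_loop:
  assumes "nreg s 4 = 0" "nreg s 5 = m" "nreg s 6 = 1" "rreg s 12 = 0"
    and g: "\<And>k. g k = mem s Work k + rreg s 11 * mem s Inp (nreg s 3 + k)"
  shows "runs \<omega> update_loop s (m * 10 + 1) (\<lambda>s'. unchanged {4, 7} {1, 2, 12} s s' \<and> npos s' = npos s \<and>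
    mem s' Inp = mem s Inp \<and> mem s' Out = mem s Out \<and>
    mem s' Work = (\<lambda>k. if k < m then g k else mem s Work k) \<and> rreg s' 12 = ip m g g)"
proof -
  define I where "I j s' \<longleftrightarrow> nreg s' 4 = j \<and> unchanged {4, 7} {1, 2, 12} s s' \<and> npos s' = npos s \<and>
    mem s' Inp = mem s Inp \<and> mem s' Out = mem s Out \<and>
    mem s' Work = (\<lambda>k. if k < j then g k else mem s Work k) \<and> rreg s' 12 = ip j g g" for j s'
  have "runs \<omega> update_loop s (m * 10 + 1) (I m)"
    unfolding update_loop_def
  proof (rule runs_repeat_block)
    fix i s' assume i: "i < m" "I i s'"
    then have "nreg s' 5 = m" "nreg s' 6 = 1" "nreg s' 3 = nreg s 3" "rreg s' 11 = rreg s 11"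
      using assms by (auto simp: I_def unchanged_def)
    with i show "nreg s' 4 = i \<and> nreg s' 5 = m \<and> I (Suc i) (exec_instr \<omega> (NAdd 4 4 6) (fold (exec_instr \<omega>)
      [NAdd 7 3 4, Load 1 Inp 7, RMul 1 11 1, Load 2 Work 4, RAdd 2 2 1, Store Work 4 2, RMul 2 2 2, RAdd 12 12 2] s'))"
      by (auto simp: I_def unchanged_def fun_eq_iff less_Suc_eq g ip_def)
  qed (use assms in \<open>auto simp: I_def unchanged_def fun_eq_iff ip_def\<close>)
  then show ?thesis
    by (rule runs_mono) (auto simp: I_def)
qed

definition scale_loop :: program where
  "scale_loop = repeat_block [Load 1 Work 4, RDiv 1 1 13, Store Work 4 1]"

lemma runs_scale_loop:
  assumes "nreg s 4 = 0" "nreg s 5 = m" "nreg s 6 = 1"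
  shows "runs \<omega> scale_loop s (m * 5 + 1) (\<lambda>s'. unchanged {4} {1} s s' \<and> npos s' = npos s \<and>
    mem s' Inp = mem s Inp \<and> mem s' Out = mem s Out \<and>
    mem s' Work = (\<lambda>k. if k < m then mem s Work k / rreg s 13 else mem s Work k))"
proof -
  define I where "I j s' \<longleftrightarrow> nreg s' 4 = j \<and> unchanged {4} {1} s s' \<and> npos s' = npos s \<and>
    mem s' Inp = mem s Inp \<and> mem s' Out = mem s Out \<and>
    mem s' Work = (\<lambda>k. if k < j then mem s Work k / rreg s 13 else mem s Work k)" for j s'
  have "runs \<omega> scale_loop s (m * 5 + 1) (I m)"
    unfolding scale_loop_def
  proof (rule runs_repeat_block)
    fix i s' assume i: "i < m" "I i s'"
    then have "nreg s' 5 = m" "nreg s' 6 = 1" "rreg s' 13 = rreg s 13"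
      using assms by (auto simp: I_def unchanged_def)
    with i show "nreg s' 4 = i \<and> nreg s' 5 = m \<and> I (Suc i) (exec_instr \<omega> (NAdd 4 4 6) (fold (exec_instr \<omega>)
      [Load 1 Work 4, RDiv 1 1 13, Store Work 4 1] s'))"
      by (auto simp: I_def unchanged_def fun_eq_iff less_Suc_eq)
  qed (use assms in \<open>auto simp: I_def unchanged_def fun_eq_iff\<close>)
  then show ?thesis
    by (rule runs_mono) (auto simp: I_def)
qed

text \<open>No normal is drawn before this loop, so cell \<open>k\<close> receives exactly normal
  coin \<open>k\<close>, as in \<open>noisy_mean\<close>.\<close>

definition noise_loop :: program where
  "noise_loop = repeat_block
    [Load 1 Out 4, RDiv 1 1 9, DrawNormal 2, RMul 2 8 2, RAdd 1 1 2, Store Out 4 1]"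

lemma runs_noise_loop:
  assumes "nreg s 4 = 0" "nreg s 5 = m" "nreg s 6 = 1" "npos s = 0"
  shows "runs \<omega> noise_loop s (m * 8 + 1) (\<lambda>s'.
    mem s' Out = (\<lambda>k. if k < m then mem s Out k / rreg s 9 + rreg s 8 * snd \<omega> k else mem s Out k))"
proof -
  define I where "I j s' \<longleftrightarrow> nreg s' 4 = j \<and> unchanged {4} {1, 2} s s' \<and> npos s' = j \<and>
    mem s' Out = (\<lambda>k. if k < j then mem s Out k / rreg s 9 + rreg s 8 * snd \<omega> k else mem s Out k)" for j s'
  have "runs \<omega> noise_loop s (m * 8 + 1) (I m)"
    unfolding noise_loop_def
  proof (rule runs_repeat_block)
    fix i s' assume i: "i < m" "I i s'"
    then have "nreg s' 5 = m" "nreg s' 6 = 1" "rreg s' 8 = rreg s 8" "rreg s' 9 = rreg s 9"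
      using assms by (auto simp: I_def unchanged_def)
    with i show "nreg s' 4 = i \<and> nreg s' 5 = m \<and> I (Suc i) (exec_instr \<omega> (NAdd 4 4 6) (fold (exec_instr \<omega>)
      [Load 1 Out 4, RDiv 1 1 9, DrawNormal 2, RMul 2 8 2, RAdd 1 1 2, Store Out 4 1] s'))"
      by (auto simp: I_def unchanged_def fun_eq_iff less_Suc_eq)
  qed (use assms in \<open>auto simp: I_def unchanged_def fun_eq_iff\<close>)
  then show ?thesis
    by (rule runs_mono) (auto simp: I_def)
qed

definition dot_loop :: program where
  "dot_loop = repeat_block [Load 1 Work 4, Load 2 Inp 4, RMul 1 1 2, RAdd 0 0 1]"

lemma runs_dot_loop:
  assumes "nreg s 4 = 0" "nreg s 5 = m" "nreg s 6 = 1" "rreg s 0 = 0"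
  shows "runs \<omega> dot_loop s (m * 6 + 1) (\<lambda>s'. rreg s' 0 = ip m (mem s Work) (mem s Inp))"
proof -
  define I where "I j s' \<longleftrightarrow> nreg s' 4 = j \<and> unchanged {4} {0, 1, 2} s s' \<and> mem s' = mem s \<and>
    rreg s' 0 = ip j (mem s Work) (mem s Inp)" for j s'
  have "runs \<omega> dot_loop s (m * 6 + 1) (I m)"
    unfolding dot_loop_def
  proof (rule runs_repeat_block)
    fix i s' assume i: "i < m" "I i s'"
    then have "nreg s' 5 = m" "nreg s' 6 = 1"
      using assms by (auto simp: I_def unchanged_def)
    with i show "nreg s' 4 = i \<and> nreg s' 5 = m \<and> I (Suc i) (exec_instr \<omega> (NAdd 4 4 6) (fold (exec_instr \<omega>)
      [Load 1 Work 4, Load 2 Inp 4, RMul 1 1 2, RAdd 0 0 1] s'))"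
      by (auto simp: I_def unchanged_def fun_eq_iff less_Suc_eq ip_def)
  qed (use assms in \<open>auto simp: I_def unchanged_def fun_eq_iff ip_def\<close>)
  then show ?thesis
    by (rule runs_mono) (auto simp: I_def)
qed

section \<open>The training program\<close>

text \<open>Register 3 holds the address of the current row. The label cell of the row is overwritten by
  \<open>\<gamma>\<close>, which turns the row into the augmented point.\<close>

definition sgd_body :: program where
  "sgd_body =
    Seq (block [NConst 4 0, RConst 0 0, NAdd 7 3 5, NSub 8 7 6, Load 10 Inp 8, Store Inp 8 4])
    (Seq accumulate_loop
    (Seq (block [RMul 0 10 0, RSub 1 4 0])
    (Seq (Cond (RLess 4 1) (block [RAdd 1 4 6]) (block []))
    (Seq (Cond (RLess 1 6) (block [RConst 1 0]) (block []))
    (Seq (block [RMul 11 5 1, RMul 11 11 10, RConst 12 0, NConst 4 0])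
    (Seq update_loop
    (Seq (block [RSqrt 13 12])
    (Seq (Cond (RLess 13 7) (block [RConst 13 1]) (block []))
    (Seq (block [NConst 4 0])
    (Seq scale_loop
    (block [NAdd 3 3 5, NAdd 1 1 6])))))))))))"

definition constants :: "nat \<Rightarrow> real \<Rightarrow> real \<Rightarrow> real \<Rightarrow> nat \<Rightarrow> nat \<Rightarrow> state \<Rightarrow> bool" where
  "constants d \<gamma> \<eta> \<sigma> n l s \<longleftrightarrow> nreg s 2 = l \<and> nreg s 5 = Suc d \<and> nreg s 6 = 1 \<and>
    rreg s 4 = \<gamma> \<and> rreg s 5 = \<eta> \<and> rreg s 6 = 0 \<and> rreg s 7 = 1 \<and> rreg s 8 = \<sigma> \<and> rreg s 9 = n \<and> npos s = 0"

text \<open>The input is only claimed intact from the current row on, because earlier rows have had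
  their label cell overwritten. In \<open>Out\<close> all cells are tracked, as the whole array is
  released.\<close>

definition sgd_invariant :: "nat \<Rightarrow> real \<Rightarrow> real \<Rightarrow> example list \<Rightarrow> nat \<Rightarrow> state \<Rightarrow> bool" where
  "sgd_invariant d \<gamma> \<eta> X i s \<longleftrightarrow> nreg s 1 = i \<and> nreg s 3 = i * Suc d \<and>
    (\<forall>k<Suc d. mem s Work k = sgd d \<gamma> \<eta> (take i X) (\<lambda>_. 0) k) \<and>
    (\<forall>k. mem s Out k = (if k < Suc d then trajectory_sum d \<gamma> \<eta> (take i X) (\<lambda>_. 0) k else 0)) \<and>
    (\<forall>k\<ge>i * Suc d. mem s Inp k = encode_dataset d X k)"

lemma encode_dataset_row:
  assumes "i < length X" "j \<le> d"
  shows "encode_dataset d X (i * Suc d + j) = (if j < d then fst (X ! i) j else snd (X ! i))"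
proof -
  have "(i * Suc d + j) div Suc d = i" "(i * Suc d + j) mod Suc d = j"
    using assms(2) by (simp_all add: div_nat_eqI less_Suc_eq_le add.commute[of _ j] del: mult_Suc_right)
  then show ?thesis using assms(1) by (simp add: encode_dataset_def)
qed

lemma runs_sgd_body:
  assumes c: "constants d \<gamma> \<eta> \<sigma> n l s" and inv: "sgd_invariant d \<gamma> \<eta> X i s" and i: "i < length X"
  shows "runs \<omega> sgd_body s (Suc d * 25 + 30) (\<lambda>s'. constants d \<gamma> \<eta> \<sigma> n l s' \<and> sgd_invariant d \<gamma> \<eta> X (Suc i) s')"
proof -
  define m where "m = Suc d"
  define w where "w = sgd d \<gamma> \<eta> (take i X) (\<lambda>_. 0)"
  define x where "x = augment d \<gamma> (fst (X ! i))"
  define y where "y = snd (X ! i)"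
  define a where "a = pull \<gamma> (margin d \<gamma> w (X ! i))"
  define g where "g = gradient_step d \<gamma> \<eta> (X ! i) w"
  define base where "base = i * Suc d"
  have row: "mem s Inp (base + k) = (if k < d then fst (X ! i) k else y)" if "k < m" for k
    using inv encode_dataset_row[OF i, of k d] that by (simp add: sgd_invariant_def base_def m_def y_def)
  have next_w: "sgd d \<gamma> \<eta> (take (Suc i) X) (\<lambda>_. 0) = project (Suc d) g"
    using i by (simp add: take_Suc_conv_app_nth sgd_step_def g_def w_def)
  have next_sum: "trajectory_sum d \<gamma> \<eta> (take (Suc i) X) (\<lambda>_. 0) = (\<lambda>k. trajectory_sum d \<gamma> \<eta> (take i X) (\<lambda>_. 0) k + w k)"
    using i by (simp add: take_Suc_conv_app_nth trajectory_sum_append trajectory_sum_single w_def)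
  have g: "g k = w k + \<eta> * a * y * x k" for k
    by (simp add: g_def gradient_step_def a_def y_def x_def)
  have margin: "margin d \<gamma> w (X ! i) = y * ip m w x"
    by (simp add: margin_def y_def x_def m_def)
  \<comment> \<open>The part of the assertion common to all intermediate points: the current row is
    already augmented, its label is kept in register 10, and \<open>v\<close> is the content of
    \<open>Work\<close>. \<open>O0\<close> and \<open>O1\<close> describe the running sum before and
    after the current iterate is added.\<close>
  define J where "J v s' \<longleftrightarrow> constants d \<gamma> \<eta> \<sigma> n l s' \<and> nreg s' 1 = i \<and> nreg s' 3 = base \<and>
    (\<forall>k<m. mem s' Inp (base + k) = x k) \<and> (\<forall>k\<ge>base + m. mem s' Inp k = encode_dataset d X k) \<and> rreg s' 10 = y \<and>
    (\<forall>k<m. mem s' Work k = v k)" for v :: point and s' :: state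
  define O0 where "O0 s' \<longleftrightarrow> (\<forall>k. mem s' Out k = (if k < m then trajectory_sum d \<gamma> \<eta> (take i X) (\<lambda>_. 0) k else 0))" for s' :: state
  define O1 where "O1 s' \<longleftrightarrow> (\<forall>k. mem s' Out k = (if k < m then trajectory_sum d \<gamma> \<eta> (take (Suc i) X) (\<lambda>_. 0) k else 0))" for s' :: state
  note defs = J_def constants_def unchanged_def
  have 1: "runs \<omega> (block [NConst 4 0, RConst 0 0, NAdd 7 3 5, NSub 8 7 6, Load 10 Inp 8, Store Inp 8 4]) s 6
      (\<lambda>s'. J w s' \<and> O0 s' \<and> nreg s' 4 = 0 \<and> rreg s' 0 = 0)"
    using c inv row[of d] row
    by (intro runs_block') (auto simp: defs O0_def sgd_invariant_def base_def m_def w_def x_def augment_def)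
  have 2: "runs \<omega> accumulate_loop s' (m * 10 + 1) (\<lambda>s'. J w s' \<and> O1 s' \<and> rreg s' 0 = ip m w x)"
    if "J w s' \<and> O0 s' \<and> nreg s' 4 = 0 \<and> rreg s' 0 = 0" for s'
    by (rule runs_mono[OF runs_accumulate_loop order.refl])
      (use that in \<open>auto simp: defs O0_def O1_def m_def[symmetric] ip_def next_sum\<close>)
  have 3: "runs \<omega> (block [RMul 0 10 0, RSub 1 4 0]) s' 2 (\<lambda>s'. J w s' \<and> O1 s' \<and> rreg s' 1 = \<gamma> - margin d \<gamma> w (X ! i))"
    if "J w s' \<and> O1 s' \<and> rreg s' 0 = ip m w x" for s'
    using that by (intro runs_block') (auto simp: defs O1_def margin)
  \<comment> \<open>Steps 4 and 5 compute \<open>pull\<close> by two conditional assignments; adding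
    register 6, which holds 0, copies \<open>\<gamma>\<close>.\<close>
  have 4: "runs \<omega> (Cond (RLess 4 1) (block [RAdd 1 4 6]) (block [])) s' 2
      (\<lambda>s'. J w s' \<and> O1 s' \<and> rreg s' 1 = min \<gamma> (\<gamma> - margin d \<gamma> w (X ! i)))"
    if "J w s' \<and> O1 s' \<and> rreg s' 1 = \<gamma> - margin d \<gamma> w (X ! i)" for s'
    using that by (intro runs_Cond' runs_block') (auto simp: defs O1_def)
  have 5: "runs \<omega> (Cond (RLess 1 6) (block [RConst 1 0]) (block [])) s' 2
      (\<lambda>s'. J w s' \<and> O1 s' \<and> rreg s' 1 = a)"
    if "J w s' \<and> O1 s' \<and> rreg s' 1 = min \<gamma> (\<gamma> - margin d \<gamma> w (X ! i))" for s'
    using that by (intro runs_Cond' runs_block') (auto simp: defs O1_def a_def pull_def)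
  have 6: "runs \<omega> (block [RMul 11 5 1, RMul 11 11 10, RConst 12 0, NConst 4 0]) s' 4
      (\<lambda>s'. J w s' \<and> O1 s' \<and> rreg s' 11 = \<eta> * a * y \<and> rreg s' 12 = 0 \<and> nreg s' 4 = 0)"
    if "J w s' \<and> O1 s' \<and> rreg s' 1 = a" for s'
    using that by (intro runs_block') (auto simp: defs O1_def)
  have 7: "runs \<omega> update_loop s' (m * 10 + 1) (\<lambda>s'. J g s' \<and> O1 s' \<and> rreg s' 12 = ip m g g)"
    if *: "J w s' \<and> O1 s' \<and> rreg s' 11 = \<eta> * a * y \<and> rreg s' 12 = 0 \<and> nreg s' 4 = 0" for s'
  proof -
    \<comment> \<open>The loop lemma speaks of all cells, but \<open>Work\<close> and the row agree
      with the mathematical vectors only on the first \<open>Suc d\<close> of them.\<close>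
    define g' where "g' k = mem s' Work k + rreg s' 11 * mem s' Inp (nreg s' 3 + k)" for k
    have g': "g' k = g k" if "k < m" for k using * that by (simp add: g'_def g J_def)
    have "ip m g' g' = ip m g g" by (rule ip_cong) (simp_all add: g')
    then show ?thesis
      by (intro runs_mono[OF runs_update_loop[OF _ _ _ _ g'_def] order.refl])
        (use * g' in \<open>auto simp: defs O1_def m_def[symmetric]\<close>)
  qed
  have 8: "runs \<omega> (block [RSqrt 13 12]) s' 1 (\<lambda>s'. J g s' \<and> O1 s' \<and> rreg s' 13 = sqrt (ip m g g))"
    if "J g s' \<and> O1 s' \<and> rreg s' 12 = ip m g g" for s'
    using that by (intro runs_block') (auto simp: defs O1_def)
  have 9: "runs \<omega> (Cond (RLess 13 7) (block [RConst 13 1]) (block [])) s' 2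
      (\<lambda>s'. J g s' \<and> O1 s' \<and> rreg s' 13 = max 1 (sqrt (ip m g g)))"
    if "J g s' \<and> O1 s' \<and> rreg s' 13 = sqrt (ip m g g)" for s'
    using that by (intro runs_Cond' runs_block') (auto simp: defs O1_def)
  have 10: "runs \<omega> (block [NConst 4 0]) s' 1
      (\<lambda>s'. J g s' \<and> O1 s' \<and> rreg s' 13 = max 1 (sqrt (ip m g g)) \<and> nreg s' 4 = 0)"
    if "J g s' \<and> O1 s' \<and> rreg s' 13 = max 1 (sqrt (ip m g g))" for s'
    using that by (intro runs_block') (auto simp: defs O1_def)
  have 11: "runs \<omega> scale_loop s' (m * 5 + 1) (\<lambda>s'. J (project m g) s' \<and> O1 s')"
    if "J g s' \<and> O1 s' \<and> rreg s' 13 = max 1 (sqrt (ip m g g)) \<and> nreg s' 4 = 0" for s'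
    by (rule runs_mono[OF runs_scale_loop order.refl])
      (use that in \<open>auto simp: defs O1_def m_def[symmetric] project_def\<close>)
  have 12: "runs \<omega> (block [NAdd 3 3 5, NAdd 1 1 6]) s' 2
      (\<lambda>s'. constants d \<gamma> \<eta> \<sigma> n l s' \<and> sgd_invariant d \<gamma> \<eta> X (Suc i) s')"
    if "J (project m g) s' \<and> O1 s'" for s'
    using that by (intro runs_block')
      (auto simp: defs O1_def sgd_invariant_def next_w m_def base_def)
  have "runs \<omega> sgd_body s (6 + ((m * 10 + 1) + (2 + (2 + (2 + (4 + ((m * 10 + 1) + (1 + (2 + (1 + ((m * 5 + 1) + 2)))))))))))
    (\<lambda>s'. constants d \<gamma> \<eta> \<sigma> n l s' \<and> sgd_invariant d \<gamma> \<eta> X (Suc i) s')"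
    unfolding sgd_body_def
    by (rule runs_Seq[OF 1], rule runs_Seq[OF 2], assumption, rule runs_Seq[OF 3], assumption,
      rule runs_Seq[OF 4], assumption, rule runs_Seq[OF 5], assumption, rule runs_Seq[OF 6], assumption,
      rule runs_Seq[OF 7], assumption, rule runs_Seq[OF 8], assumption, rule runs_Seq[OF 9], assumption,
      rule runs_Seq[OF 10], assumption, rule runs_Seq[OF 11], assumption, rule 12)
  then show ?thesis by (rule runs_mono) (auto simp: m_def)
qed

text \<open>The two truncated subtractions compute \<open>length X - (length X - n)\<close>, the
  minimum of \<open>length X\<close> and \<open>n\<close>, so datasets of any length are
  handled.\<close>

definition train_program :: "nat \<Rightarrow> real \<Rightarrow> real \<Rightarrow> real \<Rightarrow> nat \<Rightarrow> program" where
  "train_program d \<gamma> \<eta> \<sigma> n =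
    Seq (block [NConst 5 (Suc d), NConst 6 1, NConst 7 n, NSub 8 0 7, NSub 2 0 8,
      RConst 4 \<gamma>, RConst 5 \<eta>, RConst 7 1, RConst 8 \<sigma>, RConst 9 (real n)])
    (Seq (While (NLess 1 2) sgd_body)
    (Seq (block [NConst 4 0]) noise_loop))"

lemma runs_train_program:
  "runs \<omega> (train_program d \<gamma> \<eta> \<sigma> n) (train_state d X)
    (min (length X) n * (Suc d * 25 + 31) + Suc d * 8 + 13)
    (\<lambda>s'. mem s' Out = noisy_mean d \<gamma> \<eta> \<sigma> n X \<omega>)"
proof -
  define l where "l = length X - (length X - n)"
  have l: "l = min (length X) n" by (simp add: l_def)
  let ?I = "\<lambda>i s. constants d \<gamma> \<eta> \<sigma> n l s \<and> sgd_invariant d \<gamma> \<eta> X i s"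
  let ?A = "\<lambda>s. ?I l s \<and> nreg s 4 = 0"
  have 1: "runs \<omega> (block [NConst 5 (Suc d), NConst 6 1, NConst 7 n, NSub 8 0 7, NSub 2 0 8,
      RConst 4 \<gamma>, RConst 5 \<eta>, RConst 7 1, RConst 8 \<sigma>, RConst 9 (real n)]) (train_state d X) 10 (?I 0)"
    by (rule runs_block')
      (simp_all add: constants_def sgd_invariant_def train_state_def init_state_def trajectory_sum_def l_def)
  have 2: "runs \<omega> (While (NLess 1 2) sgd_body) s (l * Suc (Suc d * 25 + 30) + 1) (?I l)" if "?I 0 s" for s
  proof (rule runs_While[where I="?I"])
    fix i s assume i: "i < l" "?I i s"
    then show "holds (NLess 1 2) s \<and> runs \<omega> sgd_body s (Suc d * 25 + 30) (?I (Suc i))"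
      using runs_sgd_body[of d \<gamma> \<eta> \<sigma> n l s X i \<omega>] l by (simp add: constants_def sgd_invariant_def)
  qed (use that in \<open>auto simp: constants_def sgd_invariant_def\<close>)
  have 3: "runs \<omega> (block [NConst 4 0]) s 1 ?A" if "?I l s" for s
    using that by (intro runs_block') (auto simp: constants_def sgd_invariant_def)
  have 4: "runs \<omega> noise_loop s (Suc d * 8 + 1) (\<lambda>s'. mem s' Out = noisy_mean d \<gamma> \<eta> \<sigma> n X \<omega>)" if "?A s" for s
  proof -
    have "take l X = take n X" by (simp add: l min_def)
    then show ?thesis
      by (intro runs_mono[OF runs_noise_loop order.refl])
        (use that in \<open>auto simp: constants_def sgd_invariant_def noisy_mean_def sgd_mean_def fun_eq_iff\<close>)
  qed
  have "runs \<omega> (train_program d \<gamma> \<eta> \<sigma> n) (train_state d X)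
      (10 + ((l * Suc (Suc d * 25 + 30) + 1) + (1 + (Suc d * 8 + 1))))
      (\<lambda>s'. mem s' Out = noisy_mean d \<gamma> \<eta> \<sigma> n X \<omega>)"
    unfolding train_program_def
    by (rule runs_Seq[OF 1], rule runs_Seq[OF 2], assumption, rule runs_Seq[OF 3], assumption, rule 4)
  then show ?thesis by (rule runs_mono) (simp_all add: l)
qed

text \<open>Storing \<open>\<gamma>\<close> in cell \<open>d\<close> of the input augments the
  point, after which prediction is a single inner product.\<close>

definition predict_program :: "nat \<Rightarrow> real \<Rightarrow> program" where
  "predict_program d \<gamma> =
    Seq (block [NConst 5 (Suc d), NConst 6 1, NConst 7 d, RConst 4 \<gamma>, Store Inp 7 4])
    (Seq dot_loop (block [NConst 4 0, Store Out 4 0]))"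

lemma runs_predict_program:
  "runs \<omega> (predict_program d \<gamma>) (predict_state d \<theta> x) (Suc d * 6 + 8) (\<lambda>s'. mem s' Out 0 = score d \<gamma> \<theta> x)"
proof -
  let ?A = "\<lambda>s. nreg s 4 = 0 \<and> nreg s 5 = Suc d \<and> nreg s 6 = 1 \<and> rreg s 0 = 0 \<and> mem s Work = \<theta> \<and>
    (\<forall>k<Suc d. mem s Inp k = augment d \<gamma> x k)"
  have 1: "runs \<omega> (block [NConst 5 (Suc d), NConst 6 1, NConst 7 d, RConst 4 \<gamma>, Store Inp 7 4]) (predict_state d \<theta> x) 5 ?A"
    by (rule runs_block') (auto simp: predict_state_def init_state_def augment_def)
  have 2: "runs \<omega> dot_loop s (Suc d * 6 + 1) (\<lambda>s'. rreg s' 0 = score d \<gamma> \<theta> x)" if "?A s" for s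
  proof -
    have "ip (Suc d) (mem s Work) (mem s Inp) = score d \<gamma> \<theta> x"
      unfolding score_def by (rule ip_cong) (use that in auto)
    then show ?thesis
      by (intro runs_mono[OF runs_dot_loop order.refl]) (use that in auto)
  qed
  have 3: "runs \<omega> (block [NConst 4 0, Store Out 4 0]) s 2 (\<lambda>s'. mem s' Out 0 = score d \<gamma> \<theta> x)"
    if "rreg s 0 = score d \<gamma> \<theta> x" for s
    using that by (intro runs_block') auto
  have "runs \<omega> (predict_program d \<gamma>) (predict_state d \<theta> x) (5 + ((Suc d * 6 + 1) + 2)) (\<lambda>s'. mem s' Out 0 = score d \<gamma> \<theta> x)"
    unfolding predict_program_def
    by (rule runs_Seq[OF 1], rule runs_Seq[OF 2], assumption, rule 3)
  then show ?thesis by (rule runs_mono) simp_all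
qed

lemma trained_train_program: "trained d (train_program d \<gamma> \<eta> \<sigma> n) X \<omega> = noisy_mean d \<gamma> \<eta> \<sigma> n X \<omega>"
  unfolding trained_def by (rule runs_result(3)[OF runs_train_program])

lemma predictor_predict_program: "predictor d (predict_program d \<gamma>) \<theta> = affine_hypothesis d \<gamma> \<theta>"
  unfolding predictor_def affine_hypothesis_def
  by (intro ext) (simp add: runs_result(3)[OF runs_predict_program])

lemma learner_programs: "learner d (train_program d \<gamma> \<eta> \<sigma> n) (predict_program d \<gamma>)"
  unfolding learner_def using runs_result(1)[OF runs_train_program] runs_result(1)[OF runs_predict_program] by blast

lemma runs_in_time_programs:
  assumes n: "0 < n" and d: "0 < d" and T: "160 * (real n * real d) \<le> T"
  shows "runs_in_time d n T (train_program d \<gamma> \<eta> \<sigma> n) (predict_program d \<gamma>)"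
  unfolding runs_in_time_def
proof (intro ballI impI allI conjI)
  fix X :: "example list" and \<omega> x assume X: "length X = n"
  have nd: "d \<le> n * d" "n \<le> n * d" using n d by (auto simp: Suc_le_eq)
  have "1 \<le> n * d" using n d by (simp add: Suc_le_eq)
  have "steps \<omega> (train_program d \<gamma> \<eta> \<sigma> n) (train_state d X) \<le> n * (Suc d * 25 + 31) + Suc d * 8 + 13"
    using runs_result(2)[OF runs_train_program[of \<omega> d \<gamma> \<eta> \<sigma> n X]] X by simp
  also have "\<dots> = 25 * (n * d) + 56 * n + 8 * d + 21" by (simp add: algebra_simps)
  also have "\<dots> \<le> 160 * (n * d)" using nd \<open>1 \<le> n * d\<close> by linarith
  finally have "real (steps \<omega> (train_program d \<gamma> \<eta> \<sigma> n) (train_state d X)) \<le> real (160 * (n * d))"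
    by (simp only: of_nat_le_iff)
  then show "real (steps \<omega> (train_program d \<gamma> \<eta> \<sigma> n) (train_state d X)) \<le> T" using T by simp
  fix x
  let ?s = "predict_state d (trained d (train_program d \<gamma> \<eta> \<sigma> n) X \<omega>) x"
  have "steps no_coins (predict_program d \<gamma>) ?s \<le> Suc d * 6 + 8"
    by (rule runs_result(2)[OF runs_predict_program])
  also have "\<dots> = 6 * d + 14" by simp
  also have "\<dots> \<le> 160 * (n * d)" using nd \<open>1 \<le> n * d\<close> by linarith
  finally have "real (steps no_coins (predict_program d \<gamma>) ?s) \<le> real (160 * (n * d))"
    by (simp only: of_nat_le_iff)
  then show "real (steps no_coins (predict_program d \<gamma>) ?s) \<le> T" using T by simp
qed

section \<open>Choice of the parameters\<close>

text \<open>Write \<open>p\<close> for \<open>\<alpha> * \<xi>\<close>. The step size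
  \<open>\<eta>\<close> makes the optimisation term \<open>p / 3\<close>. Then
  \<open>\<sigma>\<close> is set by privacy: the sensitivity is at most
  \<open>4 * \<eta> * \<gamma> = 30000 / (n * p * \<gamma>)\<close>, so \<open>B\<close> gives a
  ratio of at most \<open>\<epsilon> / (2 * l * C)\<close>. Finally the size of \<open>n\<close>
  gives \<open>\<sigma> * \<gamma> * M \<le> p / 200\<close>; since \<open>\<gamma> * M\<close>
  dominates both \<open>1 / \<gamma>\<close> and \<open>sqrt d\<close>, this one inequality controls
  both noise terms, and the shares \<open>1/3\<close>, \<open>1/6\<close> and \<open>0.18\<close> of
  \<open>p\<close> add up to less than 1.\<close>

lemma noisy_mean_parameters:
  fixes \<alpha> \<xi> \<gamma> \<epsilon> \<delta> C l :: real and d n :: nat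
  defines "M \<equiv> max (sqrt (real d) / \<gamma>) (1 / \<gamma>\<^sup>2)"
    and "B \<equiv> 60000 * l * C / (\<alpha> * \<xi> * \<epsilon>)"
    and "\<eta> \<equiv> 7500 / (n * \<alpha> * \<xi> * \<gamma>\<^sup>2)"
  defines "\<sigma> \<equiv> B / (n * \<gamma>)"
  assumes d: "1 \<le> d" and g: "0 < \<gamma>" "\<gamma> \<le> 1" and a: "0 < \<alpha>" "\<alpha> \<le> 1" and xi: "0 < \<xi>" "\<xi> \<le> 1"
    and C: "1 \<le> C" and eps: "0 < \<epsilon>" "\<epsilon> \<le> C" and del: "0 < \<delta>" and l: "1 \<le> l" "ln (1 / \<delta>) \<le> l"
    and n: "200 * B / (\<alpha> * \<xi>) * M \<le> n"
  shows "0 < n" "0 < \<eta>" "\<eta> \<le> 1/2" "0 < \<sigma>"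
    and "2500 / (n * \<gamma>\<^sup>2 * \<eta>) + 6 * (10000 * \<sigma>\<^sup>2 / (9 * \<gamma>\<^sup>2)) + 900 * \<sigma>\<^sup>2 * (4 * real (Suc d)) \<le> \<alpha> * \<xi>"
    and "2 * ((2 * \<eta> * \<gamma> + 2 / n) / \<sigma>)\<^sup>2 \<le> \<epsilon>"
    and "4 * ((2 * \<eta> * \<gamma> + 2 / n) / \<sigma>)\<^sup>2 * ln (1 / \<delta>) \<le> \<epsilon>\<^sup>2"
proof -
  define p where "p = \<alpha> * \<xi>"
  have p: "0 < p" "p \<le> 1" using a xi by (auto simp: p_def mult_le_one)
  have M: "1 / \<gamma>\<^sup>2 \<le> M" "sqrt d / \<gamma> \<le> M" by (simp_all add: M_def)
  have g2: "0 < \<gamma>\<^sup>2" using g by simp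
  have Mpos: "0 < M" using M(1) g2 by (meson divide_pos_pos less_le_trans zero_less_one)
  have "1 \<le> l * C / \<epsilon>" using mult_mono[of 1 l \<epsilon> C] l eps C by (simp add: divide_simps)
  then have "60000 / p * 1 \<le> 60000 / p * (l * C / \<epsilon>)" using p by (intro mult_left_mono) auto
  also have "\<dots> = B" by (simp add: B_def p_def)
  finally have B: "60000 / p \<le> B" by simp
  have Bpos: "0 < B" using p by (intro less_le_trans[OF _ B]) simp
  have "60000 * 1 / \<gamma>\<^sup>2 \<le> 200 * (60000 / p) / p * (1 / \<gamma>\<^sup>2) * p"
    using p g2 by (simp add: field_simps)
  also have "\<dots> \<le> 200 * B / p * M * p"
    using p g2 B M Bpos Mpos by (intro mult_mono divide_right_mono mult_left_mono) auto
  also have "\<dots> \<le> n * p" using n p unfolding p_def[symmetric] by (intro mult_right_mono) auto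
  finally have np: "60000 / \<gamma>\<^sup>2 \<le> n * p" by simp
  have "0 < n * p" using g2 by (intro less_le_trans[OF _ np]) simp
  then show n0: "0 < n" using p by (simp add: zero_less_mult_iff)
  have eta: "\<eta> = 7500 / (n * p * \<gamma>\<^sup>2)" by (simp add: \<eta>_def p_def mult.assoc)
  show "0 < \<eta>" unfolding eta using n0 p g2 by simp
  have "60000 \<le> n * p * \<gamma>\<^sup>2" using np g2 by (simp add: field_simps)
  then show "\<eta> \<le> 1/2" unfolding eta using n0 p g2 by (simp add: divide_simps)
  show s0: "0 < \<sigma>" unfolding \<sigma>_def using Bpos n0 g by simp
  have "\<sigma> * (\<gamma> * M) = B * M / n" unfolding \<sigma>_def using g n0 by simp
  also have "\<dots> \<le> p / 200"
    using n n0 p unfolding p_def[symmetric] by (simp add: field_simps)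
  finally have sM: "\<sigma> * (\<gamma> * M) \<le> p / 200" .
  have "1 / \<gamma> \<le> \<gamma> * M" using mult_left_mono[OF M(1), of \<gamma>] g by (simp add: power2_eq_square)
  then have "\<sigma> * (1 / \<gamma>) \<le> p / 200" using s0 by (intro order_trans[OF mult_left_mono sM]) auto
  then have "(\<sigma> * (1 / \<gamma>))\<^sup>2 \<le> (p / 200)\<^sup>2" using s0 g by (intro power_mono) auto
  also have "\<dots> \<le> p / 40000" using p by (simp add: power2_eq_square mult_le_one mult_left_le)
  finally have t2: "\<sigma>\<^sup>2 / \<gamma>\<^sup>2 \<le> p / 40000" by (simp add: power_divide)
  have "sqrt d \<le> \<gamma> * M" using mult_left_mono[OF M(2), of \<gamma>] g by simp
  then have "\<sigma> * sqrt d \<le> p / 200" using s0 by (intro order_trans[OF mult_left_mono sM]) auto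
  then have "(\<sigma> * sqrt d)\<^sup>2 \<le> (p / 200)\<^sup>2" using s0 by (intro power_mono) auto
  also have "\<dots> \<le> p / 40000" using p by (simp add: power2_eq_square mult_le_one mult_left_le)
  finally have t3: "\<sigma>\<^sup>2 * d \<le> p / 40000" by (simp add: power_mult_distrib)
  have "2500 / (n * \<gamma>\<^sup>2 * \<eta>) \<le> p / 3" unfolding eta using n0 p g2 by (simp add: field_simps)
  moreover have "6 * (10000 * \<sigma>\<^sup>2 / (9 * \<gamma>\<^sup>2)) \<le> 60000 / 9 * (p / 40000)"
    using mult_left_mono[OF t2, of "60000 / 9"] by simp
  moreover have "900 * \<sigma>\<^sup>2 * (4 * real (Suc d)) \<le> 7200 * (p / 40000)"
  proof -
    have "900 * \<sigma>\<^sup>2 * (4 * real (Suc d)) \<le> 900 * \<sigma>\<^sup>2 * (4 * (2 * real d))"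
      using d by (intro mult_left_mono) auto
    also have "\<dots> = 7200 * (\<sigma>\<^sup>2 * d)" by simp
    also have "\<dots> \<le> 7200 * (p / 40000)" by (intro mult_left_mono t3) simp
    finally show ?thesis .
  qed
  ultimately have "2500 / (n * \<gamma>\<^sup>2 * \<eta>) + 6 * (10000 * \<sigma>\<^sup>2 / (9 * \<gamma>\<^sup>2)) + 900 * \<sigma>\<^sup>2 * (4 * real (Suc d))
      \<le> p / 3 + 60000 / 9 * (p / 40000) + 7200 * (p / 40000)"
    by (intro add_mono)
  also have "\<dots> \<le> p" using p by simp
  finally show "2500 / (n * \<gamma>\<^sup>2 * \<eta>) + 6 * (10000 * \<sigma>\<^sup>2 / (9 * \<gamma>\<^sup>2)) + 900 * \<sigma>\<^sup>2 * (4 * real (Suc d)) \<le> \<alpha> * \<xi>"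
    by (simp only: p_def)
  define q where "q = (2 * \<eta> * \<gamma> + 2 / n) / \<sigma>"
  have eg: "\<eta> * \<gamma> = 7500 / (n * p * \<gamma>)" unfolding eta using g by (simp add: power2_eq_square)
  have "p * \<gamma> \<le> 1" using p g by (intro mult_le_one) auto
  then have "1 / n \<le> \<eta> * \<gamma>" unfolding eg using n0 p g by (simp add: field_simps)
  then have "2 * \<eta> * \<gamma> + 2 / n \<le> 4 * (\<eta> * \<gamma>)" by simp
  then have "q \<le> 4 * (\<eta> * \<gamma>) / \<sigma>" unfolding q_def using s0 by (intro divide_right_mono) auto
  also have "\<dots> = \<epsilon> / (2 * l * C)"
    unfolding eg \<sigma>_def B_def p_def using n0 g a xi l C eps by (simp add: field_simps)
  finally have q: "q \<le> \<epsilon> / (2 * l * C)" .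
  have q0: "0 \<le> q" unfolding q_def using s0 g \<open>0 < \<eta>\<close> by simp
  have "q\<^sup>2 \<le> (\<epsilon> / (2 * l * C))\<^sup>2" using q q0 by (rule power_mono)
  also have "\<dots> = (1 / 4) * \<epsilon>\<^sup>2 / (l * C)\<^sup>2" by (simp add: power_divide power_mult_distrib)
  finally have q2: "4 * (q\<^sup>2 * (l * C)\<^sup>2) \<le> \<epsilon>\<^sup>2" using l C by (simp add: field_simps)
  \<comment> \<open>Here the bound of \<open>\<epsilon>\<close> by the constant \<open>C\<close>
    enters: it lets the one estimate \<open>q2\<close> yield the condition linear in
    \<open>\<epsilon>\<close> as well as the one with \<open>ln (1 / \<delta>)\<close>.\<close>
  have "\<epsilon> \<le> (l * C)\<^sup>2"
  proof -
    have "\<epsilon> \<le> 1 * C" using eps by simp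
    also have "\<dots> \<le> l * C" using l C by (intro mult_right_mono) auto
    also have "\<dots> \<le> (l * C) * (l * C)" using l C mult_mono[of 1 l 1 C] by (intro mult_le_cancel_left1[THEN iffD2]) auto
    finally show ?thesis by (simp add: power2_eq_square)
  qed
  then have "q\<^sup>2 * \<epsilon> \<le> q\<^sup>2 * (l * C)\<^sup>2" by (intro mult_left_mono) auto
  with q2 have "4 * q\<^sup>2 * \<epsilon> \<le> \<epsilon> * \<epsilon>" by (simp add: power2_eq_square)
  then have "4 * q\<^sup>2 \<le> \<epsilon>" using eps by (simp add: mult_le_cancel_right)
  moreover have "0 \<le> q\<^sup>2" by simp
  ultimately show "2 * ((2 * \<eta> * \<gamma> + 2 / n) / \<sigma>)\<^sup>2 \<le> \<epsilon>" unfolding q_def[symmetric] by linarith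
  have "ln (1 / \<delta>) \<le> (l * C)\<^sup>2"
  proof -
    have "ln (1 / \<delta>) \<le> l * 1" using l by simp
    also have "\<dots> \<le> l * C" using l C by (intro mult_left_mono) auto
    also have "\<dots> \<le> (l * C) * (l * C)" using l C mult_mono[of 1 l 1 C] by (intro mult_le_cancel_left1[THEN iffD2]) auto
    finally show ?thesis by (simp add: power2_eq_square)
  qed
  then have "q\<^sup>2 * ln (1 / \<delta>) \<le> q\<^sup>2 * (l * C)\<^sup>2" by (intro mult_left_mono) auto
  with q2 show "4 * ((2 * \<eta> * \<gamma> + 2 / n) / \<sigma>)\<^sup>2 * ln (1 / \<delta>) \<le> \<epsilon>\<^sup>2"
    unfolding q_def[symmetric] by simp
qed

text \<open>The sample size is of order
  \<open>l / (\<alpha>\<^sup>2 * \<xi>\<^sup>2 * \<epsilon>)\<close> times the maximum. As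
  \<open>\<alpha> < 1 \<le> l\<close>, any exponent \<open>K \<ge> 2\<close> covers the powers of
  \<open>\<alpha>\<close> and \<open>l\<close>. The factor 24000000 is \<open>200 * 60000\<close>,
  doubled for rounding up to an integer, and 160 is the constant of the running time.\<close>

lemma private_robust_learner_exists:
  fixes C \<xi> \<gamma> \<alpha> \<epsilon> \<delta> :: real and d :: nat
  defines "l \<equiv> ln (1 / (\<alpha> * \<gamma> * \<delta>))" and "C' \<equiv> max 1 C"
  defines "K \<equiv> 24000000 * C' / \<xi>\<^sup>2 + 160"
  defines "L \<equiv> K * \<alpha> powr (- K) * l powr K"
  assumes xi: "0 < \<xi>" "\<xi> \<le> 1/8" and d: "1 \<le> d" and g: "0 < \<gamma>" "\<gamma> \<le> 1/8" and a: "0 < \<alpha>" "\<alpha> \<le> 1/8"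
    and eps: "0 < \<epsilon>" "\<epsilon> \<le> C" and del: "0 < \<delta>" "\<delta> < 1"
  shows "\<exists>P Q n. learner d P Q \<and> private_learner d \<epsilon> \<delta> P \<and>
    robust_learner d \<gamma> (0.9 * \<gamma>) \<alpha> \<xi> n coin_space (\<lambda>X \<omega>. predictor d Q (trained d P X \<omega>)) \<and>
    real n \<le> L * (1 / \<epsilon>) * max (sqrt (real d) / \<gamma>) (1 / \<gamma>\<^sup>2) \<and>
    runs_in_time d n (L * (real n * real d / \<gamma>)) P Q"
proof -
  have C': "1 \<le> C'" "\<epsilon> \<le> C'" using eps by (auto simp: C'_def)
  have ag: "\<alpha> * \<gamma> \<le> 1/8 * (1/8)" using a g by (intro mult_mono) auto
  have agd: "0 < \<alpha> * \<gamma> * \<delta>" using a g del by simp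
  have "\<alpha> * \<gamma> * \<delta> \<le> 1/8 * (1/8) * 1" using ag a g del by (intro mult_mono) auto
  \<comment> \<open>The threshold \<open>1/8\<close> keeps the argument of the logarithm above
    \<open>exp 1\<close>, so that \<open>l \<ge> 1\<close> and powers of \<open>l\<close> are
    monotone in the exponent.\<close>
  then have "3 \<le> 1 / (\<alpha> * \<gamma> * \<delta>)" using agd by (simp add: field_simps)
  then have "exp 1 \<le> 1 / (\<alpha> * \<gamma> * \<delta>)" using exp_le by linarith
  then have l1: "1 \<le> l" unfolding l_def using agd by (simp add: ln_ge_iff)
  have "\<alpha> * \<gamma> * \<delta> \<le> 1 * \<delta>" using ag del by (intro mult_right_mono) auto
  then have ld: "ln (1 / \<delta>) \<le> l" unfolding l_def using agd del by (simp add: frac_le)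
  define M where "M = max (sqrt (real d) / \<gamma>) (1 / \<gamma>\<^sup>2)"
  have "1 \<le> 1 / \<gamma>\<^sup>2" using g by (simp add: power_le_one)
  then have M1: "1 \<le> M" by (simp add: M_def)
  define B where "B = 60000 * l * C' / (\<alpha> * \<xi> * \<epsilon>)"
  define N where "N = 200 * B / (\<alpha> * \<xi>) * M"
  define n where "n = nat \<lceil>N\<rceil>"
  have N: "N = 12000000 * (l * C' / \<epsilon>) * (1 / (\<alpha> * \<xi>)) * (1 / (\<alpha> * \<xi>)) * M"
    unfolding N_def B_def by simp
  have "1 \<le> l * C' / \<epsilon>" using mult_mono[of 1 l \<epsilon> C'] l1 eps C' by (simp add: divide_simps)
  moreover have "1 \<le> 1 / (\<alpha> * \<xi>)" using a xi by (simp add: mult_le_one)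
  ultimately have "1 * 1 * 1 * 1 * 1 \<le> N" unfolding N using M1 l1 C' eps a xi by (intro mult_mono) auto
  then have N1: "1 \<le> N" by simp
  have nN: "N \<le> n" "n \<le> 2 * N" using N1 unfolding n_def by linarith+
  define \<eta> where "\<eta> = 7500 / (n * \<alpha> * \<xi> * \<gamma>\<^sup>2)"
  define \<sigma> where "\<sigma> = B / (n * \<gamma>)"
  have g1: "\<gamma> \<le> 1" and a1: "\<alpha> \<le> 1" and xi1: "\<xi> \<le> 1" using g a xi by auto
  note par = noisy_mean_parameters[OF d g(1) g1 a(1) a1 xi(1) xi1 C'(1) eps(1) C'(2) del(1) l1 ld
      nN(1)[unfolded N_def B_def M_def], folded B_def, folded \<eta>_def \<sigma>_def]
  let ?P = "train_program d \<gamma> \<eta> \<sigma> n" and ?Q = "predict_program d \<gamma>"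
  have tr: "trained d ?P = noisy_mean d \<gamma> \<eta> \<sigma> n" by (intro ext trained_train_program)
  have K: "2 \<le> K" "160 \<le> K" "24000000 * C' / \<xi>\<^sup>2 \<le> K" using C' xi by (auto simp: K_def)
  have ap: "1 / \<alpha>\<^sup>2 \<le> \<alpha> powr (- K)"
  proof -
    have "1 / \<alpha>\<^sup>2 = \<alpha> powr (- 2)" using a by (simp add: powr_minus_divide)
    also have "\<dots> \<le> \<alpha> powr (- K)" using a K by (intro powr_mono') auto
    finally show ?thesis .
  qed
  have lp: "l \<le> l powr K" using powr_mono[of 1 K l] l1 K by simp
  have "1 \<le> 1 / \<alpha>\<^sup>2" using a by (simp add: power_le_one)
  then have "160 * 1 * 1 \<le> L" unfolding L_def using K ap lp l1 by (intro mult_mono) auto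
  then have L160: "160 \<le> L" by simp
  have "n \<le> 24000000 * C' / \<xi>\<^sup>2 * (1 / \<alpha>\<^sup>2) * l * (1 / \<epsilon>) * M"
    using nN(2) unfolding N by (simp add: power2_eq_square ac_simps)
  also have "\<dots> \<le> L * (1 / \<epsilon>) * M"
    unfolding L_def using K ap lp l1 eps M1 C' by (intro mult_right_mono mult_mono) auto
  finally have size: "n \<le> L * (1 / \<epsilon>) * M" .
  have time: "160 * (real n * real d) \<le> L * (real n * real d / \<gamma>)"
  proof -
    have "real n * real d * 1 \<le> real n * real d * (1 / \<gamma>)" using g by (intro mult_left_mono) auto
    then show ?thesis using L160 by (intro mult_mono) auto
  qed
  have "learner d ?P ?Q" by (rule learner_programs)
  moreover have "private_learner d \<epsilon> \<delta> ?P"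
    unfolding private_learner_def tr
    by (rule differentially_private_noisy_mean[OF g(1) g1 par(2) _ par(1) eps(1) del par(4) refl par(6,7)])
      (use par(3) in simp)
  moreover have "robust_learner d \<gamma> (0.9 * \<gamma>) \<alpha> \<xi> n coin_space (\<lambda>X \<omega>. predictor d ?Q (trained d ?P X \<omega>))"
    unfolding tr predictor_predict_program
    by (rule robust_learner_noisy_mean[OF g(1) g1 par(2,3,1) a(1) _ par(5)]) (use xi in simp)
  moreover have "runs_in_time d n (L * (real n * real d / \<gamma>)) ?P ?Q"
    by (rule runs_in_time_programs[OF par(1) _ time]) (use d in simp)
  ultimately show ?thesis
    using size unfolding M_def by blast
qed

theorem theorem6:
  shows "\<exists>c\<^sub>0::real. 0 < c\<^sub>0 \<and> c\<^sub>0 < 1/4 \<and>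
    (\<forall>C::real. \<forall>\<xi>::real. 0 < C \<longrightarrow> 0 < \<xi> \<longrightarrow> \<xi> \<le> c\<^sub>0 \<longrightarrow>
      (\<exists>K::real. 0 < K \<and>
        (\<forall>(d::nat) (\<gamma>::real) (\<alpha>::real) (\<epsilon>::real) (\<delta>::real).
           1 \<le> d \<longrightarrow> 0 < \<gamma> \<longrightarrow> \<gamma> \<le> c\<^sub>0 \<longrightarrow> 0 < \<alpha> \<longrightarrow> \<alpha> \<le> c\<^sub>0 \<longrightarrow>
           0 < \<epsilon> \<longrightarrow> \<epsilon> \<le> C \<longrightarrow> 0 < \<delta> \<longrightarrow> \<delta> < 1 \<longrightarrow>
           (let L = K * \<alpha> powr (- K) * (ln (1 / (\<alpha> * \<gamma> * \<delta>))) powr K in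
            \<exists>(P::program) (Q::program) (n::nat).
              learner d P Q \<and>
              private_learner d \<epsilon> \<delta> P \<and>
              robust_learner d \<gamma> (0.9 * \<gamma>) \<alpha> \<xi> n coin_space
                (\<lambda>X \<omega>. predictor d Q (trained d P X \<omega>)) \<and>
              real n \<le> L * (1 / \<epsilon>) * max (sqrt (real d) / \<gamma>) (1 / \<gamma>\<^sup>2) \<and>
              runs_in_time d n (L * (real n * real d / \<gamma>)) P Q))))"
proof (rule exI[of _ "1/8"], intro conjI allI impI)
  fix C \<xi> :: real
  assume C: "0 < C" and xi: "0 < \<xi>" "\<xi> \<le> 1/8"
  show "\<exists>K::real. 0 < K \<and>
        (\<forall>(d::nat) (\<gamma>::real) (\<alpha>::real) (\<epsilon>::real) (\<delta>::real).
           1 \<le> d \<longrightarrow> 0 < \<gamma> \<longrightarrow> \<gamma> \<le> 1/8 \<longrightarrow> 0 < \<alpha> \<longrightarrow> \<alpha> \<le> 1/8 \<longrightarrow>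
           0 < \<epsilon> \<longrightarrow> \<epsilon> \<le> C \<longrightarrow> 0 < \<delta> \<longrightarrow> \<delta> < 1 \<longrightarrow>
           (let L = K * \<alpha> powr (- K) * (ln (1 / (\<alpha> * \<gamma> * \<delta>))) powr K in
            \<exists>(P::program) (Q::program) (n::nat).
              learner d P Q \<and>
              private_learner d \<epsilon> \<delta> P \<and>
              robust_learner d \<gamma> (0.9 * \<gamma>) \<alpha> \<xi> n coin_space
                (\<lambda>X \<omega>. predictor d Q (trained d P X \<omega>)) \<and>
              real n \<le> L * (1 / \<epsilon>) * max (sqrt (real d) / \<gamma>) (1 / \<gamma>\<^sup>2) \<and>
              runs_in_time d n (L * (real n * real d / \<gamma>)) P Q))"
  proof (rule exI[of _ "24000000 * max 1 C / \<xi>\<^sup>2 + 160"], intro conjI allI impI)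
    show "0 < 24000000 * max 1 C / \<xi>\<^sup>2 + 160" by (intro add_nonneg_pos divide_nonneg_nonneg) auto
  qed (unfold Let_def, rule private_robust_learner_exists[OF xi], assumption+)
qed simp_all

end
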